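(* The property "semi-integral determinant" of discrete groups is stable under direct limits and inverse limits, subgroup stable, and stable under amenable extensions. That is: (i) if $\pi$ is a direct or an inverse limit of a directed system of groups each having semi-integral determinant, then $\pi$ has semi-integral determinant; (ii) every subgroup of a group with semi-integral determinant has semi-integral determinant; (iii) if $\pi$ contains a normal subgroup $U$ with semi-integral determinant such that the homogeneous space $\pi/U$ is amenable, then $\pi$ has semi-integral determinant.
   Context: For a discrete group $\pi$, $\mathcal N\pi$ is the group von Neumann algebra, containing $\mathbb C\pi$ acting on $\ell^2(\pi)$ by left multiplication; $\operatorname{tr}_\pi(a)=(a\cdot1,1)_{\ell^2(\pi)}$ and $\operatorname{tr}_\pi((a_{ij}))=\sum_i\operatorname{tr}_\pi(a_{ii})$ for $(a_{ij})\in M(d\times d,\mathcal N\pi)$. Matrices act on $\ell^2(\pi)^d$ by left multiplication. For $\Delta\in M(d\times d,\mathcal N\pi)$ positive (semidefinite) self-adjoint, $F_\Delta(\lambda)=\operatorname{tr}_\pi\chi_{[0,\lambda]}(\Delta)$, and $\ln\det_\pi(\Delta)=\int_{0^+}^\infty\ln\lambda\,dF_\Delta(\lambda)$ if the integral converges, $-\infty$ otherwise. The group $\pi$ has semi-integral determinant if $\ln\det_\pi(\Delta)\ge0$ for every $d$ and every positive self-adjoint $\Delta\in M(d\times d,\mathbb Z\pi)$. For a normal subgroup $U$ of $\pi$, the homogeneous space $\pi/U$ is amenable if it carries a $\pi$-invariant metric $d$ with values in $\mathbb N$ such that sets of finite diameter are finite and for all $K>0,\epsilon>0$ there is a nonempty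 finite $X\subset\pi/U$ with $|N_K(X)|\le\epsilon|X|$, where $N_K(X)=\{x: d(x,X)\le K,\ d(x,\pi/U-X)\le K\}$. *)

theory Defs
  imports
    "HOL-Analysis.Analysis"
    "HOL-Algebra.Left_Coset"
    "HOL-Algebra.Product_Groups"
begin

section \<open>The Hilbert spaces and their operators\<close>

text \<open>Elements of the complex Hilbert space of square-summable functions on a set \<open>S\<close> are total
  functions vanishing outside \<open>S\<close>. Operators are total functions as well; only their values on
  \<open>l2 S\<close> are meaningful.\<close>

definition l2 :: "'s set \<Rightarrow> ('s \<Rightarrow> complex) set" where
  "l2 S = {f. (\<forall>x. x \<notin> S \<longrightarrow> f x = 0) \<and> (\<lambda>x. (cmod (f x))\<^sup>2) summable_on S}"

definition l2_inner :: "'s set \<Rightarrow> ('s \<Rightarrow> complex) \<Rightarrow> ('s \<Rightarrow> complex) \<Rightarrow> complex" where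
  "l2_inner S f g = (\<Sum>\<^sub>\<infinity>x\<in>S. f x * cnj (g x))"

definition l2_linear :: "'s set \<Rightarrow> (('s \<Rightarrow> complex) \<Rightarrow> 's \<Rightarrow> complex) \<Rightarrow> bool" where
  "l2_linear S T \<longleftrightarrow> (\<forall>v\<in>l2 S. T v \<in> l2 S) \<and>
     (\<forall>v\<in>l2 S. \<forall>w\<in>l2 S. \<forall>c. T (\<lambda>x. c * v x + w x) = (\<lambda>x. c * T v x + T w x))"

definition self_adjoint_on :: "'s set \<Rightarrow> (('s \<Rightarrow> complex) \<Rightarrow> 's \<Rightarrow> complex) \<Rightarrow> bool" where
  "self_adjoint_on S T \<longleftrightarrow> l2_linear S T \<and>
     (\<forall>v\<in>l2 S. \<forall>w\<in>l2 S. l2_inner S (T v) w = l2_inner S v (T w))"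

definition positive_self_adjoint_on :: "'s set \<Rightarrow> (('s \<Rightarrow> complex) \<Rightarrow> 's \<Rightarrow> complex) \<Rightarrow> bool" where
  "positive_self_adjoint_on S T \<longleftrightarrow> self_adjoint_on S T \<and>
     (\<forall>v\<in>l2 S. 0 \<le> Re (l2_inner S (T v) v))"

definition orth_projection_on :: "'s set \<Rightarrow> (('s \<Rightarrow> complex) \<Rightarrow> 's \<Rightarrow> complex) \<Rightarrow> bool" where
  "orth_projection_on S P \<longleftrightarrow> self_adjoint_on S P \<and> (\<forall>v\<in>l2 S. P (P v) = P v)"


section \<open>Spectral projections\<close>

definition projection_valued_measure ::
  "'s set \<Rightarrow> (real set \<Rightarrow> ('s \<Rightarrow> complex) \<Rightarrow> 's \<Rightarrow> complex) \<Rightarrow> bool" where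
  "projection_valued_measure S E \<longleftrightarrow>
     (\<forall>B\<in>sets borel. orth_projection_on S (E B)) \<and>
     (\<forall>v\<in>l2 S. E UNIV v = v) \<and>
     (\<forall>B\<in>sets borel. \<forall>C\<in>sets borel. \<forall>v\<in>l2 S. E (B \<inter> C) v = E B (E C v)) \<and>
     (\<forall>B. range B \<subseteq> sets borel \<longrightarrow> disjoint_family B \<longrightarrow>
        (\<forall>v\<in>l2 S. \<forall>w\<in>l2 S.
          (\<lambda>n::nat. l2_inner S (E (B n) v) w) sums l2_inner S (E (\<Union>n. B n) v) w))"

definition scalar_spectral_measure ::
  "'s set \<Rightarrow> (real set \<Rightarrow> ('s \<Rightarrow> complex) \<Rightarrow> 's \<Rightarrow> complex) \<Rightarrow> ('s \<Rightarrow> complex) \<Rightarrow> real measure" where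
  "scalar_spectral_measure S E v =
     measure_of UNIV (sets borel) (\<lambda>B. ennreal (Re (l2_inner S (E B v) v)))"

text \<open>\<open>E\<close> is the spectral measure of the bounded self-adjoint operator \<open>T\<close>, i.e. it is boundedly
  supported and \<open>T = \<integral> t dE(t)\<close>. By polarization the quadratic form determines the
  operator, which avoids complex measures. The support condition ensures that the integrals exist.\<close>

definition is_spectral_measure ::
  "'s set \<Rightarrow> (('s \<Rightarrow> complex) \<Rightarrow> 's \<Rightarrow> complex) \<Rightarrow>
    (real set \<Rightarrow> ('s \<Rightarrow> complex) \<Rightarrow> 's \<Rightarrow> complex) \<Rightarrow> bool" where
  "is_spectral_measure S T E \<longleftrightarrow> projection_valued_measure S E \<and>
     (\<exists>K. \<forall>v\<in>l2 S. E {-K..K} v = v) \<and>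
     (\<forall>v\<in>l2 S. l2_inner S (T v) v = of_real (\<integral>t. t \<partial>scalar_spectral_measure S E v))"

text \<open>\<open>spectral_projection S T B\<close> is \<open>\<chi>\<^sub>B(T)\<close>. By the spectral theorem a bounded
  self-adjoint operator has a spectral measure whose values on Borel sets, restricted to \<open>l2 S\<close>,
  are unique; the choice operator only picks the irrelevant values elsewhere.\<close>

definition spectral_projection ::
  "'s set \<Rightarrow> (('s \<Rightarrow> complex) \<Rightarrow> 's \<Rightarrow> complex) \<Rightarrow> real set \<Rightarrow> ('s \<Rightarrow> complex) \<Rightarrow> 's \<Rightarrow> complex" where
  "spectral_projection S T = (SOME E. is_spectral_measure S T E)"


section \<open>Matrices over the integral group ring\<close>

definition int_group_ring :: "('a, 'm) monoid_scheme \<Rightarrow> ('a \<Rightarrow> int) set" where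
  "int_group_ring G = {a. finite {g. a g \<noteq> 0} \<and> {g. a g \<noteq> 0} \<subseteq> carrier G}"

text \<open>The linear extension of \<open>(g f)(x) = f (g\<^sup>-\<^sup>1 x)\<close>.\<close>

definition left_mult_op ::
  "('a, 'm) monoid_scheme \<Rightarrow> ('a \<Rightarrow> int) \<Rightarrow> ('a \<Rightarrow> complex) \<Rightarrow> 'a \<Rightarrow> complex" where
  "left_mult_op G a f x =
     (if x \<in> carrier G then \<Sum>g\<in>{g. a g \<noteq> 0}. of_int (a g) * f (inv\<^bsub>G\<^esub> g \<otimes>\<^bsub>G\<^esub> x) else 0)"

text \<open>The \<open>d\<close>-fold direct sum of \<open>l2 (carrier G)\<close> is \<open>l2 (l2_sum_index G d)\<close>;
  the \<open>i\<close>-th component of \<open>v\<close> is \<open>\<lambda>x. v (i, x)\<close>.\<close>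

definition l2_sum_index :: "('a, 'm) monoid_scheme \<Rightarrow> nat \<Rightarrow> (nat \<times> 'a) set" where
  "l2_sum_index G d = {..<d} \<times> carrier G"

definition matrix_op ::
  "('a, 'm) monoid_scheme \<Rightarrow> nat \<Rightarrow> (nat \<Rightarrow> nat \<Rightarrow> 'a \<Rightarrow> int) \<Rightarrow>
    (nat \<times> 'a \<Rightarrow> complex) \<Rightarrow> nat \<times> 'a \<Rightarrow> complex" where
  "matrix_op G d A v =
     (\<lambda>(i, x). if i < d then \<Sum>j<d. left_mult_op G (A i j) (\<lambda>y. v (j, y)) x else 0)"


section \<open>Trace, spectral density function and determinant\<close>

text \<open>The formulas for the trace make sense for every operator; below they are only applied to
  spectral projections of matrices over the group ring, which are matrices over the group von
  Neumann algebra.\<close>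

definition vn_trace :: "('a, 'm) monoid_scheme \<Rightarrow> (('a \<Rightarrow> complex) \<Rightarrow> 'a \<Rightarrow> complex) \<Rightarrow> complex" where
  "vn_trace G a = (let e = (\<lambda>x. if x = \<one>\<^bsub>G\<^esub> then 1 else 0) in l2_inner (carrier G) (a e) e)"

definition op_entry ::
  "((nat \<times> 'a \<Rightarrow> complex) \<Rightarrow> nat \<times> 'a \<Rightarrow> complex) \<Rightarrow> nat \<Rightarrow> nat \<Rightarrow> ('a \<Rightarrow> complex) \<Rightarrow> 'a \<Rightarrow> complex" where
  "op_entry P i j f = (\<lambda>x. P (\<lambda>(k, y). if k = j then f y else 0) (i, x))"

definition vn_trace_matrix ::
  "('a, 'm) monoid_scheme \<Rightarrow> nat \<Rightarrow> ((nat \<times> 'a \<Rightarrow> complex) \<Rightarrow> nat \<times> 'a \<Rightarrow> complex) \<Rightarrow> complex" where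
  "vn_trace_matrix G d P = (\<Sum>i<d. vn_trace G (op_entry P i i))"

definition spectral_density ::
  "('a, 'm) monoid_scheme \<Rightarrow> nat \<Rightarrow> ((nat \<times> 'a \<Rightarrow> complex) \<Rightarrow> nat \<times> 'a \<Rightarrow> complex) \<Rightarrow> real \<Rightarrow> real" where
  "spectral_density G d T t =
     Re (vn_trace_matrix G d (spectral_projection (l2_sum_index G d) T {0..t}))"

text \<open>The lower limit \<open>0\<^sup>+\<close> excludes the atom of the Stieltjes measure at \<open>0\<close>, which comes from the
  kernel. As the measure is finite and boundedly supported, only the negative part of \<open>ln\<close> can
  fail to be integrable, so that convergence of the improper integral is integrability.\<close>

definition ln_det ::
  "('a, 'm) monoid_scheme \<Rightarrow> nat \<Rightarrow> ((nat \<times> 'a \<Rightarrow> complex) \<Rightarrow> nat \<times> 'a \<Rightarrow> complex) \<Rightarrow> ereal" where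
  "ln_det G d T =
     (if set_integrable (interval_measure (spectral_density G d T)) {0<..} ln
      then ereal (LINT t:{0<..}|interval_measure (spectral_density G d T). ln t)
      else - \<infinity>)"

definition semi_integral_determinant :: "('a, 'm) monoid_scheme \<Rightarrow> bool" where
  "semi_integral_determinant G \<longleftrightarrow>
     (\<forall>d A. (\<forall>i<d. \<forall>j<d. A i j \<in> int_group_ring G) \<longrightarrow>
        positive_self_adjoint_on (l2_sum_index G d) (matrix_op G d A) \<longrightarrow>
        0 \<le> ln_det G d (matrix_op G d A))"


section \<open>Direct and inverse limits of groups\<close>

text \<open>\<open>(i, j) \<in> r\<close> means \<open>i \<le> j\<close>.\<close>

definition directed_index :: "'i set \<Rightarrow> ('i \<times> 'i) set \<Rightarrow> bool" where
  "directed_index I r \<longleftrightarrow> I \<noteq> {} \<and> preorder_on I r \<and>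
     (\<forall>i\<in>I. \<forall>j\<in>I. \<exists>k\<in>I. (i, k) \<in> r \<and> (j, k) \<in> r)"

text \<open>The structure maps \<open>\<phi> i j : G i \<rightarrow> G j\<close>, for \<open>i \<le> j\<close>, need not be injective.\<close>

definition direct_system ::
  "'i set \<Rightarrow> ('i \<times> 'i) set \<Rightarrow> ('i \<Rightarrow> 'a monoid) \<Rightarrow> ('i \<Rightarrow> 'i \<Rightarrow> 'a \<Rightarrow> 'a) \<Rightarrow> bool" where
  "direct_system I r G \<phi> \<longleftrightarrow> directed_index I r \<and>
     (\<forall>i\<in>I. group (G i)) \<and>
     (\<forall>(i, j)\<in>r. \<phi> i j \<in> hom (G i) (G j)) \<and>
     (\<forall>i\<in>I. \<forall>x\<in>carrier (G i). \<phi> i i x = x) \<and>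
     (\<forall>i j k. (i, j) \<in> r \<longrightarrow> (j, k) \<in> r \<longrightarrow>
        (\<forall>x\<in>carrier (G i). \<phi> j k (\<phi> i j x) = \<phi> i k x))"

definition direct_limit_rel ::
  "'i set \<Rightarrow> ('i \<times> 'i) set \<Rightarrow> ('i \<Rightarrow> 'a monoid) \<Rightarrow> ('i \<Rightarrow> 'i \<Rightarrow> 'a \<Rightarrow> 'a) \<Rightarrow> (('i \<times> 'a) \<times> ('i \<times> 'a)) set" where
  "direct_limit_rel I r G \<phi> =
     {((i, x), (j, y)) | i x j y. (i, x) \<in> (SIGMA i:I. carrier (G i)) \<and>
        (j, y) \<in> (SIGMA i:I. carrier (G i)) \<and>
        (\<exists>k. (i, k) \<in> r \<and> (j, k) \<in> r \<and> \<phi> i k x = \<phi> j k y)}"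

text \<open>The disjoint union modulo eventual equality. The unions in the product and in the
  unit run over choices of representatives and upper bounds, all of which yield the same class.\<close>

definition direct_limit ::
  "'i set \<Rightarrow> ('i \<times> 'i) set \<Rightarrow> ('i \<Rightarrow> 'a monoid) \<Rightarrow> ('i \<Rightarrow> 'i \<Rightarrow> 'a \<Rightarrow> 'a) \<Rightarrow> ('i \<times> 'a) set monoid" where
  "direct_limit I r G \<phi> =
     \<lparr>carrier = (SIGMA i:I. carrier (G i)) // direct_limit_rel I r G \<phi>,
      monoid.mult = (\<lambda>A B. \<Union>(i, x)\<in>A. \<Union>(j, y)\<in>B. \<Union>k\<in>{k. (i, k) \<in> r \<and> (j, k) \<in> r}.
                direct_limit_rel I r G \<phi> `` {(k, \<phi> i k x \<otimes>\<^bsub>G k\<^esub> \<phi> j k y)}),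
      one = (\<Union>i\<in>I. direct_limit_rel I r G \<phi> `` {(i, \<one>\<^bsub>G i\<^esub>)})\<rparr>"

text \<open>Here the structure maps go backwards: \<open>\<phi> i j : G j \<rightarrow> G i\<close> for \<open>i \<le> j\<close>.\<close>

definition inverse_system ::
  "'i set \<Rightarrow> ('i \<times> 'i) set \<Rightarrow> ('i \<Rightarrow> 'a monoid) \<Rightarrow> ('i \<Rightarrow> 'i \<Rightarrow> 'a \<Rightarrow> 'a) \<Rightarrow> bool" where
  "inverse_system I r G \<phi> \<longleftrightarrow> directed_index I r \<and>
     (\<forall>i\<in>I. group (G i)) \<and>
     (\<forall>(i, j)\<in>r. \<phi> i j \<in> hom (G j) (G i)) \<and>
     (\<forall>i\<in>I. \<forall>x\<in>carrier (G i). \<phi> i i x = x) \<and>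
     (\<forall>i j k. (i, j) \<in> r \<longrightarrow> (j, k) \<in> r \<longrightarrow>
        (\<forall>x\<in>carrier (G k). \<phi> i j (\<phi> j k x) = \<phi> i k x))"

definition inverse_limit ::
  "'i set \<Rightarrow> ('i \<times> 'i) set \<Rightarrow> ('i \<Rightarrow> 'a monoid) \<Rightarrow> ('i \<Rightarrow> 'i \<Rightarrow> 'a \<Rightarrow> 'a) \<Rightarrow> ('i \<Rightarrow> 'a) monoid" where
  "inverse_limit I r G \<phi> = (product_group I G)
     \<lparr>carrier := {f \<in> carrier (product_group I G). \<forall>(i, j)\<in>r. \<phi> i j (f j) = f i}\<rparr>"


section \<open>Amenable homogeneous spaces\<close>

text \<open>Distance to a set; the distance to the empty set is \<open>\<infinity>\<close>.\<close>

definition set_distance :: "('b \<Rightarrow> 'b \<Rightarrow> nat) \<Rightarrow> 'b \<Rightarrow> 'b set \<Rightarrow> ereal" where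
  "set_distance d x A = (INF a\<in>A. ereal (real (d x a)))"

definition boundary_nbhd :: "'b set \<Rightarrow> ('b \<Rightarrow> 'b \<Rightarrow> nat) \<Rightarrow> real \<Rightarrow> 'b set \<Rightarrow> 'b set" where
  "boundary_nbhd M d K X =
     {x \<in> M. set_distance d x X \<le> ereal K \<and> set_distance d x (M - X) \<le> ereal K}"

text \<open>The group acts on the cosets of \<open>U\<close> by left multiplication. Bounded neighbourhoods of
  finite sets are finite here, so \<open>card\<close> below is only applied to finite sets.\<close>

definition amenable_homogeneous_space :: "('a, 'm) monoid_scheme \<Rightarrow> 'a set \<Rightarrow> bool" where
  "amenable_homogeneous_space G U \<longleftrightarrow>
     (\<exists>d :: 'a set \<Rightarrow> 'a set \<Rightarrow> nat.
        Metric_space (lcosets\<^bsub>G\<^esub> U) (\<lambda>x y. real (d x y)) \<and>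
        (\<forall>g\<in>carrier G. \<forall>x\<in>lcosets\<^bsub>G\<^esub> U. \<forall>y\<in>lcosets\<^bsub>G\<^esub> U.
           d (g <#\<^bsub>G\<^esub> x) (g <#\<^bsub>G\<^esub> y) = d x y) \<and>
        (\<forall>X\<subseteq>lcosets\<^bsub>G\<^esub> U. (\<exists>D. \<forall>x\<in>X. \<forall>y\<in>X. d x y \<le> D) \<longrightarrow> finite X) \<and>
        (\<forall>K>0. \<forall>\<epsilon>>0. \<exists>X\<subseteq>lcosets\<^bsub>G\<^esub> U. finite X \<and> X \<noteq> {} \<and>
           real (card (boundary_nbhd (lcosets\<^bsub>G\<^esub> U) d K X)) \<le> \<epsilon> * real (card X)))"

end

theory Submission
  imports Defs "HOL-Probability.Probability"
begin

text \<open>A positive self-adjoint matrix \<open>A\<close> over the group ring acts with a spectral measure whose trace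
  \<open>\<mu>\<close> is a finite measure on a compact interval, hence determined by the moments \<open>tr A\<^sup>n\<close>, and these
  depend only on finitely many products of group elements. In each of the cases one finds hermitian
  matrices \<open>B\<^sub>k\<close> over groups with semi-integral determinant such that the (normalized) moments of the
  positive matrices \<open>B\<^sub>k\<^sup>2\<close> converge to those of \<open>A\<^sup>2\<close>: matrices obtained along homomorphisms that are
  injective on large finite sets, and compressions of \<open>A\<close> to Folner sets of cosets.

  The logarithmic integral is upper semicontinuous along such a sequence \<open>\<nu>\<^sub>k\<close>: for \<open>0 < e < 1\<close> the continuous
  function \<open>ln (max t e)\<close> has \<open>\<nu>\<^sub>k\<close>-integral at least \<open>ln e\<close> times the mass of \<open>\<nu>\<^sub>k\<close> at \<open>0\<close>. The limit superior of
  these masses is at most the mass of \<open>\<mu>\<close> at \<open>0\<close>, so that the integral of \<open>ln (max t e)\<close> over the positive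
  half line is nonnegative for \<open>\<mu>\<close>; now let \<open>e\<close> tend to \<open>0\<close>. No convergence of the kernels is needed.

  The spectral theorem is obtained from the Hausdorff moment problem: the numbers \<open>(T\<^sup>n v, v)\<close> are the
  moments of a measure depending on \<open>v\<close>, and polarizing these measures gives the spectral projections.\<close>

section \<open>Square-summable functions\<close>

text \<open>Squares are used because positivity is a condition on the whole Hilbert space, which a
  matrix transported along a homomorphism has no reason to inherit. Being hermitian is an identity
  between coefficients and does survive; the square of a hermitian matrix is then positive, and
  ln(t^2) = 2 ln t leads back to A. Integrality is carried along because transport and compression
  only copy or drop coefficients. Convergence of moments controls integrals only if all measures
  live on one compact interval. The row sums of absolute values of coefficients bound the operators,
  and no construction here increases them. \<open>spectral_projection\<close> is an arbitrary choice
  among spectral measures, so existence is not enough: every spectral measure must be shown to have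
  the constructed scalar measures. Since these are described by quadratic forms, complex measures
  are replaced throughout by finite complex combinations of positive ones, and a linear relation
  that holds on monomials is extended to all bounded Borel functions.\<close>

definition delta :: "'s \<Rightarrow> 's \<Rightarrow> complex" where
  "delta a = (\<lambda>x. if x = a then 1 else 0)"

lemma cmod_sq: "(cmod z)\<^sup>2 = Re z * Re z + Im z * Im z"
  by (simp add: cmod_power2 power2_eq_square[of "Re z"] power2_eq_square[of "Im z"])

lemma l2_outside: "f \<in> l2 S \<Longrightarrow> x \<notin> S \<Longrightarrow> f x = 0"
  by (simp add: l2_def)

lemma l2_summable: "f \<in> l2 S \<Longrightarrow> (\<lambda>x. (cmod (f x))\<^sup>2) summable_on S"
  by (simp add: l2_def)

lemma l2_abs_summable:
  assumes "f \<in> l2 S" "g \<in> l2 S"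
  shows "(\<lambda>x. norm (f x * cnj (g x))) summable_on S"
proof -
  have "(\<lambda>x. norm (cmod (f x) * cmod (g x))) summable_on S"
    by (rule abs_summable_product)
      (use l2_summable[OF assms(1)] l2_summable[OF assms(2)] in
        \<open>simp_all add: norm_mult power2_eq_square\<close>)
  then show ?thesis by (simp add: norm_mult)
qed

lemma l2_inner_summable:
  assumes "f \<in> l2 S" "g \<in> l2 S"
  shows "(\<lambda>x. f x * cnj (g x)) summable_on S"
  using l2_abs_summable[OF assms] by (rule Infinite_Sum.abs_summable_summable)

lemma l2_lincomb:
  assumes "f \<in> l2 S" "g \<in> l2 S"
  shows "(\<lambda>x. c * f x + g x) \<in> l2 S"
proof -
  have "(\<lambda>x. (2 * (cmod c)\<^sup>2) * (cmod (f x))\<^sup>2 + 2 * (cmod (g x))\<^sup>2) summable_on S"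
    by (intro summable_on_add summable_on_cmult_right l2_summable assms)
  moreover have "(cmod (c * f x + g x))\<^sup>2 \<le> (2 * (cmod c)\<^sup>2) * (cmod (f x))\<^sup>2 + 2 * (cmod (g x))\<^sup>2" for x
  proof -
    have "(cmod (c * f x + g x))\<^sup>2 \<le> (cmod (c * f x) + cmod (g x))\<^sup>2"
      by (intro power_mono norm_triangle_ineq) auto
    also have "\<dots> \<le> 2 * (cmod (c * f x))\<^sup>2 + 2 * (cmod (g x))\<^sup>2"
      using sum_squares_bound[of "cmod (c * f x)" "cmod (g x)"] by (simp add: power2_sum)
    finally show ?thesis by (simp add: norm_mult power_mult_distrib)
  qed
  ultimately have "(\<lambda>x. (cmod (c * f x + g x))\<^sup>2) summable_on S"
    by (rule summable_on_comparison_test) auto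
  then show ?thesis using assms by (simp add: l2_def)
qed

lemma l2_zero [simp]: "(\<lambda>x. 0) \<in> l2 S"
  by (simp add: l2_def)

lemma l2_add: "f \<in> l2 S \<Longrightarrow> g \<in> l2 S \<Longrightarrow> (\<lambda>x. f x + g x) \<in> l2 S"
  using l2_lincomb[of f S g 1] by simp

lemma l2_scale: "f \<in> l2 S \<Longrightarrow> (\<lambda>x. c * f x) \<in> l2 S"
  using l2_lincomb[of f S "\<lambda>x. 0" c] by simp

lemma l2_diff: "f \<in> l2 S \<Longrightarrow> g \<in> l2 S \<Longrightarrow> (\<lambda>x. f x - g x) \<in> l2 S"
  using l2_lincomb[of g S f "-1"] by simp

lemma l2_finite_support:
  assumes "finite F" "F \<subseteq> S" "\<And>x. x \<notin> F \<Longrightarrow> f x = 0"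
  shows "f \<in> l2 S"
proof -
  have "(\<lambda>x. (cmod (f x))\<^sup>2) summable_on S"
    by (rule finite_nonzero_values_imp_summable_on)
      (rule finite_subset[OF _ assms(1)], use assms in auto)
  then show ?thesis using assms by (auto simp: l2_def)
qed

lemma delta_l2 [simp]: "a \<in> S \<Longrightarrow> delta a \<in> l2 S"
  by (rule l2_finite_support[of "{a}"]) (auto simp: delta_def)

lemma l2_inner_lincomb_left:
  assumes "u \<in> l2 S" "v \<in> l2 S" "w \<in> l2 S"
  shows "l2_inner S (\<lambda>x. c * u x + v x) w = c * l2_inner S u w + l2_inner S v w"
proof -
  have "l2_inner S (\<lambda>x. c * u x + v x) w
      = (\<Sum>\<^sub>\<infinity>x\<in>S. c * (u x * cnj (w x)) + v x * cnj (w x))"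
    unfolding l2_inner_def by (simp add: algebra_simps)
  also have "\<dots> = (\<Sum>\<^sub>\<infinity>x\<in>S. c * (u x * cnj (w x))) + (\<Sum>\<^sub>\<infinity>x\<in>S. v x * cnj (w x))"
    by (intro infsum_add summable_on_cmult_right l2_inner_summable assms)
  also have "(\<Sum>\<^sub>\<infinity>x\<in>S. c * (u x * cnj (w x))) = c * (\<Sum>\<^sub>\<infinity>x\<in>S. u x * cnj (w x))"
    by (rule infsum_cmult_right') 
  finally show ?thesis by (simp add: l2_inner_def)
qed

lemma l2_inner_cnj: "cnj (l2_inner S v w) = l2_inner S w v"
  unfolding l2_inner_def infsum_cnj[symmetric] by (simp add: mult.commute)

lemma l2_inner_lincomb_right:
  assumes "u \<in> l2 S" "v \<in> l2 S" "w \<in> l2 S"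
  shows "l2_inner S w (\<lambda>x. c * u x + v x) = cnj c * l2_inner S w u + l2_inner S w v"
proof -
  have "l2_inner S w (\<lambda>x. c * u x + v x) = cnj (l2_inner S (\<lambda>x. c * u x + v x) w)"
    by (simp add: l2_inner_cnj)
  also have "\<dots> = cnj c * cnj (l2_inner S u w) + cnj (l2_inner S v w)"
    by (simp add: l2_inner_lincomb_left[OF assms])
  finally show ?thesis by (simp add: l2_inner_cnj)
qed

lemma l2_inner_zero [simp]: "l2_inner S (\<lambda>x. 0) w = 0" "l2_inner S w (\<lambda>x. 0) = 0"
  by (simp_all add: l2_inner_def)

lemma l2_inner_scale:
  assumes "v \<in> l2 S" "w \<in> l2 S"
  shows "l2_inner S (\<lambda>x. c * v x) w = c * l2_inner S v w"
    and "l2_inner S v (\<lambda>x. c * w x) = cnj c * l2_inner S v w"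
  using l2_inner_lincomb_left[of v S "\<lambda>x. 0" w c] l2_inner_lincomb_right[of w S "\<lambda>x. 0" v c] assms
  by simp_all

lemma l2_inner_add:
  assumes "u \<in> l2 S" "v \<in> l2 S" "w \<in> l2 S"
  shows "l2_inner S (\<lambda>x. u x + v x) w = l2_inner S u w + l2_inner S v w"
    and "l2_inner S w (\<lambda>x. u x + v x) = l2_inner S w u + l2_inner S w v"
  using l2_inner_lincomb_left[OF assms, of 1] l2_inner_lincomb_right[OF assms, of 1] by simp_all

lemma l2_inner_self:
  assumes "v \<in> l2 S"
  shows "l2_inner S v v = of_real (\<Sum>\<^sub>\<infinity>x\<in>S. (cmod (v x))\<^sup>2)"
proof -
  have "((\<lambda>x. complex_of_real ((cmod (v x))\<^sup>2)) has_sum of_real (\<Sum>\<^sub>\<infinity>x\<in>S. (cmod (v x))\<^sup>2)) S"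
    using l2_summable[OF assms] by (intro has_sum_of_real has_sum_infsum)
  then show ?thesis
    unfolding l2_inner_def complex_norm_square by (rule infsumI)
qed

lemma l2_inner_self_nonneg: "v \<in> l2 S \<Longrightarrow> 0 \<le> Re (l2_inner S v v)"
  by (simp add: l2_inner_self infsum_nonneg)

lemma l2_inner_delta:
  assumes "a \<in> S"
  shows "l2_inner S v (delta a) = v a" "l2_inner S (delta a) v = cnj (v a)"
proof -
  have *: "l2_inner S v (delta a) = v a" for v
  proof -
    have "l2_inner S v (delta a) = (\<Sum>\<^sub>\<infinity>x\<in>{a}. v x * cnj (delta a x))"
      unfolding l2_inner_def by (rule infsum_cong_neutral) (use assms in \<open>auto simp: delta_def\<close>)
    then show ?thesis by (simp add: delta_def)
  qed
  show "l2_inner S v (delta a) = v a" by (rule *)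
  show "l2_inner S (delta a) v = cnj (v a)" using *[of v] l2_inner_cnj[of S v "delta a"] by simp
qed

lemma l2_eqI:
  assumes "u \<in> l2 S" "v \<in> l2 S" "\<And>w. w \<in> l2 S \<Longrightarrow> l2_inner S u w = l2_inner S v w"
  shows "u = v"
proof
  fix x
  show "u x = v x"
  proof (cases "x \<in> S")
    case True
    then show ?thesis using assms(3)[of "delta x"] by (simp add: l2_inner_delta)
  next
    case False
    then show ?thesis using assms l2_outside by metis
  qed
qed

definition restr :: "'s set \<Rightarrow> ('s \<Rightarrow> complex) \<Rightarrow> 's \<Rightarrow> complex" where
  "restr F v = (\<lambda>x. if x \<in> F then v x else 0)"

lemma restr_l2:
  assumes "v \<in> l2 S" shows "restr F v \<in> l2 S"
proof -
  have "(\<lambda>x. (cmod (restr F v x))\<^sup>2) summable_on S"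
    by (rule summable_on_comparison_test[OF l2_summable[OF assms]]) (auto simp: restr_def)
  then show ?thesis using assms by (auto simp: l2_def restr_def)
qed

lemma restr_finite_l2: "finite F \<Longrightarrow> F \<subseteq> S \<Longrightarrow> restr F v \<in> l2 S"
  by (rule l2_finite_support[of F]) (auto simp: restr_def)

lemma l2_inner_restr:
  assumes "finite F" "F \<subseteq> S"
  shows "l2_inner S u (restr F v) = (\<Sum>x\<in>F. u x * cnj (v x))"
proof -
  have "l2_inner S u (restr F v) = (\<Sum>\<^sub>\<infinity>x\<in>F. u x * cnj (v x))"
    unfolding l2_inner_def by (rule infsum_cong_neutral) (use assms in \<open>auto simp: restr_def\<close>)
  then show ?thesis using assms by simp
qed

lemma l2_inner_diff:
  assumes "u \<in> l2 S" "v \<in> l2 S" "w \<in> l2 S"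
  shows "l2_inner S (\<lambda>x. u x - v x) w = l2_inner S u w - l2_inner S v w"
    and "l2_inner S w (\<lambda>x. u x - v x) = l2_inner S w u - l2_inner S w v"
  using l2_inner_lincomb_left[of v S u w "-1"] l2_inner_lincomb_right[of v S u w "-1"] assms
  by (simp_all)

text \<open>A restriction is orthogonal to its remainder, so the squared norm of the remainder is
  the full sum minus a partial sum. This is the density of finitely supported functions, in the
  filter form used for the Riesz representation.\<close>

lemma restr_approx:
  assumes "v \<in> l2 S"
  shows "((\<lambda>F. Re (l2_inner S (\<lambda>x. v x - restr F v x) (\<lambda>x. v x - restr F v x))) \<longlongrightarrow> 0)
    (finite_subsets_at_top S)"
proof -
  have "((\<lambda>F. \<Sum>x\<in>F. (cmod (v x))\<^sup>2) \<longlongrightarrow> (\<Sum>\<^sub>\<infinity>x\<in>S. (cmod (v x))\<^sup>2)) (finite_subsets_at_top S)"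
    by (rule infsum_tendsto[OF l2_summable[OF assms]])
  then have "((\<lambda>F. (\<Sum>\<^sub>\<infinity>x\<in>S. (cmod (v x))\<^sup>2) - (\<Sum>x\<in>F. (cmod (v x))\<^sup>2)) \<longlongrightarrow> 0)
      (finite_subsets_at_top S)"
    by (auto intro!: tendsto_eq_intros)
  moreover have "\<forall>\<^sub>F F in finite_subsets_at_top S.
      (\<Sum>\<^sub>\<infinity>x\<in>S. (cmod (v x))\<^sup>2) - (\<Sum>x\<in>F. (cmod (v x))\<^sup>2)
      = Re (l2_inner S (\<lambda>x. v x - restr F v x) (\<lambda>x. v x - restr F v x))"
  proof (rule eventually_finite_subsets_at_top_weakI)
    fix F assume F: "finite F" "F \<subseteq> S"
    have r: "restr F v \<in> l2 S" using restr_l2 assms by blast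
    have "l2_inner S v (restr F v) = of_real (\<Sum>x\<in>F. (cmod (v x))\<^sup>2)"
      by (simp add: l2_inner_restr[OF F] complex_norm_square[symmetric])
    moreover have "l2_inner S (restr F v) (restr F v) = of_real (\<Sum>x\<in>F. (cmod (v x))\<^sup>2)"
      by (simp add: l2_inner_restr[OF F] complex_norm_square[symmetric]) (simp add: restr_def complex_norm_square[symmetric])
    moreover have "l2_inner S (restr F v) v = cnj (l2_inner S v (restr F v))"
      by (simp add: l2_inner_cnj)
    ultimately show "(\<Sum>\<^sub>\<infinity>x\<in>S. (cmod (v x))\<^sup>2) - (\<Sum>x\<in>F. (cmod (v x))\<^sup>2)
      = Re (l2_inner S (\<lambda>x. v x - restr F v x) (\<lambda>x. v x - restr F v x))"
      using assms r l2_diff[OF assms r] by (simp add: l2_inner_diff l2_inner_self)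
  qed
  ultimately show ?thesis using tendsto_cong by fastforce
qed

section \<open>Cauchy-Schwarz for hermitian forms and the Riesz representation\<close>

text \<open>The form is arbitrary and may be degenerate, because it is later applied to the forms
  that define the spectral projections, before these operators exist.\<close>

lemma form_cauchy_schwarz:
  assumes lin: "\<And>u v w c. u \<in> l2 S \<Longrightarrow> v \<in> l2 S \<Longrightarrow> w \<in> l2 S \<Longrightarrow>
      b (\<lambda>x. c * u x + v x) w = c * b u w + b v w"
    and herm: "\<And>u v. u \<in> l2 S \<Longrightarrow> v \<in> l2 S \<Longrightarrow> b u v = cnj (b v u)"
    and pos: "\<And>u. u \<in> l2 S \<Longrightarrow> 0 \<le> Re (b u u)"
    and "v \<in> l2 S" "w \<in> l2 S"
  shows "(cmod (b v w))\<^sup>2 \<le> Re (b v v) * Re (b w w)"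
proof -
  have real: "b u u = of_real (Re (b u u))" if "u \<in> l2 S" for u
    using herm[OF that that] by (metis Reals_cnj_iff of_real_Re)
  let ?m = "cmod (b v w)"
  \<comment> \<open>Positivity at \<open>t v + b(v,w) w\<close> with real \<open>t\<close>. The
    factor \<open>b(v,w)\<close> aligns the phase, so that a real quadratic polynomial in
    \<open>t\<close> remains.\<close>
  have key: "0 \<le> t\<^sup>2 * Re (b v v) + 2 * t * ?m\<^sup>2 + ?m\<^sup>2 * Re (b w w)" for t :: real
  proof -
    define s :: complex where "s = of_real t"
    define c where "c = b v w"
    define u where "u = (\<lambda>x. s * v x + c * w x)"
    have cw: "(\<lambda>x. c * w x) \<in> l2 S" using assms(5) by (rule l2_scale)
    have u: "u \<in> l2 S" unfolding u_def using assms(4) cw by (rule l2_lincomb)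
    have cwl: "b (\<lambda>x. c * w x) z = c * b w z" if "z \<in> l2 S" for z
    proof -
      have z0: "b (\<lambda>x. 0) z = 0" using lin[of "\<lambda>x. 0" "\<lambda>x. 0" z 1] that by simp
      show ?thesis using lin[of w "\<lambda>x. 0" z c] assms(5) that z0 by simp
    qed
    have ul: "b u z = s * b v z + c * b w z" if "z \<in> l2 S" for z
      unfolding u_def using lin[OF assms(4) cw that] cwl[OF that] by simp
    have "b u u = s * b v u + c * b w u" using ul u by blast
    also have "b v u = cnj (s * b v v + c * b w v)"
      using herm[OF assms(4) u] ul[OF assms(4)] by simp
    also have "b w u = cnj (s * b v w + c * b w w)"
      using herm[OF assms(5) u] ul[OF assms(5)] by simp
    also have "b w v = cnj c" unfolding c_def using herm assms by blast
    finally have buu: "b u u = s * cnj s * cnj (b v v) + s * cnj c * c + c * cnj s * cnj c + c * cnj c * cnj (b w w)"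
      by (simp add: c_def algebra_simps)
    have 1: "Im (b v v) = 0" "Im (b w w) = 0"
      using real[OF assms(4)] real[OF assms(5)] by (metis Im_complex_of_real)+
    have "Re (b u u) = t\<^sup>2 * Re (b v v) + 2 * t * (cmod c)\<^sup>2 + (cmod c)\<^sup>2 * Re (b w w)"
      unfolding buu s_def cmod_sq power2_eq_square[of t] using 1 by (simp add: algebra_simps)
    then have "Re (b u u) = t\<^sup>2 * Re (b v v) + 2 * t * ?m\<^sup>2 + ?m\<^sup>2 * Re (b w w)"
      by (simp only: c_def)
    then show ?thesis using pos[OF u] by simp
  qed
  show ?thesis
  proof (cases "?m = 0")
    case True
    then show ?thesis using pos[OF assms(4)] pos[OF assms(5)] by simp
  next
    case False
    have vv: "0 \<le> Re (b v v)" using pos[OF assms(4)] .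
    show ?thesis
    proof (cases "Re (b v v) = 0")
      case True
      \<comment> \<open>For a null vector \<open>v\<close> the polynomial is affine in
        \<open>t\<close>; this value of \<open>t\<close> would make it negative unless
        \<open>b(v,w) = 0\<close>.\<close>
      have "0 \<le> 2 * (- Re (b w w) - 1) * ?m\<^sup>2 + ?m\<^sup>2 * Re (b w w)"
        using key[of "- Re (b w w) - 1"] True by simp
      also have "\<dots> = - ?m\<^sup>2 * (Re (b w w) + 2)" by (simp add: algebra_simps)
      finally have "Re (b w w) + 2 \<le> 0" using False
        by (simp add: mult_le_0_iff) 
      then show ?thesis using pos[OF assms(5)] by simp
    next
      case False2: False
      let ?a = "Re (b v v)"
      \<comment> \<open>The value of \<open>t\<close> that minimizes the quadratic
        polynomial.\<close>
      have "0 \<le> (-?m\<^sup>2/?a)\<^sup>2 * ?a + 2 * (-?m\<^sup>2/?a) * ?m\<^sup>2 + ?m\<^sup>2 * Re (b w w)"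
        by (rule key)
      also have "\<dots> = ?m\<^sup>2 * (Re (b w w) - ?m\<^sup>2 / ?a)"
        using False2 by (simp add: field_simps power2_eq_square)
      finally have "?m\<^sup>2 / ?a \<le> Re (b w w)" using False by (simp add: zero_le_mult_iff)
      then show ?thesis using vv False2 by (simp add: divide_le_eq mult.commute split: if_splits)
    qed
  qed
qed

lemma l2_sum:
  "finite P \<Longrightarrow> (\<And>p. p \<in> P \<Longrightarrow> u p \<in> l2 S) \<Longrightarrow> (\<lambda>x. \<Sum>p\<in>P. c p * u p x) \<in> l2 S"
  by (induction P rule: finite_induct) (auto intro: l2_lincomb)

lemma l2_inner_sum:
  assumes "finite P" "\<And>p. p \<in> P \<Longrightarrow> u p \<in> l2 S" "w \<in> l2 S"
  shows "l2_inner S (\<lambda>x. \<Sum>p\<in>P. c p * u p x) w = (\<Sum>p\<in>P. c p * l2_inner S (u p) w)"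
  using assms
proof (induction P rule: finite_induct)
  case (insert p P)
  then show ?case by (simp add: l2_inner_lincomb_left l2_sum)
qed simp

lemma l2_cauchy_schwarz:
  assumes "v \<in> l2 S" "w \<in> l2 S"
  shows "(cmod (l2_inner S v w))\<^sup>2 \<le> Re (l2_inner S v v) * Re (l2_inner S w w)"
  by (rule form_cauchy_schwarz[where S=S])
    (use assms in \<open>auto simp: l2_inner_lincomb_left l2_inner_cnj l2_inner_self_nonneg\<close>)

text \<open>The representing vector is written down by coordinates as the values on the
  \<open>delta x\<close>. Testing the functional on finite restrictions of this vector bounds its
  partial sums; the identity then extends from finite supports by continuity. The functional is
  conjugate linear since the inner product is linear in its first argument.\<close>

lemma l2_riesz:
  assumes lin: "\<And>v w c. v \<in> l2 S \<Longrightarrow> w \<in> l2 S \<Longrightarrow> \<phi> (\<lambda>x. c * v x + w x) = cnj c * \<phi> v + \<phi> w"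
    and bd: "\<And>w. w \<in> l2 S \<Longrightarrow> (cmod (\<phi> w))\<^sup>2 \<le> C * Re (l2_inner S w w)"
  defines "u \<equiv> (\<lambda>x. if x \<in> S then \<phi> (delta x) else 0)"
  shows "u \<in> l2 S" and "w \<in> l2 S \<Longrightarrow> l2_inner S u w = \<phi> w"
proof -
  have z: "\<phi> (\<lambda>x. 0) = 0" using lin[of "\<lambda>x. 0" "\<lambda>x. 0" 1] by simp
  have fin: "\<phi> (restr F v) = (\<Sum>x\<in>F. u x * cnj (v x))" if "finite F" "F \<subseteq> S" for F v
    using that
  proof (induction F)
    case empty
    then show ?case using z by (simp add: restr_def)
  next
    case (insert a F)
    have eq: "restr (insert a F) v = (\<lambda>x. v a * delta a x + restr F v x)"
      using insert by (auto simp: restr_def delta_def)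
    have "\<phi> (restr (insert a F) v) = cnj (v a) * \<phi> (delta a) + \<phi> (restr F v)"
      unfolding eq using insert by (intro lin restr_finite_l2) auto
    then show ?case using insert by (simp add: u_def)
  qed
  \<comment> \<open>Over the empty set the bound says nothing about the sign of
    \<open>C\<close>.\<close>
  have C: "0 \<le> C \<or> S = {}"
  proof -
    have "0 \<le> C" if "a \<in> S" for a
      using bd[of "delta a"] that by (simp add: l2_inner_delta) (simp add: delta_def order_trans[OF zero_le_power2])
    then show ?thesis by blast
  qed
  have b: "(\<Sum>x\<in>F. (cmod (u x))\<^sup>2) \<le> C" if F: "finite F" "F \<subseteq> S" "S \<noteq> {}" for F
  proof -
    let ?s = "\<Sum>x\<in>F. (cmod (u x))\<^sup>2"
    have s0: "0 \<le> ?s" by (simp add: sum_nonneg)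
    have "\<phi> (restr F u) = of_real ?s"
      using fin[OF F(1,2), of u] by (simp add: complex_norm_square[symmetric])
    moreover have "Re (l2_inner S (restr F u) (restr F u)) = ?s"
      unfolding l2_inner_restr[OF F(1,2)] Re_sum
      by (rule sum.cong) (auto simp: restr_def cmod_sq)
    \<comment> \<open>The functional takes the value \<open>s\<close> on \<open>restr F u\<close>,
      whose squared norm is also \<open>s\<close>.\<close>
    ultimately have "?s\<^sup>2 \<le> C * ?s"
      using bd[OF restr_finite_l2[OF F(1,2), of u]] by (metis norm_of_real power2_abs)
    then show ?thesis
      using s0 C F(3) by (cases "?s = 0") (auto simp: power2_eq_square)
  qed
  show u: "u \<in> l2 S"
  proof -
    have "(\<lambda>x. (cmod (u x))\<^sup>2) summable_on S"
    proof (cases "S = {}")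
      case False
      show ?thesis
        by (rule nonneg_bounded_partial_sums_imp_summable_on[where C=C])
          (use b False in \<open>auto intro!: eventually_finite_subsets_at_top_weakI\<close>)
    qed simp
    then show ?thesis by (simp add: l2_def u_def)
  qed
  show "l2_inner S u w = \<phi> w" if w: "w \<in> l2 S"
  proof -
    let ?T = "finite_subsets_at_top S"
    let ?r = "\<lambda>F x. w x - restr F w x"
    have rl2: "?r F \<in> l2 S" for F using w restr_l2 l2_diff by blast
    have "((\<lambda>F. \<Sum>x\<in>F. u x * cnj (w x)) \<longlongrightarrow> l2_inner S u w) ?T"
      unfolding l2_inner_def by (rule infsum_tendsto[OF l2_inner_summable[OF u w]])
    moreover have "\<forall>\<^sub>F F in ?T. (\<Sum>x\<in>F. u x * cnj (w x)) = \<phi> (restr F w)"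
      by (rule eventually_finite_subsets_at_top_weakI) (simp add: fin)
    ultimately have lim1: "((\<lambda>F. \<phi> (restr F w)) \<longlongrightarrow> l2_inner S u w) ?T"
      using tendsto_cong by fastforce
    have "((\<lambda>F. (cmod (\<phi> (?r F)))\<^sup>2) \<longlongrightarrow> 0) ?T"
    proof (rule tendsto_sandwich[where f="\<lambda>_. 0"])
      show "((\<lambda>F. C * Re (l2_inner S (?r F) (?r F))) \<longlongrightarrow> 0) ?T"
        using tendsto_mult_left[OF restr_approx[OF w], of C] by simp
      show "\<forall>\<^sub>F F in ?T. (cmod (\<phi> (?r F)))\<^sup>2 \<le> C * Re (l2_inner S (?r F) (?r F))"
        by (intro always_eventually allI bd rl2)
    qed simp_all
    then have "((\<lambda>F. \<phi> (?r F)) \<longlongrightarrow> 0) ?T"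
      using tendsto_real_sqrt[of "\<lambda>F. (cmod (\<phi> (?r F)))\<^sup>2" 0 ?T] tendsto_norm_zero_cancel by force
    then have "((\<lambda>F. \<phi> (?r F) + \<phi> (restr F w)) \<longlongrightarrow> 0 + l2_inner S u w) ?T"
      by (intro tendsto_add lim1)
    moreover have "\<phi> (?r F) + \<phi> (restr F w) = \<phi> w" for F
      using lin[OF rl2[of F] restr_l2[OF w], of 1 F] by simp
    ultimately have "((\<lambda>F. \<phi> w) \<longlongrightarrow> l2_inner S u w) ?T" by simp
    then show ?thesis by (simp add: tendsto_const_iff)
  qed
qed

section \<open>Finite measures on compact intervals\<close>

definition bounded_measure :: "real \<Rightarrow> real measure \<Rightarrow> bool" where
  "bounded_measure K \<mu> \<longleftrightarrow>
     sets \<mu> = sets borel \<and> finite_measure \<mu> \<and> (AE t in \<mu>. \<bar>t\<bar> \<le> K)"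

lemma bounded_measureD:
  assumes "bounded_measure K \<mu>"
  shows "sets \<mu> = sets borel" "finite_measure \<mu>" "AE t in \<mu>. \<bar>t\<bar> \<le> K" "space \<mu> = UNIV"
  using assms sets_eq_imp_space_eq[of \<mu> borel] by (auto simp: bounded_measure_def)

lemma integrable_bounded:
  fixes f :: "real \<Rightarrow> 'b::{banach, second_countable_topology}"
  assumes "sets \<mu> = sets borel" "finite_measure \<mu>" "f \<in> borel_measurable borel" "\<And>t. norm (f t) \<le> C"
  shows "integrable \<mu> f"
  by (rule finite_measure.integrable_const_bound[OF assms(2), of _ C])
    (use assms in \<open>auto cong: measurable_cong_sets\<close>)

lemma bounded_measure_integrable:
  fixes f :: "real \<Rightarrow> 'b::{banach, second_countable_topology}"
  assumes "bounded_measure K \<mu>" "f \<in> borel_measurable borel" "\<And>t. \<bar>t\<bar> \<le> K \<Longrightarrow> norm (f t) \<le> C"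
  shows "integrable \<mu> f"
  by (rule finite_measure.integrable_const_bound[OF bounded_measureD(2)[OF assms(1)], of _ C])
    (use assms bounded_measureD[OF assms(1)] in \<open>auto cong: measurable_cong_sets elim!: eventually_mono\<close>)

lemma bounded_measure_integrable_continuous:
  fixes f :: "real \<Rightarrow> 'b::{banach, second_countable_topology}"
  assumes "bounded_measure K \<mu>" "f \<in> borel_measurable borel" "continuous_on {-K..K} f"
  shows "integrable \<mu> f"
proof -
  have "compact (f ` {-K..K})" using assms(3) by (intro compact_continuous_image) auto
  then obtain C where "\<forall>y\<in>f ` {-K..K}. norm y \<le> C" using compact_imp_bounded bounded_iff by meson
  then show ?thesis by (intro bounded_measure_integrable[OF assms(1,2), of C]) (auto simp: abs_le_iff)
qed

lemma bounded_measure_integrable_power [simp]: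
  "bounded_measure K \<mu> \<Longrightarrow> integrable \<mu> (\<lambda>t. t ^ n :: real)"
  by (rule bounded_measure_integrable_continuous) (auto intro!: continuous_intros)

section \<open>Finite complex combinations of measures\<close>

text \<open>The functional that sends \<open>f\<close> to the sum of the integrals of
  \<open>f * g i\<close> against \<open>\<mu> i\<close> stands for the complex measure with parts
  \<open>g i d\<mu> i\<close>. The next three lemmas show from small classes of test functions that
  such a functional vanishes.\<close>

lemma combination_linear:
  fixes g :: "'i \<Rightarrow> real \<Rightarrow> complex" and f h :: "real \<Rightarrow> real"
  assumes f: "\<And>i. i \<in> I \<Longrightarrow> integrable (\<mu> i) (\<lambda>t. f t *\<^sub>R g i t)"
    and h: "\<And>i. i \<in> I \<Longrightarrow> integrable (\<mu> i) (\<lambda>t. h t *\<^sub>R g i t)"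
  shows "(\<Sum>i\<in>I. \<integral>t. (a * f t + h t) *\<^sub>R g i t \<partial>\<mu> i)
    = a * (\<Sum>i\<in>I. \<integral>t. f t *\<^sub>R g i t \<partial>\<mu> i) + (\<Sum>i\<in>I. \<integral>t. h t *\<^sub>R g i t \<partial>\<mu> i)"
proof -
  have "(\<integral>t. (a * f t + h t) *\<^sub>R g i t \<partial>\<mu> i)
      = a * (\<integral>t. f t *\<^sub>R g i t \<partial>\<mu> i) + (\<integral>t. h t *\<^sub>R g i t \<partial>\<mu> i)" if "i \<in> I" for i
  proof -
    have "(\<integral>t. (a * f t + h t) *\<^sub>R g i t \<partial>\<mu> i)
        = (\<integral>t. a *\<^sub>R (f t *\<^sub>R g i t) + h t *\<^sub>R g i t \<partial>\<mu> i)"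
      by (simp add: scaleR_add_left)
    also have "\<dots> = (\<integral>t. a *\<^sub>R (f t *\<^sub>R g i t) \<partial>\<mu> i) + (\<integral>t. h t *\<^sub>R g i t \<partial>\<mu> i)"
      using f[OF that] h[OF that] by (intro Bochner_Integration.integral_add integrable_scaleR_right)
    finally show ?thesis using f[OF that] by (simp add: scaleR_conv_of_real)
  qed
  then show ?thesis by (simp add: sum.distrib sum_distrib_left)
qed

lemma combination_bounded_convergence:
  fixes g :: "'i \<Rightarrow> real \<Rightarrow> complex"
  assumes \<mu>: "\<And>i. i \<in> I \<Longrightarrow> sets (\<mu> i) = sets borel \<and> finite_measure (\<mu> i)"
    and g: "\<And>i. i \<in> I \<Longrightarrow> g i \<in> borel_measurable borel"
    and gb: "\<And>i t. i \<in> I \<Longrightarrow> norm (g i t) \<le> C"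
    and U: "\<And>n. U n \<in> borel_measurable borel" and Ub: "\<And>n t. \<bar>U n t\<bar> \<le> (D::real)"
    and lim: "\<And>t. (\<lambda>n. U n t) \<longlonglongrightarrow> f t" and f: "f \<in> borel_measurable borel"
    and z: "\<And>n. (\<Sum>i\<in>I. \<integral>t. U n t *\<^sub>R g i t \<partial>\<mu> i) = 0"
  shows "(\<Sum>i\<in>I. \<integral>t. f t *\<^sub>R g i t \<partial>\<mu> i) = 0"
proof -
  have D: "0 \<le> D" using Ub[of 0 0] by linarith
  have "(\<lambda>n. \<Sum>i\<in>I. \<integral>t. U n t *\<^sub>R g i t \<partial>\<mu> i) \<longlonglongrightarrow> (\<Sum>i\<in>I. \<integral>t. f t *\<^sub>R g i t \<partial>\<mu> i)"
  proof (rule tendsto_sum)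
    fix i assume i: "i \<in> I"
    have [measurable_cong]: "sets (\<mu> i) = sets borel" using \<mu> i by blast
    have [measurable]: "f \<in> borel_measurable borel" "\<And>n. U n \<in> borel_measurable borel"
      "g i \<in> borel_measurable borel" using f U g i by auto
    show "(\<lambda>n. \<integral>t. U n t *\<^sub>R g i t \<partial>\<mu> i) \<longlonglongrightarrow> (\<integral>t. f t *\<^sub>R g i t \<partial>\<mu> i)"
    proof (rule integral_dominated_convergence[where w="\<lambda>_. D * C"])
      show "integrable (\<mu> i) (\<lambda>_. D * C)" using \<mu> i by (intro integrable_bounded) auto
      show "AE t in \<mu> i. (\<lambda>n. U n t *\<^sub>R g i t) \<longlonglongrightarrow> f t *\<^sub>R g i t"
        by (intro AE_I2 tendsto_scaleR lim tendsto_const)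
      show "AE t in \<mu> i. norm (U n t *\<^sub>R g i t) \<le> D * C" for n
        using Ub gb[OF i] D by (intro AE_I2) (auto intro!: mult_mono)
    qed simp_all
  qed
  then show ?thesis using z by (simp add: LIMSEQ_const_iff)
qed

text \<open>Measurable induction, with a bound on the function carried through it: the functional is
  additive only where all integrals exist, and monotone limits need a constant dominating
  function.\<close>

lemma combination_from_indicator:
  fixes g :: "'i \<Rightarrow> real \<Rightarrow> complex"
  assumes \<mu>: "\<And>i. i \<in> I \<Longrightarrow> sets (\<mu> i) = sets borel \<and> finite_measure (\<mu> i)"
    and g: "\<And>i. i \<in> I \<Longrightarrow> g i \<in> borel_measurable borel"
    and gb: "\<And>i t. i \<in> I \<Longrightarrow> norm (g i t) \<le> C"
    and z: "\<And>B. B \<in> sets borel \<Longrightarrow> (\<Sum>i\<in>I. \<integral>t. indicator B t *\<^sub>R g i t \<partial>\<mu> i) = 0"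
    and f: "f \<in> borel_measurable borel" and fb: "\<And>t. \<bar>f t\<bar> \<le> (D::real)"
  shows "(\<Sum>i\<in>I. \<integral>t. f t *\<^sub>R g i t \<partial>\<mu> i) = 0"
proof -
  define \<Lambda> where "\<Lambda> f = (\<Sum>i\<in>I. \<integral>t. f t *\<^sub>R g i t \<partial>\<mu> i)" for f
  have int: "integrable (\<mu> i) (\<lambda>t. f t *\<^sub>R g i t)"
    if "i \<in> I" "f \<in> borel_measurable borel" "\<And>t. \<bar>f t\<bar> \<le> D" for f and D :: real and i
  proof (rule integrable_bounded[where C="D * C"])
    show "norm (f t *\<^sub>R g i t) \<le> D * C" for t
      using that gb[of i t] by (auto intro!: mult_mono')
  qed (use that \<mu> g in auto)
  have linc: "\<Lambda> (\<lambda>t. a * f t + h t) = a * \<Lambda> f + \<Lambda> h"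
    if f: "f \<in> borel_measurable borel" "\<And>t. \<bar>f t\<bar> \<le> D" and h: "h \<in> borel_measurable borel" "\<And>t. \<bar>h t\<bar> \<le> D'"
    for f h D D' and a :: real
    unfolding \<Lambda>_def by (intro combination_linear int[OF _ f] int[OF _ h])
  have z0: "\<Lambda> (\<lambda>_. 0) = 0" by (simp add: \<Lambda>_def)
  have nonneg: "\<Lambda> u = 0" if "u \<in> borel_measurable borel" "\<And>t. 0 \<le> u t" "\<exists>D. \<forall>t. u t \<le> D" for u
    using that
  proof (induction rule: borel_measurable_induct_real)
    case (set A)
    then show ?case using z[of A] by (simp add: \<Lambda>_def)
  next
    case (mult u c)
    show ?case
    proof (cases "c = 0")
      case True
      then show ?thesis using z0 by simp
    next
      case False
      obtain D where D: "\<forall>t. c * u t \<le> D" using mult by blast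
      have b: "\<bar>u t\<bar> \<le> D / c" for t
        using D[rule_format, of t] mult False by (simp add: field_simps)
      then have "\<Lambda> u = 0" using mult by (meson abs_le_iff)
      then show ?thesis using linc[of u "D/c" "\<lambda>_. 0" 0 c] mult b z0 by simp
    qed
  next
    case (add u v)
    obtain D where D: "\<forall>t. v t + u t \<le> D" using add.prems by blast
    have b: "\<bar>u t\<bar> \<le> D" "\<bar>v t\<bar> \<le> D" for t
      using D[rule_format, of t] add.hyps(2)[of t] add.hyps(4)[of t] by linarith+
    have "\<Lambda> u = 0" "\<Lambda> v = 0" using add.IH b by (meson abs_le_iff)+
    then show ?case using linc[of v D u D 1] add.hyps b by simp
  next
    case (seq U)
    obtain D where D: "\<forall>t. u t \<le> D" using seq.prems by blast
    have le: "U n t \<le> u t" for n t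
      using seq.hyps by (intro incseq_le) (auto simp: incseq_def le_fun_def)
    have b: "\<bar>U n t\<bar> \<le> D" for n t
      using le[of n t] D[rule_format, of t] seq.hyps(2)[of n t] by linarith
    have U0: "\<Lambda> (U n) = 0" for n using seq.IH[of n] b[of n] by (meson abs_le_iff)
    show ?case
      unfolding \<Lambda>_def
    proof (rule combination_bounded_convergence[OF \<mu> g gb, where U=U and D=D])
      show "(\<Sum>i\<in>I. \<integral>t. U n t *\<^sub>R g i t \<partial>\<mu> i) = 0" for n using U0[of n] by (simp add: \<Lambda>_def)
      show "(\<lambda>n. U n t) \<longlonglongrightarrow> u t" for t using seq.hyps(4)[of t] by simp
      show "U n \<in> borel_measurable borel" for n by (rule seq.hyps(1))
      show "u \<in> borel_measurable borel" by (rule that(1))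
      show "\<bar>U n t\<bar> \<le> D" for n t by (rule b)
    qed assumption+
  qed
  have pos: "\<Lambda> (\<lambda>t. max 0 (f t)) = 0" "\<Lambda> (\<lambda>t. max 0 (- f t)) = 0"
    using f by (auto intro!: nonneg exI[of _ D] simp: fb[unfolded abs_le_iff] order_trans[OF abs_ge_zero fb])
  have "f = (\<lambda>t. (-1) * max 0 (- f t) + max 0 (f t))" by auto
  then have "\<Lambda> f = \<Lambda> (\<lambda>t. (-1) * max 0 (- f t) + max 0 (f t))" by metis
  also have "\<dots> = (-1) * \<Lambda> (\<lambda>t. max 0 (- f t)) + \<Lambda> (\<lambda>t. max 0 (f t))"
    using linc[of "\<lambda>t. max 0 (- f t)" D "\<lambda>t. max 0 (f t)" D "-1"] f
    by (simp add: abs_le_iff order_trans[OF abs_ge_zero fb] fb[unfolded abs_le_iff])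
  finally show ?thesis using pos by (simp add: \<Lambda>_def)
qed

lemma combination_from_moments:
  fixes g :: "'i \<Rightarrow> real \<Rightarrow> complex"
  assumes I: "finite I" and \<mu>: "\<And>i. i \<in> I \<Longrightarrow> bounded_measure K (\<mu> i)"
    and g: "\<And>i. i \<in> I \<Longrightarrow> g i \<in> borel_measurable borel"
    and gb: "\<And>i t. i \<in> I \<Longrightarrow> norm (g i t) \<le> C"
    and z: "\<And>n. (\<Sum>i\<in>I. \<integral>t. t ^ n *\<^sub>R g i t \<partial>\<mu> i) = 0"
    and f: "f \<in> borel_measurable borel" and fb: "\<And>t. \<bar>f t\<bar> \<le> (D::real)"
  shows "(\<Sum>i\<in>I. \<integral>t. f t *\<^sub>R g i t \<partial>\<mu> i) = 0"
proof -
  define \<Lambda> where "\<Lambda> f = (\<Sum>i\<in>I. \<integral>t. f t *\<^sub>R g i t \<partial>\<mu> i)" for f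
  have C0: "0 \<le> C" if "i \<in> I" for i using gb[OF that, of 0] norm_ge_zero order_trans by blast
  have int: "integrable (\<mu> i) (\<lambda>t. f t *\<^sub>R g i t)"
    if "i \<in> I" "f \<in> borel_measurable borel" "\<And>t. \<bar>t\<bar> \<le> K \<Longrightarrow> \<bar>f t\<bar> \<le> D" for f and D :: real and i
  proof (rule bounded_measure_integrable[where C="D * C"])
    show "norm (f t *\<^sub>R g i t) \<le> D * C" if "\<bar>t\<bar> \<le> K" for t
      using that \<open>\<And>t. \<bar>t\<bar> \<le> K \<Longrightarrow> \<bar>f t\<bar> \<le> D\<close>[of t] gb[of i t] \<open>i \<in> I\<close>
      by (auto intro!: mult_mono')
  qed (use that \<mu> g in auto)
  have add: "\<Lambda> (\<lambda>t. a * f t + h t) = a * \<Lambda> f + \<Lambda> h"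
    if f: "f \<in> borel_measurable borel" "\<And>t. \<bar>t\<bar> \<le> K \<Longrightarrow> \<bar>f t\<bar> \<le> D"
      and h: "h \<in> borel_measurable borel" "\<And>t. \<bar>t\<bar> \<le> K \<Longrightarrow> \<bar>h t\<bar> \<le> D'"
    for f h D D' and a :: real
    unfolding \<Lambda>_def by (intro combination_linear int[OF _ f] int[OF _ h])
  have z0: "\<Lambda> (\<lambda>_. 0) = 0" by (simp add: \<Lambda>_def)
  have cbd: "\<exists>D. \<forall>t. \<bar>t\<bar> \<le> K \<longrightarrow> \<bar>f t\<bar> \<le> D" if "continuous_on UNIV f" for f :: "real \<Rightarrow> real"
  proof -
    have "compact (f ` {-K..K})"
      using that by (intro compact_continuous_image) (auto intro: continuous_on_subset)
    then obtain C where "\<forall>y\<in>f ` {-K..K}. norm y \<le> C" using compact_imp_bounded bounded_iff by meson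
    then show ?thesis by (intro exI[of _ C]) (auto simp: abs_le_iff)
  qed
  have poly: "\<Lambda> (\<lambda>x. \<Sum>i\<le>n. a i * x ^ i) = 0" for a :: "nat \<Rightarrow> real" and n
  proof (induction n)
    case 0
    show ?case using z[of 0] add[of "\<lambda>_. 1" 1 "\<lambda>_. 0" 0 "a 0"] z0 by (simp add: \<Lambda>_def)
  next
    case (Suc n)
    have "\<Lambda> (\<lambda>x. \<Sum>i\<le>Suc n. a i * x ^ i) = \<Lambda> (\<lambda>x. a (Suc n) * x ^ (Suc n) + (\<Sum>i\<le>n. a i * x ^ i))"
      by (simp add: add.commute)
    also have "\<dots> = a (Suc n) * \<Lambda> (\<lambda>x. x ^ Suc n) + \<Lambda> (\<lambda>x. (\<Sum>i\<le>n. a i * x ^ i))"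
    proof -
      obtain D where D: "\<forall>t. \<bar>t\<bar> \<le> K \<longrightarrow> \<bar>t ^ Suc n :: real\<bar> \<le> D"
        using cbd[of "\<lambda>t. t ^ Suc n"] continuous_on_power[OF continuous_on_id] by blast
      obtain D' where D': "\<forall>t. \<bar>t\<bar> \<le> K \<longrightarrow> \<bar>\<Sum>i\<le>n. a i * t ^ i :: real\<bar> \<le> D'"
        using cbd[of "\<lambda>t. \<Sum>i\<le>n. a i * t ^ i"]
          continuous_on_sum[of "{..n}" UNIV "\<lambda>i t. a i * t ^ i"]
          continuous_on_mult_left[OF continuous_on_power[OF continuous_on_id]] by blast
      show ?thesis by (rule add[of _ D _ D']) (use D D' in auto)
    qed
    also have "\<Lambda> (\<lambda>x. x ^ Suc n) = 0" using z[of "Suc n"] by (simp add: \<Lambda>_def)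
    finally show ?case using Suc by simp
  qed
  have cont: "\<Lambda> f = 0" if "continuous_on UNIV f" for f :: "real \<Rightarrow> real"
  proof -
    let ?M = "\<Sum>i\<in>I. measure (\<mu> i) UNIV"
    have "norm (\<Lambda> f) \<le> e * (C * ?M)" if e: "e > 0" for e
    proof -
      obtain p where p: "real_polynomial_function p" "\<And>x. x \<in> {-K..K} \<Longrightarrow> \<bar>f x - p x\<bar> < e"
        using Stone_Weierstrass_real_polynomial_function[OF _ continuous_on_subset[OF \<open>continuous_on UNIV f\<close> subset_UNIV] e, of "{-K..K}"] by auto
      then obtain a n where pe: "p = (\<lambda>x. \<Sum>i\<le>n. a i * x ^ i)"
        by (auto simp: real_polynomial_function_iff_sum)
      have pc: "continuous_on UNIV p" unfolding pe by (intro continuous_intros)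
      have m: "f \<in> borel_measurable borel" "p \<in> borel_measurable borel"
        using pc \<open>continuous_on UNIV f\<close> by (auto intro: borel_measurable_continuous_onI)
      have pK: "\<bar>f t - p t\<bar> \<le> e" if "\<bar>t\<bar> \<le> K" for t using p(2)[of t] that by (cases "t \<in> {-K..K}") auto
      obtain D where D: "\<forall>t. \<bar>t\<bar> \<le> K \<longrightarrow> \<bar>p t\<bar> \<le> D" using cbd[OF pc] by blast
      have "\<Lambda> f = \<Lambda> (\<lambda>t. 1 * (f t - p t) + p t)" by simp
      also have "\<dots> = 1 * \<Lambda> (\<lambda>t. f t - p t) + \<Lambda> p"
        using add[of "\<lambda>t. f t - p t" e p D 1] m pK D by simp
      also have "\<Lambda> p = 0" unfolding pe by (rule poly)
      finally have "norm (\<Lambda> f) = norm (\<Lambda> (\<lambda>t. f t - p t))" by simp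
      also have "\<dots> \<le> (\<Sum>i\<in>I. norm (\<integral>t. (f t - p t) *\<^sub>R g i t \<partial>\<mu> i))"
        unfolding \<Lambda>_def by (rule norm_sum)
      also have "\<dots> \<le> (\<Sum>i\<in>I. e * C * measure (\<mu> i) UNIV)"
      proof (rule sum_mono)
        fix i assume i: "i \<in> I"
        note b = bounded_measureD[OF \<mu>[OF i]]
        have "norm (\<integral>t. (f t - p t) *\<^sub>R g i t \<partial>\<mu> i) \<le> (\<integral>t. norm ((f t - p t) *\<^sub>R g i t) \<partial>\<mu> i)"
          by (rule integral_norm_bound)
        also have "\<dots> \<le> (\<integral>t. e * C \<partial>\<mu> i)"
        proof (rule integral_mono_AE)
          show "integrable (\<mu> i) (\<lambda>t. norm ((f t - p t) *\<^sub>R g i t))"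
            using int[OF i _ pK] m by (intro integrable_norm) auto
          show "integrable (\<mu> i) (\<lambda>t. e * C)" using b by (intro integrable_bounded) auto
          show "AE t in \<mu> i. norm ((f t - p t) *\<^sub>R g i t) \<le> e * C"
            using b(3)
          proof eventually_elim
            case (elim t)
            then show ?case using pK[of t] gb[OF i, of t] e by (auto intro!: mult_mono)
          qed
        qed
        also have "\<dots> = e * C * measure (\<mu> i) UNIV" using b by simp
        finally show "norm (\<integral>t. (f t - p t) *\<^sub>R g i t \<partial>\<mu> i) \<le> e * C * measure (\<mu> i) UNIV" .
      qed
      also have "\<dots> = e * (C * ?M)" by (simp add: sum_distrib_left mult.assoc)
      finally show ?thesis .
    qed
    then have bound: "norm (\<Lambda> f) \<le> e * (C * ?M)" if "e > 0" for e using that by blast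
    \<comment> \<open>The approximation error was arbitrary, so the norm is at most the limit of the
      bounds at 0.\<close>
    have "((\<lambda>e. e * (C * ?M)) \<longlongrightarrow> 0 * (C * ?M)) (at_right 0)"
      by (intro tendsto_intros)
    moreover have "\<forall>\<^sub>F e in at_right 0. norm (\<Lambda> f) \<le> e * (C * ?M)"
      using bound by (auto simp: eventually_at_right_less intro: eventually_mono[OF eventually_at_right_less])
    ultimately have "norm (\<Lambda> f) \<le> 0 * (C * ?M)"
      by (intro tendsto_lowerbound[where F="at_right 0"]) auto
    then show ?thesis by simp
  qed
  have bd: "sets (\<mu> i) = sets borel \<and> finite_measure (\<mu> i)" if "i \<in> I" for i
    using bounded_measureD[OF \<mu>[OF that]] by blast
  have closed: "\<Lambda> (indicator A) = 0" if A: "closed A" for A :: "real set"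
  proof (cases "A = {}")
    case True
    then show ?thesis using z0 by (simp add: \<Lambda>_def)
  next
    case False
    \<comment> \<open>Continuous functions with values in [0,1] that decrease to the indicator
      exactly because \<open>A\<close> is closed.\<close>
    let ?U = "\<lambda>n t. max 0 (1 - real n * infdist t A)"
    have c: "continuous_on UNIV (?U n)" for n by (intro continuous_intros)
    show ?thesis
      unfolding \<Lambda>_def
    proof (rule combination_bounded_convergence[OF bd g gb, where U="?U" and D=1])
      show "?U n \<in> borel_measurable borel" for n
        using c by (rule borel_measurable_continuous_onI)
      show "\<bar>?U n t\<bar> \<le> 1" for n t using infdist_nonneg[of t A] by (auto simp: max_def)
      show "indicator A \<in> borel_measurable borel" using A by simp
      show "(\<Sum>i\<in>I. \<integral>t. ?U n t *\<^sub>R g i t \<partial>\<mu> i) = 0" for n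
        using cont[OF c[of n]] by (simp add: \<Lambda>_def)
      show "(\<lambda>n. ?U n t) \<longlonglongrightarrow> indicator A t" for t
      proof (cases "t \<in> A")
        case True
        then show ?thesis by (simp add: infdist_zero)
      next
        case f: False
        then have "infdist t A > 0"
          using A False in_closed_iff_infdist_zero infdist_nonneg by (metis less_eq_real_def)
        then obtain n0 where n0: "1 < real n0 * infdist t A" using reals_Archimedean3 by blast
        have "\<forall>\<^sub>F n in sequentially. ?U n t = 0"
          using eventually_ge_at_top[of n0]
        proof eventually_elim
          case (elim n)
          then have "real n0 * infdist t A \<le> real n * infdist t A"
            using infdist_nonneg by (intro mult_right_mono) auto
          then show ?case using n0 by auto
        qed
        then show ?thesis using f by (simp add: tendsto_eventually)
      qed
    qed auto
  qed
  have ind: "\<Lambda> (indicator B) = 0" if "B \<in> sets borel" for B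
  proof -
    have gen: "sets (borel :: real measure) = sigma_sets UNIV (Collect closed)"
      by (subst borel_eq_closed) simp
    have B: "B \<in> sigma_sets UNIV (Collect closed)" using that gen by simp
    have st: "Int_stable (Collect (closed :: real set \<Rightarrow> bool))"
      by (auto simp: Int_stable_def)
    have pw: "Collect (closed :: real set \<Rightarrow> bool) \<subseteq> Pow UNIV" by simp
    show ?thesis
      using st pw B
    proof (induction rule: sigma_sets_induct_disjoint)
      case (basic A)
      then show ?case using closed by simp
    next
      case empty
      then show ?case using z0 by (simp add: \<Lambda>_def)
    next
      case (compl A)
      have m: "A \<in> sets borel" using compl gen by simp
      have "indicator (UNIV - A) = (\<lambda>t. (-1) * indicator A t + (1::real))"
        by (auto simp: indicator_def)
      then have "\<Lambda> (indicator (UNIV - A)) = \<Lambda> (\<lambda>t. (-1) * indicator A t + 1)" by metis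
      also have "\<dots> = (-1) * \<Lambda> (indicator A) + \<Lambda> (\<lambda>t. 1)"
        using add[of "indicator A" 1 "\<lambda>_. 1" 1 "-1"] m by simp
      also have "\<Lambda> (\<lambda>t. 1) = 0" using z[of 0] by (simp add: \<Lambda>_def)
      finally show ?case using compl by simp
    next
      case (union A)
      have m: "A n \<in> sets borel" for n using union gen by auto
      let ?U = "\<lambda>n t. \<Sum>i<n. indicator (A i) t :: real"
      have U: "?U n t = indicator (\<Union>i<n. A i) t" for n t
        using union(1) by (subst indicator_UN_disjoint) (auto simp: disjoint_family_on_def)
      have Ub: "\<bar>?U n t\<bar> \<le> 1" for n t unfolding U by (simp add: indicator_def)
      have Um: "?U n \<in> borel_measurable borel" for n using m by (auto intro!: borel_measurable_sum)
      have U0: "\<Lambda> (?U n) = 0" for n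
      proof (induction n)
        case 0
        then show ?case using z0 by simp
      next
        case (Suc n)
        have "\<Lambda> (?U (Suc n)) = \<Lambda> (\<lambda>t. 1 * indicator (A n) t + ?U n t)" by (simp add: add.commute)
        also have "\<dots> = 1 * \<Lambda> (indicator (A n)) + \<Lambda> (?U n)"
          using add[of "indicator (A n)" 1 "?U n" 1 1] m Um[of n] Ub by simp
        finally show ?case using Suc union by simp
      qed
      show ?case
        unfolding \<Lambda>_def
      proof (rule combination_bounded_convergence[OF bd g gb, where U="?U" and D=1])
        show "(\<lambda>n. ?U n t) \<longlonglongrightarrow> indicator (\<Union> (range A)) t" for t
          unfolding U by (rule LIMSEQ_indicator_UN)
        show "\<bar>?U n t\<bar> \<le> 1" for n t by (rule Ub)
        show "indicator (\<Union> (range A)) \<in> borel_measurable borel" using m by auto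
        show "(\<Sum>i\<in>I. \<integral>t. ?U n t *\<^sub>R g i t \<partial>\<mu> i) = 0" for n
          using U0[of n] by (simp add: \<Lambda>_def)
      qed (use Um in auto)
    qed
  qed
  show ?thesis
    by (rule combination_from_indicator[OF bd g gb _ f fb]) (use ind in \<open>auto simp: \<Lambda>_def\<close>)
qed

lemma bounded_measure_mono: "bounded_measure K \<mu> \<Longrightarrow> K \<le> K' \<Longrightarrow> bounded_measure K' \<mu>"
  by (auto simp: bounded_measure_def elim!: eventually_mono)

text \<open>The moment criterion with two measures and weights 1 and -1, after enlarging both
  intervals to a common one.\<close>

lemma bounded_measure_unique:
  assumes "bounded_measure K \<mu>" "bounded_measure K' \<nu>"
    and "\<And>n. (\<integral>t. t ^ n \<partial>\<mu>) = (\<integral>t. t ^ n \<partial>\<nu>)"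
  shows "\<mu> = \<nu>"
proof (rule measure_eqI)
  let ?m = "\<lambda>b::bool. if b then \<mu> else \<nu>" and ?g = "\<lambda>(b::bool) (t::real). if b then 1 else - 1 :: complex"
  let ?K = "max K K'"
  have b: "bounded_measure ?K \<mu>" "bounded_measure ?K \<nu>"
    using assms bounded_measure_mono by (meson max.cobounded1 max.cobounded2)+
  show sets: "sets \<mu> = sets \<nu>" using assms bounded_measureD by metis
  fix B assume "B \<in> sets \<mu>"
  then have B: "B \<in> sets borel" using assms bounded_measureD by metis
  have "(\<Sum>i\<in>UNIV. \<integral>t. indicator B t *\<^sub>R ?g i t \<partial>?m i) = 0"
  proof (rule combination_from_moments[where K="?K" and C=1 and D=1])
    fix n
    have *: "(\<integral>t. t ^ n *\<^sub>R c \<partial>\<rho>) = of_real (\<integral>t. t ^ n \<partial>\<rho>) * c"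
      if "bounded_measure ?K \<rho>" for \<rho> and c :: complex
      using that by (subst integral_scaleR_left) (auto simp: scaleR_conv_of_real)
    show "(\<Sum>i\<in>UNIV. \<integral>t. t ^ n *\<^sub>R ?g i t \<partial>?m i) = 0"
      using *[OF b(1), of 1] *[OF b(2), of "-1"] by (simp add: UNIV_bool assms(3))
  qed (use b B in auto)
  then have "complex_of_real (measure \<mu> B) = complex_of_real (measure \<nu> B)"
    using assms(1,2)[THEN bounded_measureD(1)] assms(1,2)[THEN bounded_measureD(4)] B
    by (simp add: UNIV_bool scaleR_conv_of_real finite_measure.emeasure_finite)
  then show "emeasure \<mu> B = emeasure \<nu> B"
    using assms(1,2)[THEN bounded_measureD(2)] by (simp add: finite_measure.emeasure_eq_measure)
qed

section \<open>The Hausdorff moment problem\<close>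

text \<open>With \<open>b l k\<close> read as the value of a functional at t^k (1-t)^l, this is the
  expansion of t^m (t + (1-t))^N by the binomial theorem.\<close>

lemma pascal_partition:
  fixes b :: "nat \<Rightarrow> nat \<Rightarrow> real"
  assumes rec: "\<And>l k. b l k = b (Suc l) k + b l (Suc k)"
  shows "(\<Sum>j\<le>N. real (N choose j) * b (N - j) (m + j)) = b 0 m"
proof (induction N)
  case (Suc N)
  have "(\<Sum>j\<le>Suc N. real (Suc N choose j) * b (Suc N - j) (m + j))
      = b (Suc N) m + (\<Sum>j\<le>N. real ((N choose Suc j) + (N choose j)) * b (N - j) (m + Suc j))"
    by (subst sum.atMost_Suc_shift) (simp add: add.commute)
  also have "\<dots> = (b (Suc N) m + (\<Sum>j\<le>N. real (N choose Suc j) * b (N - j) (m + Suc j)))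
      + (\<Sum>j\<le>N. real (N choose j) * b (N - j) (m + Suc j))"
    by (simp add: algebra_simps sum.distrib)
  also have "b (Suc N) m + (\<Sum>j\<le>N. real (N choose Suc j) * b (N - j) (m + Suc j))
      = (\<Sum>j\<le>Suc N. real (N choose j) * b (Suc N - j) (m + j))"
    by (subst sum.atMost_Suc_shift) simp
  also have "\<dots> = (\<Sum>j\<le>N. real (N choose j) * b (Suc (N - j)) (m + j))"
    by (simp add: Suc_diff_le)
  also have "\<dots> + (\<Sum>j\<le>N. real (N choose j) * b (N - j) (m + Suc j))
      = (\<Sum>j\<le>N. real (N choose j) * b (N - j) (m + j))"
    by (subst rec[of "N - _"]) (simp add: sum.distrib algebra_simps)
  finally show ?case using Suc by simp
qed simp

text \<open>Compares an ordinary moment with a factorial moment. Both are products of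
  \<open>m\<close> factors of modulus at most 1, so they differ by at most the sum of the
  differences of factors. The condition \<open>2 * m < n\<close> bounds (k-j)/(n-j) from below by -1
  also when k < j.\<close>

lemma binomial_quotient_bound:
  assumes "k \<le> n" "2 * m < n"
  shows "\<bar>(real k / real n) ^ m - real (k choose m) / real (n choose m)\<bar>
    \<le> (\<Sum>j<m. real j / (real n - real j))"
proof -
  let ?q = "\<lambda>j. (real k - real j) / (real n - real j)"
  have n: "0 < real n" "\<And>j. j < m \<Longrightarrow> 2 * real j < real n" using assms by auto
  have ch: "real (l choose m) = (\<Prod>j<m. real l - real j) / fact m" for l
    by (simp add: binomial_gbinomial gbinomial_prod_rev atLeast0LessThan)
  have 1: "real (k choose m) / real (n choose m) = (\<Prod>j<m. ?q j)"
    by (simp add: ch prod_dividef)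
  have 2: "(real k / real n) ^ m = (\<Prod>j<m. real k / real n)" by simp
  have "norm ((\<Prod>j<m. real k / real n) - (\<Prod>j<m. ?q j)) \<le> (\<Sum>j<m. norm (real k / real n - ?q j))"
  proof (rule norm_prod_diff)
    show "norm (real k / real n) \<le> 1" using assms by simp
    show "norm (?q j) \<le> 1" if "j \<in> {..<m}" for j
      using n(2)[of j] that assms by (auto simp: abs_le_iff divide_simps)
  qed
  also have "\<dots> \<le> (\<Sum>j<m. real j / (real n - real j))"
  proof (rule sum_mono)
    fix j assume "j \<in> {..<m}"
    then have j: "2 * real j < real n" using n by auto
    have eq: "real k / real n - ?q j = (real j / (real n - real j)) * ((real n - real k) / real n)"
      using j n by (simp add: divide_simps) (simp add: algebra_simps)
    have "\<bar>(real n - real k) / real n\<bar> \<le> 1" using assms n by (simp add: abs_le_iff divide_simps)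
    then show "norm (real k / real n - ?q j) \<le> real j / (real n - real j)"
      unfolding eq using j mult_left_mono[of "\<bar>(real n - real k) / real n\<bar>" 1 "real j / (real n - real j)"]
      by (simp add: abs_mult)
  qed
  finally show ?thesis unfolding 1 2 real_norm_def .
qed

text \<open>The Hausdorff moment problem; \<open>b l k\<close> stands for the value of the moment functional at
  \<open>t\<^sup>k (1 - t)\<^sup>l\<close>. The measure is a limit of Bernstein discretizations, whose factorial moments
  are exact.\<close>

lemma hausdorff_moments_normalized:
  fixes b :: "nat \<Rightarrow> nat \<Rightarrow> real"
  assumes rec: "\<And>l k. b l k = b (Suc l) k + b l (Suc k)"
    and pos: "\<And>l k. 0 \<le> b l k" and one: "b 0 0 = 1"
  shows "\<exists>\<mu>. bounded_measure 1 \<mu> \<and> (AE t in \<mu>. 0 \<le> t) \<and> (\<forall>n. (\<integral>t. t ^ n \<partial>\<mu>) = b 0 n)"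
proof -
  \<comment> \<open>The value of the functional at the Bernstein polynomial of index
    \<open>k\<close> and degree \<open>n\<close>; it becomes the mass placed at
    \<open>k / n\<close>.\<close>
  define w where "w n k = real (n choose k) * b (n - k) k" for n k
  have w0: "0 \<le> w n k" for n k by (simp add: w_def pos)
  have w1: "(\<Sum>k\<le>n. w n k) = 1" for n
    using pascal_partition[where b=b, OF rec, of n 0] one by (simp add: w_def)
  define P where "P n = point_measure {..n} (\<lambda>k. ennreal (w n k))" for n
  define \<mu> where "\<mu> n = distr (P n) borel (\<lambda>k. real k / real n)" for n
  have P: "prob_space (P n)" for n
    by (rule prob_spaceI)
      (simp add: P_def space_point_measure emeasure_point_measure_finite w0 w1 sum_ennreal)
  have meas: "(\<lambda>k. real k / real n) \<in> measurable (P n) borel" for n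
    by (simp add: P_def measurable_def sets_point_measure space_point_measure)
  have int: "(\<integral>t. f t \<partial>\<mu> n) = (\<Sum>k\<le>n. w n k * f (real k / real n))"
    if "f \<in> borel_measurable borel" for f :: "real \<Rightarrow> real" and n
    unfolding \<mu>_def using that
    by (subst integral_distr[OF meas]) (simp_all add: P_def lebesgue_integral_point_measure_finite w0)
  have rd: "real_distribution (\<mu> n)" for n
  proof -
    have "prob_space (\<mu> n)" unfolding \<mu>_def by (rule prob_space.prob_space_distr[OF P meas])
    then show ?thesis
      by (intro real_distribution.intro real_distribution_axioms.intro) (simp_all add: \<mu>_def)
  qed
  \<comment> \<open>Tightness is formulated with half-open intervals; the left end -1 keeps the
    possible atom at 0 inside.\<close>
  have supp: "measure (\<mu> n) {-1<..1} = 1" for n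
  proof -
    have "measure (\<mu> n) {-1<..1} = (\<integral>t. indicator {-1<..1} t \<partial>\<mu> n)"
      using rd[of n] by (simp add: real_distribution.space_eq_univ)
    also have "\<dots> = (\<Sum>k\<le>n. w n k * indicator {-1<..1} (real k / real n))"
      by (rule int) simp
    also have "\<dots> = (\<Sum>k\<le>n. w n k)"
    proof (rule sum.cong)
      fix k assume "k \<in> {..n}"
      then have "real k / real n \<le> 1" by (auto simp: divide_simps)
      moreover have "-1 < real k / real n" by (rule less_le_trans[of _ 0]) auto
      ultimately show "w n k * indicator {-1<..1} (real k / real n) = w n k" by (simp add: indicator_def)
    qed simp
    finally show ?thesis using w1 by simp
  qed
  have "tight \<mu>" unfolding tight_def
  proof (intro conjI allI impI)
    fix \<epsilon> :: real assume "0 < \<epsilon>"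
    then show "\<exists>a b. a < b \<and> (\<forall>n. measure (\<mu> n) {a<..b} > 1 - \<epsilon>)"
      by (intro exI[of _ "-1"] exI[of _ 1]) (simp add: supp)
  qed (rule rd)
  from tight_imp_convergent_subsubsequence[OF this strict_mono_id]
  obtain r M where r: "strict_mono (r :: nat \<Rightarrow> nat)" and M: "real_distribution M"
    and conv: "weak_conv_m (\<lambda>n. \<mu> (r n)) M"
    by (auto simp: comp_def)
  have lim: "(\<lambda>n. \<integral>t. f t \<partial>\<mu> (r n)) \<longlonglongrightarrow> (\<integral>t. f t \<partial>M)"
    if "\<And>t. isCont f t" "\<And>t. norm (f t) \<le> B" for f :: "real \<Rightarrow> real" and B
    by (rule weak_conv_imp_integral_bdd_continuous_conv[OF rd M conv that])
  interpret M: real_distribution M by (rule M)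
  \<comment> \<open>Truncation to [0,1]: weak convergence allows only test functions that are
    bounded and continuous on the whole line.\<close>
  let ?c = "\<lambda>t::real. max 0 (min 1 t)"
  have kn: "0 \<le> real k / real n" "real k / real n \<le> 1" if "k \<le> n" for k n
    using that by (auto simp: divide_simps)
  have ck: "?c (real k / real n) = real k / real n" if "k \<le> n" for k n
    using kn[OF that] by (simp add: max_absorb2 min_absorb2)
  have AE: "AE t in M. t \<in> {0..1}"
  proof -
    \<comment> \<open>Vanishes exactly on [0,1], so a zero integral in the limit locates the limit
      measure.\<close>
    let ?f = "\<lambda>t::real. min 1 \<bar>t - ?c t\<bar>"
    have c: "isCont ?f t" for t by (intro continuous_intros)
    have m: "?f \<in> borel_measurable borel" by measurable
    have "(\<integral>t. ?f t \<partial>\<mu> (r n)) = 0" for n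
      by (subst int[OF m]) (use kn in \<open>auto intro!: sum.neutral\<close>)
    moreover have "(\<lambda>n. \<integral>t. ?f t \<partial>\<mu> (r n)) \<longlonglongrightarrow> (\<integral>t. ?f t \<partial>M)"
      by (rule lim[OF c, of 1]) auto
    ultimately have "(\<integral>t. ?f t \<partial>M) = 0" by (simp add: LIMSEQ_const_iff)
    moreover have "integrable M ?f"
      by (rule M.integrable_const_bound[where B=1]) auto
    ultimately have "AE t in M. ?f t = 0"
      by (subst (asm) integral_nonneg_eq_0_iff_AE) auto
    then show ?thesis by eventually_elim (auto simp: min_def max_def split: if_splits)
  qed
  have mom: "(\<integral>t. t ^ m \<partial>M) = b 0 m" for m
  proof -
    let ?f = "\<lambda>t::real. ?c t ^ m"
    have c: "isCont ?f t" for t by (intro continuous_intros)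
    have m: "?f \<in> borel_measurable borel" by measurable
    have "norm (?f t) \<le> 1" for t by (auto intro!: power_le_one simp: norm_power power_abs)
    then have l1: "(\<lambda>n. \<integral>t. ?f t \<partial>\<mu> (r n)) \<longlonglongrightarrow> (\<integral>t. ?f t \<partial>M)"
      using lim[OF c, of 1] by blast
    have "\<bar>(\<integral>t. ?f t \<partial>\<mu> n) - b 0 m\<bar> \<le> (\<Sum>j<m. real j / (real n - real j))" if n: "2 * m < n" for n
    proof -
      have i: "(\<integral>t. ?f t \<partial>\<mu> n) = (\<Sum>k\<le>n. w n k * (real k / real n) ^ m)"
        by (subst int[OF m]) (intro sum.cong, simp_all only: ck atMost_iff)
      have C: "0 < real (n choose m)" using n by simp
      \<comment> \<open>The factorial moments are exact at every \<open>n\<close>: rewriting (n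
        choose k)(k choose m) as (n choose m)(n-m choose k-m) leaves a binomial expansion.\<close>
      have "(\<Sum>k\<le>n. w n k * real (k choose m)) = real (n choose m) * b 0 m"
      proof -
        have "(\<Sum>k\<le>n. w n k * real (k choose m)) = (\<Sum>k\<in>{m..n}. w n k * real (k choose m))"
          by (rule sum.mono_neutral_right) (auto simp: not_le)
        also have "\<dots> = (\<Sum>k\<in>{m..n}. real (n choose m) * (real ((n - m) choose (k - m)) * b (n - k) k))"
        proof (rule sum.cong)
          fix k assume "k \<in> {m..n}"
          then have "real ((n choose k) * (k choose m)) = real ((n choose m) * ((n - m) choose (k - m)))"
            by (simp add: choose_mult)
          then show "w n k * real (k choose m) = real (n choose m) * (real ((n - m) choose (k - m)) * b (n - k) k)"
            by (simp add: w_def algebra_simps)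
        qed simp
        also have "\<dots> = real (n choose m) * (\<Sum>k\<in>{m..n}. real ((n - m) choose (k - m)) * b (n - k) k)"
          by (simp add: sum_distrib_left)
        also have "(\<Sum>k\<in>{m..n}. real ((n - m) choose (k - m)) * b (n - k) k)
            = (\<Sum>j\<le>n - m. real ((n - m) choose j) * b (n - m - j) (m + j))"
          by (rule sum.reindex_bij_witness[of _ "\<lambda>j. m + j" "\<lambda>k. k - m"]) (use n in auto)
        also have "\<dots> = b 0 m" by (rule pascal_partition[where b=b, OF rec])
        finally show ?thesis .
      qed
      then have bm: "b 0 m = (\<Sum>k\<le>n. w n k * (real (k choose m) / real (n choose m)))"
        using C by (simp add: sum_divide_distrib[symmetric])
      have "(\<integral>t. ?f t \<partial>\<mu> n) - b 0 m
          = (\<Sum>k\<le>n. w n k * ((real k / real n) ^ m - real (k choose m) / real (n choose m)))"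
        unfolding i bm by (simp add: sum_subtractf[symmetric] right_diff_distrib)
      also have "\<bar>\<dots>\<bar> \<le> (\<Sum>k\<le>n. \<bar>w n k * ((real k / real n) ^ m - real (k choose m) / real (n choose m))\<bar>)"
        by (rule sum_abs)
      also have "\<dots> \<le> (\<Sum>k\<le>n. w n k * (\<Sum>j<m. real j / (real n - real j)))"
        using n w0 binomial_quotient_bound by (intro sum_mono) (simp add: abs_mult mult_left_mono)
      also have "\<dots> = (\<Sum>j<m. real j / (real n - real j))"
        by (simp add: sum_distrib_right[symmetric] w1)
      finally show ?thesis .
    qed
    then have ev: "\<forall>\<^sub>F n in sequentially. norm ((\<integral>t. ?f t \<partial>\<mu> n) - b 0 m) \<le> (\<Sum>j<m. real j / (real n - real j))"
      by (intro eventually_mono[OF eventually_gt_at_top[of "2 * m"]]) (simp only: real_norm_def)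
    have z: "(\<lambda>n. \<Sum>j<m. real j / (real n - real j)) \<longlonglongrightarrow> 0"
    proof (rule tendsto_null_sum)
      fix j
      have "filterlim (\<lambda>n. real n - real j) at_top sequentially"
        using filterlim_tendsto_add_at_top[OF tendsto_const[of "- real j"] filterlim_real_sequentially]
        by (simp add: add.commute)
      then show "(\<lambda>n. real j / (real n - real j)) \<longlonglongrightarrow> 0"
        by (intro tendsto_divide_0[OF tendsto_const]) (auto intro: filterlim_at_top_imp_at_infinity)
    qed
    have "(\<lambda>n. (\<integral>t. ?f t \<partial>\<mu> n) - b 0 m) \<longlonglongrightarrow> 0"
      by (rule Lim_null_comparison[OF ev z])
    then have "(\<lambda>n. \<integral>t. ?f t \<partial>\<mu> n) \<longlonglongrightarrow> b 0 m" by (simp add: LIM_zero_iff)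
    then have "(\<lambda>n. \<integral>t. ?f t \<partial>\<mu> (r n)) \<longlonglongrightarrow> b 0 m"
      using LIMSEQ_subseq_LIMSEQ[OF _ r] by (auto simp: comp_def)
    then have "(\<integral>t. ?f t \<partial>M) = b 0 m" using l1 LIMSEQ_unique by blast
    moreover have "(\<integral>t. ?f t \<partial>M) = (\<integral>t. t ^ m \<partial>M)"
      proof (rule integral_cong_AE)
      show "AE t in M. ?f t = t ^ m"
        using AE by eventually_elim (auto simp: max_absorb2 min_absorb2)
    qed simp_all
    ultimately show ?thesis by simp
  qed
  have "AE t in M. \<bar>t\<bar> \<le> 1" using AE by eventually_elim auto
  then have "bounded_measure 1 M"
    using M.finite_measure_axioms by (simp add: bounded_measure_def)
  moreover have "AE t in M. 0 \<le> t" using AE by eventually_elim auto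
  ultimately show ?thesis using mom by blast
qed

text \<open>Division by the total mass reduces to a probability measure. If the mass is 0, all
  moments vanish, since the recursion and positivity give
  \<open>b 0 (Suc n) \<le> b 0 n\<close>.\<close>

lemma hausdorff_moments:
  fixes b :: "nat \<Rightarrow> nat \<Rightarrow> real"
  assumes rec: "\<And>l k. b l k = b (Suc l) k + b l (Suc k)" and pos: "\<And>l k. 0 \<le> b l k"
  shows "\<exists>\<mu>. bounded_measure 1 \<mu> \<and> (AE t in \<mu>. 0 \<le> t) \<and> (\<forall>n. (\<integral>t. t ^ n \<partial>\<mu>) = b 0 n)"
proof (cases "b 0 0 = 0")
  case True
  have "b 0 n = 0" for n
  proof (induction n)
    case (Suc n)
    then show ?case using rec[of 0 n] pos[of 1 n] pos[of 0 "Suc n"] by simp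
  qed (use True in simp)
  moreover have "bounded_measure 1 (null_measure borel)"
    by (auto simp: bounded_measure_def AE_iff_null null_sets_def intro!: finite_measureI)
  moreover have "AE t in null_measure borel. 0 \<le> (t::real)"
    by (auto simp: AE_iff_null null_sets_def)
  moreover have "(\<integral>t. t ^ n \<partial>null_measure borel) = (0::real)" for n
    by (rule integral_eq_zero_AE) (auto simp: AE_iff_null null_sets_def)
  ultimately show ?thesis by (intro exI[of _ "null_measure borel"] conjI allI) auto
next
  case False
  define c where "c = b 0 0"
  have c: "c > 0" using False pos[of 0 0] by (simp add: c_def)
  have "b l k / c = b (Suc l) k / c + b l (Suc k) / c" for l k
    by (subst rec) (simp add: add_divide_distrib)
  moreover have "0 \<le> b l k / c" for l k using pos[of l k] c by simp
  moreover have "b 0 0 / c = 1" using c by (simp add: c_def)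
  ultimately obtain \<mu> where \<mu>: "bounded_measure 1 \<mu>" "AE t in \<mu>. 0 \<le> t"
    "\<And>n. (\<integral>t. t ^ n \<partial>\<mu>) = b 0 n / c"
    using hausdorff_moments_normalized[of "\<lambda>l k. b l k / c"] by blast
  let ?\<nu> = "density \<mu> (\<lambda>_. ennreal c)"
  note B = bounded_measureD[OF \<mu>(1)]
  have "finite_measure ?\<nu>"
    using finite_measure.emeasure_finite[OF B(2), of "space \<mu>"]
    by (intro finite_measureI) (simp add: emeasure_density nn_integral_cmult ennreal_mult_eq_top_iff)
  then have "bounded_measure 1 ?\<nu>" using B by (simp add: bounded_measure_def AE_density)
  moreover have "AE t in ?\<nu>. 0 \<le> t" using \<mu>(2) by (simp add: AE_density)
  moreover have "(\<integral>t. t ^ n \<partial>?\<nu>) = b 0 n" for n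
  proof -
    have "(\<integral>t. t ^ n \<partial>?\<nu>) = (\<integral>t. c * t ^ n \<partial>\<mu>)"
      using c B(1) by (subst integral_density) (auto cong: measurable_cong_sets)
    then show ?thesis using \<mu>(3) c by simp
  qed
  ultimately show ?thesis by blast
qed

section \<open>Polarized integrals\<close>

text \<open>The combination lemmas ask for globally bounded functions, while monomials and densities
  are bounded only on the interval carrying the measures; cutting off there changes no
  integral.\<close>

lemma combination_cutoff:
  fixes f :: "real \<Rightarrow> real" and g :: "real \<Rightarrow> complex"
  assumes "bounded_measure K \<mu>" "f \<in> borel_measurable borel" "g \<in> borel_measurable borel"
  shows "(\<integral>t. (f t * indicator {-K..K} t) *\<^sub>R (indicator {-K..K} t *\<^sub>R g t) \<partial>\<mu>) = (\<integral>t. f t *\<^sub>R g t \<partial>\<mu>)"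
    and "(\<integral>t. f t *\<^sub>R (indicator {-K..K} t *\<^sub>R g t) \<partial>\<mu>) = (\<integral>t. f t *\<^sub>R g t \<partial>\<mu>)"
proof -
  note B = bounded_measureD[OF assms(1)]
  have [measurable_cong]: "sets \<mu> = sets borel" by (rule B)
  have [measurable]: "f \<in> borel_measurable borel" "g \<in> borel_measurable borel" by fact+
  have "AE t in \<mu>. indicator {-K..K} t = (1::real)"
    using B(3) by eventually_elim (auto simp: indicator_def)
  then have "AE t in \<mu>. (f t * indicator {-K..K} t) *\<^sub>R (indicator {-K..K} t *\<^sub>R g t) = f t *\<^sub>R g t"
    "AE t in \<mu>. f t *\<^sub>R (indicator {-K..K} t *\<^sub>R g t) = f t *\<^sub>R g t"
    by (eventually_elim, simp)+
  then show "(\<integral>t. (f t * indicator {-K..K} t) *\<^sub>R (indicator {-K..K} t *\<^sub>R g t) \<partial>\<mu>) = (\<integral>t. f t *\<^sub>R g t \<partial>\<mu>)"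
    and "(\<integral>t. f t *\<^sub>R (indicator {-K..K} t *\<^sub>R g t) \<partial>\<mu>) = (\<integral>t. f t *\<^sub>R g t \<partial>\<mu>)"
    by (auto intro!: integral_cong_AE)
qed

text \<open>The integral of \<open>f\<close> against the would-be complex measure of the pair
  \<open>(v, w)\<close>, by the polarization identity with the four vectors v + i^k w. No
  sesquilinearity is built in; it depends on the family \<open>m\<close>.\<close>

definition polar_integral ::
  "(('s \<Rightarrow> complex) \<Rightarrow> real measure) \<Rightarrow> (real \<Rightarrow> real) \<Rightarrow> ('s \<Rightarrow> complex) \<Rightarrow> ('s \<Rightarrow> complex) \<Rightarrow> complex" where
  "polar_integral m f v w = (\<Sum>k<4. \<integral>t. f t *\<^sub>R (\<i> ^ k / 4) \<partial>m (\<lambda>x. v x + \<i> ^ k * w x))"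

text \<open>Each term has its own density \<open>h j\<close>, so that relations such as "the measure
  of \<open>(T v, w)\<close> is \<open>t\<close> times that of \<open>(v, w)\<close>" are covered.
  The hypothesis has two forms because the constructed measures are known by their moments, whereas
  those of a given spectral measure are known on Borel sets.\<close>

lemma polar_integral_relation:
  fixes a :: "'j \<Rightarrow> complex" and h :: "'j \<Rightarrow> real \<Rightarrow> real"
  assumes m: "\<And>v. v \<in> l2 S \<Longrightarrow> bounded_measure K (m v)" and J: "finite J"
    and v: "\<And>j. j \<in> J \<Longrightarrow> v j \<in> l2 S" and w: "\<And>j. j \<in> J \<Longrightarrow> w j \<in> l2 S"
    and h: "\<And>j. j \<in> J \<Longrightarrow> h j \<in> borel_measurable borel"
    and hb: "\<And>j t. j \<in> J \<Longrightarrow> \<bar>t\<bar> \<le> K \<Longrightarrow> \<bar>h j t\<bar> \<le> C"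
    and z: "(\<forall>n. (\<Sum>j\<in>J. a j * polar_integral m (\<lambda>t. t ^ n * h j t) (v j) (w j)) = 0) \<or>
      (\<forall>B\<in>sets borel. (\<Sum>j\<in>J. a j * polar_integral m (\<lambda>t. indicator B t * h j t) (v j) (w j)) = 0)"
    and f: "f \<in> borel_measurable borel" and fb: "\<And>t. \<bar>t\<bar> \<le> K \<Longrightarrow> \<bar>f t\<bar> \<le> D"
  shows "(\<Sum>j\<in>J. a j * polar_integral m (\<lambda>t. f t * h j t) (v j) (w j)) = 0"
proof -
  let ?I = "J \<times> {..<4::nat}"
  define \<mu> where "\<mu> p = m (\<lambda>x. v (fst p) x + \<i> ^ snd p * w (fst p) x)" for p
  \<comment> \<open>Coefficient, density and polarization weight merge into one complex density, one
    for each term and each of the four vectors.\<close>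
  define g where "g p t = of_real (h (fst p) t) * (a (fst p) * (\<i> ^ snd p / 4))" for p t
  let ?g = "\<lambda>p t. indicator {-K..K} t *\<^sub>R g p t"
  have \<mu>: "bounded_measure K (\<mu> p)" if "p \<in> ?I" for p
    unfolding \<mu>_def using that v w by (intro m l2_add l2_scale) auto
  have \<mu>': "sets (\<mu> p) = sets borel \<and> finite_measure (\<mu> p)" if "p \<in> ?I" for p
    using bounded_measureD[OF \<mu>[OF that]] by blast
  have gm: "g p \<in> borel_measurable borel" if "p \<in> ?I" for p
    unfolding g_def using h[of "fst p"] that by auto
  have gm': "?g p \<in> borel_measurable borel" if "p \<in> ?I" for p
    using gm[OF that] by measurable
  have expand: "(\<Sum>p\<in>?I. \<integral>t. f t *\<^sub>R g p t \<partial>\<mu> p)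
      = (\<Sum>j\<in>J. a j * polar_integral m (\<lambda>t. f t * h j t) (v j) (w j))" for f :: "real \<Rightarrow> real"
  proof -
    have "(\<integral>t. f t *\<^sub>R g p t \<partial>\<mu> p)
        = a (fst p) * (\<integral>t. (f t * h (fst p) t) *\<^sub>R (\<i> ^ snd p / 4) \<partial>\<mu> p)" for p
      by (subst integral_mult_right_zero[symmetric])
        (auto simp: g_def scaleR_conv_of_real algebra_simps intro!: Bochner_Integration.integral_cong)
    then show ?thesis
      by (simp add: polar_integral_def \<mu>_def sum_distrib_left sum.cartesian_product split_beta)
  qed
  define M where "M = (\<Sum>j\<in>J. cmod (a j))"
  have gb: "norm (?g p t) \<le> \<bar>C\<bar> * M" if "p \<in> ?I" for p t
  proof (cases "\<bar>t\<bar> \<le> K")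
    case True
    obtain j k where p: "p = (j, k)" "j \<in> J" using \<open>p \<in> ?I\<close> by auto
    have aM: "cmod (a j) \<le> M" unfolding M_def using p J by (intro member_le_sum) auto
    then have aM4: "cmod (a j) / 4 \<le> M" using norm_ge_zero[of "a j"] by linarith
    have "norm (?g p t) \<le> norm (g p t)" by (simp add: indicator_def)
    also have "\<dots> = \<bar>h j t\<bar> * (cmod (a j) / 4)"
      by (simp add: g_def p norm_mult norm_divide norm_power)
    also have "\<dots> \<le> \<bar>C\<bar> * M"
      using hb[OF p(2) True] aM4 by (intro mult_mono) auto
    finally show ?thesis .
  next
    case False
    then show ?thesis by (auto simp: indicator_def M_def abs_le_iff intro!: mult_nonneg_nonneg sum_nonneg)
  qed
  let ?f = "\<lambda>t. f t * indicator {-K..K} t"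
  have f': "?f \<in> borel_measurable borel" using f by measurable
  have fb': "\<bar>?f t\<bar> \<le> \<bar>D\<bar>" for t
  proof (cases "t \<in> {-K..K}")
    case True
    then have "\<bar>t\<bar> \<le> K" by auto
    from fb[OF this] show ?thesis unfolding indicator_def using True by auto
  qed simp
  have fin: "finite ?I" using J by simp
  have "(\<Sum>p\<in>?I. \<integral>t. ?f t *\<^sub>R ?g p t \<partial>\<mu> p) = 0"
    using z
  proof
    assume z: "\<forall>n. (\<Sum>j\<in>J. a j * polar_integral m (\<lambda>t. t ^ n * h j t) (v j) (w j)) = 0"
    show ?thesis
    proof (rule combination_from_moments[OF fin \<mu> gm' gb _ f' fb'])
      fix n
      have "(\<Sum>p\<in>?I. \<integral>t. t ^ n *\<^sub>R ?g p t \<partial>\<mu> p) = (\<Sum>p\<in>?I. \<integral>t. t ^ n *\<^sub>R g p t \<partial>\<mu> p)"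
        by (intro sum.cong refl combination_cutoff(2)[OF \<mu>] gm) auto
      then show "(\<Sum>p\<in>?I. \<integral>t. t ^ n *\<^sub>R ?g p t \<partial>\<mu> p) = 0" using z expand by simp
    qed
  next
    assume z: "\<forall>B\<in>sets borel. (\<Sum>j\<in>J. a j * polar_integral m (\<lambda>t. indicator B t * h j t) (v j) (w j)) = 0"
    show ?thesis
    proof (rule combination_from_indicator[OF \<mu>' gm' gb _ f' fb'])
      fix B :: "real set" assume B: "B \<in> sets borel"
      have "(\<Sum>p\<in>?I. \<integral>t. indicator B t *\<^sub>R ?g p t \<partial>\<mu> p) = (\<Sum>p\<in>?I. \<integral>t. indicator B t *\<^sub>R g p t \<partial>\<mu> p)"
        by (intro sum.cong refl combination_cutoff(2)[OF \<mu>] gm) (use B in auto)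
      then show "(\<Sum>p\<in>?I. \<integral>t. indicator B t *\<^sub>R ?g p t \<partial>\<mu> p) = 0" using z B expand by simp
    qed
  qed
  moreover have "(\<Sum>p\<in>?I. \<integral>t. ?f t *\<^sub>R ?g p t \<partial>\<mu> p) = (\<Sum>p\<in>?I. \<integral>t. f t *\<^sub>R g p t \<partial>\<mu> p)"
    by (intro sum.cong refl combination_cutoff(1)[OF \<mu> f gm])
  ultimately show ?thesis using expand by simp
qed

lemma polar_integral_eqI:
  assumes m: "\<And>v. v \<in> l2 S \<Longrightarrow> bounded_measure K (m v)"
    and v: "v \<in> l2 S" "w \<in> l2 S" "v' \<in> l2 S" "w' \<in> l2 S"
    and h: "h \<in> borel_measurable borel" "\<And>t. \<bar>t\<bar> \<le> K \<Longrightarrow> \<bar>h t\<bar> \<le> C"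
    and z: "(\<forall>n. polar_integral m (\<lambda>t. t ^ n) v w = polar_integral m (\<lambda>t. t ^ n * h t) v' w') \<or>
      (\<forall>B\<in>sets borel. polar_integral m (indicator B) v w = polar_integral m (\<lambda>t. indicator B t * h t) v' w')"
    and f: "f \<in> borel_measurable borel" "\<And>t. \<bar>t\<bar> \<le> K \<Longrightarrow> \<bar>f t\<bar> \<le> D"
  shows "polar_integral m f v w = polar_integral m (\<lambda>t. f t * h t) v' w'"
proof -
  have "(\<Sum>j\<in>(UNIV::bool set). (if j then 1 else -1) *
      polar_integral m (\<lambda>t. f t * (if j then 1 else h t)) (if j then v else v') (if j then w else w')) = 0"
    by (rule polar_integral_relation[where h="\<lambda>j t. if j then 1 else h t" and C="max 1 C" and D=D and K=K and S=S])
      (use assms in \<open>auto simp: UNIV_bool le_max_iff_disj\<close>)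
  then show ?thesis by (simp add: UNIV_bool)
qed

text \<open>In the expansion with c = i^k the weights i^k / 4 leave only the part that contains
  \<open>cnj c\<close>, as the sums of i^k and of i^(2k) over four values of \<open>k\<close>
  vanish.\<close>

lemma polarization:
  assumes A: "self_adjoint_on S A" and v: "v \<in> l2 S" and w: "w \<in> l2 S"
  shows "(\<Sum>k<4. of_real (Re (l2_inner S (A (\<lambda>x. v x + \<i> ^ k * w x)) (\<lambda>x. v x + \<i> ^ k * w x))) * (\<i> ^ k / 4))
    = l2_inner S (A v) w"
proof -
  let ?q = "\<lambda>u. l2_inner S (A u) u"
  have Al2: "A u \<in> l2 S" if "u \<in> l2 S" for u
    using A that by (auto simp: self_adjoint_on_def l2_linear_def)
  have real: "of_real (Re (?q u)) = ?q u" if "u \<in> l2 S" for u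
  proof -
    have "cnj (?q u) = ?q u" using A that by (simp add: self_adjoint_on_def l2_inner_cnj)
    then show ?thesis by (metis Reals_cnj_iff of_real_Re)
  qed
  have ex: "?q (\<lambda>x. v x + c * w x) = ?q v + cnj c * l2_inner S (A v) w + c * l2_inner S (A w) v + c * cnj c * ?q w" for c
  proof -
    have u: "(\<lambda>x. v x + c * w x) = (\<lambda>x. c * w x + v x)" by auto
    have Au: "A (\<lambda>x. c * w x + v x) = (\<lambda>x. c * A w x + A v x)"
      using A v w by (auto simp: self_adjoint_on_def l2_linear_def)
    show ?thesis
      unfolding u Au
        l2_inner_lincomb_left[OF Al2[OF w] Al2[OF v] l2_lincomb[OF w v]]
        l2_inner_lincomb_right[OF w v Al2[OF w]] l2_inner_lincomb_right[OF w v Al2[OF v]]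
      by (simp add: algebra_simps)
  qed
  have "of_real (Re (?q (\<lambda>x. v x + c * w x)))
      = ?q v + cnj c * l2_inner S (A v) w + c * l2_inner S (A w) v + c * cnj c * ?q w" for c
    using real[OF l2_add[OF v l2_scale[OF w]]] ex by metis
  then have "(\<Sum>k<4. of_real (Re (?q (\<lambda>x. v x + \<i> ^ k * w x))) * (\<i> ^ k / 4))
    = (\<Sum>k<4. (?q v + cnj (\<i> ^ k) * l2_inner S (A v) w + \<i> ^ k * l2_inner S (A w) v
        + \<i> ^ k * cnj (\<i> ^ k) * ?q w) * (\<i> ^ k / 4))"
    by (simp only:)
  also have "\<dots> = l2_inner S (A v) w"
    by (simp add: numeral_eq_Suc sum.lessThan_Suc) (simp add: field_simps)
  finally show ?thesis .
qed

lemma polar_integral_eq: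
  assumes m: "\<And>v. v \<in> l2 S \<Longrightarrow> bounded_measure K (m v)"
    and v: "v \<in> l2 S" "w \<in> l2 S"
    and f: "f \<in> borel_measurable borel" "\<And>t. \<bar>t\<bar> \<le> K \<Longrightarrow> \<bar>f t\<bar> \<le> D"
  shows "polar_integral m f v w =
    (\<Sum>k<4. of_real (\<integral>t. f t \<partial>m (\<lambda>x. v x + \<i> ^ k * w x)) * (\<i> ^ k / 4))"
  unfolding polar_integral_def
proof (rule sum.cong)
  fix k :: nat
  have "bounded_measure K (m (\<lambda>x. v x + \<i> ^ k * w x))" by (intro m l2_add l2_scale v)
  then have "integrable (m (\<lambda>x. v x + \<i> ^ k * w x)) f"
    by (rule bounded_measure_integrable[of _ _ _ D]) (use f in auto)
  then show "(\<integral>t. f t *\<^sub>R (\<i> ^ k / 4) \<partial>m (\<lambda>x. v x + \<i> ^ k * w x))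
    = of_real (\<integral>t. f t \<partial>m (\<lambda>x. v x + \<i> ^ k * w x)) * (\<i> ^ k / 4)"
    by (subst integral_scaleR_left) (auto simp: scaleR_conv_of_real)
qed simp

text \<open>The bridge from measures to operators: wherever the integrals of \<open>f\<close> form
  the quadratic form of a self-adjoint operator, the polarized integral is its sesquilinear
  form.\<close>

lemma polar_integral_operator:
  assumes m: "\<And>v. v \<in> l2 S \<Longrightarrow> bounded_measure K (m v)"
    and v: "v \<in> l2 S" "w \<in> l2 S"
    and f: "f \<in> borel_measurable borel" "\<And>t. \<bar>t\<bar> \<le> K \<Longrightarrow> \<bar>f t\<bar> \<le> D"
    and A: "self_adjoint_on S A" "\<And>u. u \<in> l2 S \<Longrightarrow> (\<integral>t. f t \<partial>m u) = Re (l2_inner S (A u) u)"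
  shows "polar_integral m f v w = l2_inner S (A v) w"
proof -
  have "polar_integral m f v w = (\<Sum>k<4. of_real (\<integral>t. f t \<partial>m (\<lambda>x. v x + \<i> ^ k * w x)) * (\<i> ^ k / 4))"
    by (rule polar_integral_eq[OF m v f])
  also have "\<dots> = (\<Sum>k<4. of_real (Re (l2_inner S (A (\<lambda>x. v x + \<i> ^ k * w x)) (\<lambda>x. v x + \<i> ^ k * w x))) * (\<i> ^ k / 4))"
    by (subst A(2)) (auto intro!: l2_add l2_scale v)
  also have "\<dots> = l2_inner S (A v) w" by (rule polarization[OF A(1) v])
  finally show ?thesis .
qed

lemma power_bound_on: "\<bar>t\<bar> \<le> K \<Longrightarrow> \<bar>t ^ n\<bar> \<le> (K::real) ^ n"
  by (simp add: power_abs power_mono)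

section \<open>Bounded positive operators\<close>

text \<open>Boundedness is imposed on the quadratic form only. Together with positivity it says
  \<open>0 \<le> T / K \<le> 1\<close>, which is what the moment problem on [0,1] requires.\<close>

locale positive_operator =
  fixes S :: "'s set" and T :: "('s \<Rightarrow> complex) \<Rightarrow> 's \<Rightarrow> complex" and K :: real
  assumes psa: "positive_self_adjoint_on S T"
    and bound: "\<And>v. v \<in> l2 S \<Longrightarrow> Re (l2_inner S (T v) v) \<le> K * Re (l2_inner S v v)"
    and K: "0 < K"
begin

lemma T_l2 [simp]: "v \<in> l2 S \<Longrightarrow> T v \<in> l2 S"
  using psa by (auto simp: positive_self_adjoint_on_def self_adjoint_on_def l2_linear_def)

lemma T_lin: "u \<in> l2 S \<Longrightarrow> v \<in> l2 S \<Longrightarrow> T (\<lambda>x. c * u x + v x) = (\<lambda>x. c * T u x + T v x)"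
  using psa by (auto simp: positive_self_adjoint_on_def self_adjoint_on_def l2_linear_def)

lemma T_sym: "u \<in> l2 S \<Longrightarrow> v \<in> l2 S \<Longrightarrow> l2_inner S (T u) v = l2_inner S u (T v)"
  using psa by (auto simp: positive_self_adjoint_on_def self_adjoint_on_def)

lemma T_pos: "v \<in> l2 S \<Longrightarrow> 0 \<le> Re (l2_inner S (T v) v)"
  using psa by (auto simp: positive_self_adjoint_on_def)

lemma Tpow_l2 [simp]: "v \<in> l2 S \<Longrightarrow> (T ^^ n) v \<in> l2 S"
  by (induction n) auto

lemma Tpow_lin:
  "u \<in> l2 S \<Longrightarrow> v \<in> l2 S \<Longrightarrow> (T ^^ n) (\<lambda>x. c * u x + v x) = (\<lambda>x. c * (T ^^ n) u x + (T ^^ n) v x)"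
  by (induction n) (simp_all add: T_lin)

lemma Tpow_sym:
  "u \<in> l2 S \<Longrightarrow> v \<in> l2 S \<Longrightarrow> l2_inner S ((T ^^ n) u) v = l2_inner S u ((T ^^ n) v)"
proof (induction n arbitrary: u v)
  case (Suc n)
  then show ?case by (simp add: T_sym funpow_swap1)
qed simp

lemma Tpow_self_adjoint: "self_adjoint_on S (T ^^ n)"
  by (auto simp: self_adjoint_on_def l2_linear_def Tpow_lin Tpow_sym)

text \<open>\<open>A = T / K\<close> and \<open>1 - A\<close> are both positive, and so are their products
  \<open>A\<^sup>k (1 - A)\<^sup>l\<close>: split off squares; the remaining case is
  \<open>A (1 - A) = (1 - A) A (1 - A) + A (1 - A) A\<close>.\<close>

lemma T_scale: "v \<in> l2 S \<Longrightarrow> T (\<lambda>x. c * v x) = (\<lambda>x. c * T v x)"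
  using T_lin[of v v "c - 1"] by (simp add: algebra_simps)

lemma Tpow_scale: "v \<in> l2 S \<Longrightarrow> (T ^^ n) (\<lambda>x. c * v x) = (\<lambda>x. c * (T ^^ n) v x)"
  using Tpow_lin[of v v n "c - 1"] by (simp add: algebra_simps)

definition \<kappa> :: complex where
  "\<kappa> = of_real (1 / K)"

lemma \<kappa>: "cnj \<kappa> = \<kappa>" "Re (\<kappa> * z) = Re z / K" "Re (\<kappa> ^ n * z) = Re z / K ^ n"
  by (simp_all add: \<kappa>_def power_divide flip: of_real_power)

definition A :: "('s \<Rightarrow> complex) \<Rightarrow> 's \<Rightarrow> complex" where
  "A v = (\<lambda>x. \<kappa> * T v x)"

definition R :: "('s \<Rightarrow> complex) \<Rightarrow> 's \<Rightarrow> complex" where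
  "R v = (\<lambda>x. v x - A v x)"

lemma A_l2 [simp]: "v \<in> l2 S \<Longrightarrow> A v \<in> l2 S"
  unfolding A_def by (intro l2_scale T_l2)

lemma R_l2 [simp]: "v \<in> l2 S \<Longrightarrow> R v \<in> l2 S"
  unfolding R_def by (intro l2_diff A_l2)

lemma A_lin: "u \<in> l2 S \<Longrightarrow> v \<in> l2 S \<Longrightarrow> A (\<lambda>x. c * u x + v x) = (\<lambda>x. c * A u x + A v x)"
  by (simp only: A_def T_lin) (simp add: algebra_simps)

lemma AR_l2 [simp]: "v \<in> l2 S \<Longrightarrow> (A ^^ k) v \<in> l2 S" "v \<in> l2 S \<Longrightarrow> (R ^^ l) v \<in> l2 S"
  by (induction k, simp_all) (induction l, simp_all)

lemma A_diff: "u \<in> l2 S \<Longrightarrow> v \<in> l2 S \<Longrightarrow> A (\<lambda>x. u x - v x) = (\<lambda>x. A u x - A v x)"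
  using A_lin[of v u "-1"] by simp

lemma A_sym: "u \<in> l2 S \<Longrightarrow> v \<in> l2 S \<Longrightarrow> l2_inner S (A u) v = l2_inner S u (A v)"
  by (simp add: A_def l2_inner_scale T_sym \<kappa>)

lemma R_sym: "u \<in> l2 S \<Longrightarrow> v \<in> l2 S \<Longrightarrow> l2_inner S (R u) v = l2_inner S u (R v)"
  by (simp add: R_def l2_inner_diff A_sym)

lemma A_pos: "v \<in> l2 S \<Longrightarrow> 0 \<le> Re (l2_inner S (A v) v)"
  using K by (simp add: A_def l2_inner_scale T_pos \<kappa> del: times_complex.sel)

lemma R_pos: "v \<in> l2 S \<Longrightarrow> 0 \<le> Re (l2_inner S (R v) v)"
  using K bound[of v]
  by (simp add: R_def A_def l2_inner_diff l2_inner_scale l2_scale \<kappa> divide_le_eq mult.commute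
      del: times_complex.sel)

lemma AR_commute: "v \<in> l2 S \<Longrightarrow> A (R v) = R (A v)"
  by (simp add: R_def A_diff)

lemma A_Rpow: "v \<in> l2 S \<Longrightarrow> A ((R ^^ l) v) = (R ^^ l) (A v)"
  by (induction l) (simp_all add: AR_commute)

lemma R_Apow: "v \<in> l2 S \<Longrightarrow> R ((A ^^ k) v) = (A ^^ k) (R v)"
  by (induction k) (simp_all add: AR_commute[symmetric])

lemma A_R_decomp: "v = (\<lambda>x. R v x + A v x)"
  by (simp add: R_def)

lemma AR_pos: "v \<in> l2 S \<Longrightarrow> 0 \<le> Re (l2_inner S ((A ^^ k) ((R ^^ l) v)) v)"
\<comment> \<open>The vector varies, because a factor split off at both ends turns \<open>v\<close>
  into \<open>A v\<close> or \<open>R v\<close>.\<close>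
proof (induction "k + l" arbitrary: k l v rule: less_induct)
  case less
  show ?case
  proof (cases "k \<ge> 2")
    case True
    then obtain k' where k: "k = Suc (Suc k')" by (metis add_2_eq_Suc le_Suc_ex)
    have "l2_inner S ((A ^^ k) ((R ^^ l) v)) v = l2_inner S (A ((A ^^ k') (A ((R ^^ l) v)))) v"
      by (simp add: k funpow_swap1)
    also have "\<dots> = l2_inner S ((A ^^ k') ((R ^^ l) (A v))) (A v)"
      using less.prems by (simp add: A_sym A_Rpow)
    finally show ?thesis using less.hyps[of k' l "A v"] less.prems k by simp
  next
    case k: False
    show ?thesis
    proof (cases "l \<ge> 2")
      case True
      then obtain l' where l: "l = Suc (Suc l')" by (metis add_2_eq_Suc le_Suc_ex)
      have "(A ^^ k) ((R ^^ l) v) = (A ^^ k) (R ((R ^^ l') (R v)))"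
        by (simp add: l funpow_swap1)
      also have "\<dots> = R ((A ^^ k) ((R ^^ l') (R v)))" using less.prems by (simp add: R_Apow)
      finally have "l2_inner S ((A ^^ k) ((R ^^ l) v)) v = l2_inner S ((A ^^ k) ((R ^^ l') (R v))) (R v)"
        using less.prems by (simp add: R_sym)
      then show ?thesis using less.hyps[of k l' "R v"] less.prems l by simp
    next
      case l: False
      consider "k = 0" "l = 0" | "k = 1" "l = 0" | "k = 0" "l = 1" | "k = 1" "l = 1"
        using k l by linarith
      then show ?thesis
      proof cases
        case 4
        have "l2_inner S (A (R v)) v = l2_inner S (A (R v)) (\<lambda>x. R v x + A v x)"
          using A_R_decomp[of v] by simp
        also have "\<dots> = l2_inner S (A (R v)) (R v) + l2_inner S (R (A v)) (A v)"
          using less.prems by (simp add: l2_inner_add AR_commute)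
        finally show ?thesis using 4 A_pos[of "R v"] R_pos[of "A v"] less.prems by simp
      qed (use less.prems in \<open>simp_all add: A_pos R_pos l2_inner_self_nonneg\<close>)
    qed
  qed
qed

section \<open>Scalar spectral measures of vectors\<close>

lemma Apow: "v \<in> l2 S \<Longrightarrow> (A ^^ n) v = (\<lambda>x. \<kappa> ^ n * (T ^^ n) v x)"
  by (induction n) (simp_all add: A_def T_scale mult.assoc)

text \<open>Finitely many vectors are treated together: one vector gives its scalar spectral
  measure, and the vectors \<open>delta (i, \<one>)\<close> give the measure of the trace.\<close>

lemma spectral_moments_exist:
  assumes v: "\<And>i. i < d \<Longrightarrow> v i \<in> l2 S"
  shows "\<exists>\<mu>. bounded_measure K \<mu> \<and> (AE t in \<mu>. 0 \<le> t) \<and>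
    (\<forall>n. (\<integral>t. t ^ n \<partial>\<mu>) = (\<Sum>i<(d::nat). Re (l2_inner S ((T ^^ n) (v i)) (v i))))"
proof -
  define b where "b l k = (\<Sum>i<d. Re (l2_inner S ((A ^^ k) ((R ^^ l) (v i))) (v i)))" for l k
  \<comment> \<open>The Hausdorff recursion is the identity \<open>1 = R + A\<close> inserted
    between the powers.\<close>
  have step: "l2_inner S ((A ^^ k) ((R ^^ l) u)) u =
    l2_inner S ((A ^^ k) ((R ^^ Suc l) u)) u + l2_inner S ((A ^^ Suc k) ((R ^^ l) u)) u"
    if u: "u \<in> l2 S" for l k u
  proof -
    let ?u = "(R ^^ l) u"
    have u': "?u \<in> l2 S" using u by simp
    have "(A ^^ k) ?u = (\<lambda>x. R ((A ^^ k) ?u) x + A ((A ^^ k) ?u) x)"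
      using A_R_decomp[of "(A ^^ k) ?u"] by simp
    also have "R ((A ^^ k) ?u) = (A ^^ k) ((R ^^ Suc l) u)" using u' by (simp add: R_Apow)
    also have "A ((A ^^ k) ?u) = (A ^^ Suc k) ?u" by simp
    finally have e: "(A ^^ k) ?u = (\<lambda>x. (A ^^ k) ((R ^^ Suc l) u) x + (A ^^ Suc k) ?u x)" .
    have "l2_inner S ((A ^^ k) ?u) u
        = l2_inner S (\<lambda>x. (A ^^ k) ((R ^^ Suc l) u) x + (A ^^ Suc k) ?u x) u"
      by (rule arg_cong[OF e])
    also have "\<dots> = l2_inner S ((A ^^ k) ((R ^^ Suc l) u)) u + l2_inner S ((A ^^ Suc k) ?u) u"
      using u by (intro l2_inner_add AR_l2)
    finally show ?thesis .
  qed
  have "b l k = b (Suc l) k + b l (Suc k)" for l k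
    unfolding b_def sum.distrib[symmetric]
  proof (rule sum.cong)
    fix i assume "i \<in> {..<d}"
    then have "v i \<in> l2 S" using v by simp
    then show "Re (l2_inner S ((A ^^ k) ((R ^^ l) (v i))) (v i)) =
      Re (l2_inner S ((A ^^ k) ((R ^^ Suc l) (v i))) (v i)) + Re (l2_inner S ((A ^^ Suc k) ((R ^^ l) (v i))) (v i))"
      by (subst step) (simp_all only: plus_complex.sel)
  qed simp
  moreover have "0 \<le> b l k" for l k unfolding b_def using v by (intro sum_nonneg AR_pos) auto
  ultimately have "\<exists>\<mu>. bounded_measure 1 \<mu> \<and> (AE t in \<mu>. 0 \<le> t) \<and> (\<forall>n. (\<integral>t. t ^ n \<partial>\<mu>) = b 0 n)"
    by (rule hausdorff_moments)
  then obtain \<mu> where \<mu>: "bounded_measure 1 \<mu>" "AE t in \<mu>. 0 \<le> t"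
    "\<And>n. (\<integral>t. t ^ n \<partial>\<mu>) = b 0 n"
    by blast
  note B = bounded_measureD[OF \<mu>(1)]
  have [measurable_cong]: "sets \<mu> = sets borel" by (rule B)
  \<comment> \<open>Undoes the normalization \<open>A = T / K\<close>.\<close>
  let ?\<nu> = "distr \<mu> borel (\<lambda>t. K * t)"
  have "finite_measure ?\<nu>" using B(2) by (intro finite_measure.finite_measure_distr) auto
  moreover have "AE t in ?\<nu>. \<bar>t\<bar> \<le> K"
    using B(3) K by (subst AE_distr_iff) (auto simp: abs_mult elim!: eventually_mono)
  ultimately have "bounded_measure K ?\<nu>" by (simp add: bounded_measure_def)
  moreover have "AE t in ?\<nu>. 0 \<le> t"
    using \<mu>(2) K by (subst AE_distr_iff) (auto elim!: eventually_mono)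
  moreover have "(\<integral>t. t ^ n \<partial>?\<nu>) = (\<Sum>i<d. Re (l2_inner S ((T ^^ n) (v i)) (v i)))" for n
  proof -
    have "(\<integral>t. t ^ n \<partial>?\<nu>) = K ^ n * b 0 n"
      using \<mu>(3)[of n] by (subst integral_distr) (auto simp: power_mult_distrib)
    also have "\<dots> = (\<Sum>i<d. Re (l2_inner S ((T ^^ n) (v i)) (v i)))"
      using K v by (simp add: b_def Apow l2_inner_scale \<kappa> sum_distrib_left del: times_complex.sel)
    finally show ?thesis .
  qed
  ultimately show ?thesis by blast
qed

definition sm :: "('s \<Rightarrow> complex) \<Rightarrow> real measure" where
  "sm v = (SOME \<mu>. bounded_measure K \<mu> \<and> (AE t in \<mu>. 0 \<le> t) \<and>
    (\<forall>n. (\<integral>t. t ^ n \<partial>\<mu>) = Re (l2_inner S ((T ^^ n) v) v)))"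

lemma sm:
  assumes "v \<in> l2 S"
  shows "bounded_measure K (sm v)" "AE t in sm v. 0 \<le> t"
    "(\<integral>t. t ^ n \<partial>sm v) = Re (l2_inner S ((T ^^ n) v) v)"
  proof -
  have "\<exists>\<mu>. bounded_measure K \<mu> \<and> (AE t in \<mu>. 0 \<le> t) \<and>
    (\<forall>n. (\<integral>t. t ^ n \<partial>\<mu>) = Re (l2_inner S ((T ^^ n) v) v))"
    using spectral_moments_exist[of 1 "\<lambda>_. v"] assms by simp
  from someI_ex[OF this, folded sm_def]
  show "bounded_measure K (sm v)" "AE t in sm v. 0 \<le> t"
    "(\<integral>t. t ^ n \<partial>sm v) = Re (l2_inner S ((T ^^ n) v) v)" by blast+
qed

text \<open>The measures are chosen for each vector separately, so their homogeneity has to be read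
  off from the moments.\<close>

lemma sm_scale:
  assumes v: "v \<in> l2 S" and f: "f \<in> borel_measurable borel" "\<And>t. \<bar>f t\<bar> \<le> D"
  shows "(\<integral>t. f t \<partial>sm (\<lambda>x. c * v x)) = (cmod c)\<^sup>2 * (\<integral>t. f t \<partial>sm v)"
proof -
  have cv: "(\<lambda>x. c * v x) \<in> l2 S" using v by (rule l2_scale)
  let ?m = "\<lambda>b. if b then sm (\<lambda>x. c * v x) else sm v"
  let ?c = "\<lambda>b. if b then 1 else - of_real ((cmod c)\<^sup>2) :: complex"
  have int: "(\<integral>t. f t *\<^sub>R d \<partial>sm u) = of_real (\<integral>t. f t \<partial>sm u) * d"
    if "u \<in> l2 S" "integrable (sm u) f" for u d and f :: "real \<Rightarrow> real"
    using that by (subst integral_scaleR_left) (auto simp: scaleR_conv_of_real)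
  have pw: "(T ^^ n) (\<lambda>x. c * v x) = (\<lambda>x. c * (T ^^ n) v x)" for n
    using v by (rule Tpow_scale)
  have "(\<Sum>b\<in>UNIV. \<integral>t. f t *\<^sub>R ?c b \<partial>?m b) = 0"
  proof (rule combination_from_moments[where K=K and C="1 + (cmod c)\<^sup>2" and D=D])
    fix n
    have "Re (l2_inner S ((T ^^ n) (\<lambda>x. c * v x)) (\<lambda>x. c * v x)) = (cmod c)\<^sup>2 * Re (l2_inner S ((T ^^ n) v) v)"
    proof -
      have "l2_inner S ((T ^^ n) (\<lambda>x. c * v x)) (\<lambda>x. c * v x) = of_real ((cmod c)\<^sup>2) * l2_inner S ((T ^^ n) v) v"
        unfolding pw using v by (simp add: l2_inner_scale l2_scale complex_norm_square[unfolded of_real_power])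
      then show ?thesis by simp
    qed
    then show "(\<Sum>b\<in>UNIV. \<integral>t. t ^ n *\<^sub>R ?c b \<partial>?m b) = 0"
      by (simp add: UNIV_bool int[OF v bounded_measure_integrable_power[OF sm(1)[OF v]]]
          int[OF cv bounded_measure_integrable_power[OF sm(1)[OF cv]]] sm(3)[OF v] sm(3)[OF cv]
          del: scaleR_right.add)
  qed (use sm(1)[OF v] sm(1)[OF cv] f in \<open>auto simp: norm_power\<close>)
  moreover have "integrable (sm u) f" if "u \<in> l2 S" for u
    using sm(1)[OF that] f by (intro bounded_measure_integrable[where C=D]) auto
  ultimately have "of_real (\<integral>t. f t \<partial>sm (\<lambda>x. c * v x)) = complex_of_real ((cmod c)\<^sup>2 * (\<integral>t. f t \<partial>sm v))"
    using int[OF v, of f "- of_real ((cmod c)\<^sup>2)"] int[OF cv, of f 1] v cv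
    by (simp add: UNIV_bool scaleR_conv_of_real mult.commute)
  then show ?thesis using of_real_eq_iff by blast
qed

end

section \<open>Existence and uniqueness of the spectral measure\<close>

lemma borel_indicator:
  assumes "B \<in> sets borel"
  shows "(indicator B :: real \<Rightarrow> real) \<in> borel_measurable borel" "\<bar>indicator B t :: real\<bar> \<le> 1"
  using assms by (auto simp: indicator_def)

context positive_operator
begin

abbreviation Bf :: "(real \<Rightarrow> real) \<Rightarrow> ('s \<Rightarrow> complex) \<Rightarrow> ('s \<Rightarrow> complex) \<Rightarrow> complex" where
  "Bf \<equiv> polar_integral sm"

text \<open>Monomials are where \<open>Bf\<close> is computed directly; linearity and
  multiplicativity below are transported from them.\<close>

lemma Bf_power: "v \<in> l2 S \<Longrightarrow> w \<in> l2 S \<Longrightarrow> Bf (\<lambda>t. t ^ n) v w = l2_inner S ((T ^^ n) v) w"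
  by (rule polar_integral_operator[OF sm(1) _ _ _ power_bound_on Tpow_self_adjoint sm(3)]) auto

text \<open>A three-term relation with weights 1, -c and -1, true for monomials because the powers
  of \<open>T\<close> are linear.\<close>

lemma Bf_lin_left:
  assumes f: "f \<in> borel_measurable borel" "\<And>t. \<bar>f t\<bar> \<le> D"
    and u: "u \<in> l2 S" and v: "v \<in> l2 S" and w: "w \<in> l2 S"
  shows "Bf f (\<lambda>x. c * u x + v x) w = c * Bf f u w + Bf f v w"
proof -
  let ?a = "\<lambda>j::nat. if j = 0 then 1 else if j = 1 then - c else - 1"
  let ?v = "\<lambda>j::nat. if j = 0 then (\<lambda>x. c * u x + v x) else if j = 1 then u else v"
  have l: "(\<lambda>x. c * u x + v x) \<in> l2 S" using u v by (rule l2_lincomb)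
  have "(\<Sum>j<3. ?a j * Bf (\<lambda>t. f t * 1) (?v j) w) = 0"
    by (rule polar_integral_relation[where h="\<lambda>_ _. 1" and K=K and S=S and C=1 and D=D])
      (use sm(1) l u v w f in \<open>auto simp: numeral_eq_Suc sum.lessThan_Suc Bf_power Tpow_lin l2_inner_lincomb_left\<close>)
  then show ?thesis by (simp add: numeral_eq_Suc sum.lessThan_Suc algebra_simps)
qed

lemma Bf_lin_right:
  assumes f: "f \<in> borel_measurable borel" "\<And>t. \<bar>f t\<bar> \<le> D"
    and u: "u \<in> l2 S" and v: "v \<in> l2 S" and w: "w \<in> l2 S"
  shows "Bf f w (\<lambda>x. c * u x + v x) = cnj c * Bf f w u + Bf f w v"
proof -
  let ?a = "\<lambda>j::nat. if j = 0 then 1 else if j = 1 then - cnj c else - 1"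
  let ?v = "\<lambda>j::nat. if j = 0 then (\<lambda>x. c * u x + v x) else if j = 1 then u else v"
  have l: "(\<lambda>x. c * u x + v x) \<in> l2 S" using u v by (rule l2_lincomb)
  have "(\<Sum>j<3. ?a j * Bf (\<lambda>t. f t * 1) w (?v j)) = 0"
    by (rule polar_integral_relation[where h="\<lambda>_ _. 1" and K=K and S=S and C=1 and D=D])
      (use sm(1) l u v w f in \<open>auto simp: numeral_eq_Suc sum.lessThan_Suc Bf_power l2_inner_lincomb_right\<close>)
  then show ?thesis by (simp add: numeral_eq_Suc sum.lessThan_Suc algebra_simps)
qed

lemma Bf_expand:
  assumes f: "f \<in> borel_measurable borel" "\<And>t. \<bar>f t\<bar> \<le> D" and v: "v \<in> l2 S" and w: "w \<in> l2 S"
  shows "4 * Bf f v w = of_real (\<integral>t. f t \<partial>sm (\<lambda>x. v x + w x)) - of_real (\<integral>t. f t \<partial>sm (\<lambda>x. v x - w x))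
    + \<i> * of_real (\<integral>t. f t \<partial>sm (\<lambda>x. v x + \<i> * w x)) - \<i> * of_real (\<integral>t. f t \<partial>sm (\<lambda>x. v x - \<i> * w x))"
  by (subst polar_integral_eq[OF sm(1) v w f])
    (simp_all add: numeral_eq_Suc sum.lessThan_Suc algebra_simps)

text \<open>Exchanging \<open>v\<close> and \<open>w\<close> replaces each of the four vectors by a
  multiple of modulus 1 of one of the old ones, which leaves its integrals unchanged.\<close>

lemma Bf_hermitian:
  assumes f: "f \<in> borel_measurable borel" "\<And>t. \<bar>f t\<bar> \<le> D" and v: "v \<in> l2 S" and w: "w \<in> l2 S"
  shows "Bf f v w = cnj (Bf f w v)"
proof -
  have s: "(\<integral>t. f t \<partial>sm (\<lambda>x. c * u x)) = (\<integral>t. f t \<partial>sm u)" if "u \<in> l2 S" "cmod c = 1" for u c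
    using sm_scale[OF that(1) f, of c] that(2) by simp
  have 1: "(\<integral>t. f t \<partial>sm (\<lambda>x. w x + v x)) = (\<integral>t. f t \<partial>sm (\<lambda>x. v x + w x))"
    by (simp add: add.commute)
  have 2: "(\<integral>t. f t \<partial>sm (\<lambda>x. w x - v x)) = (\<integral>t. f t \<partial>sm (\<lambda>x. v x - w x))"
    using s[of "\<lambda>x. v x - w x" "-1"] l2_diff[OF v w] by simp
  have 3: "(\<integral>t. f t \<partial>sm (\<lambda>x. w x + \<i> * v x)) = (\<integral>t. f t \<partial>sm (\<lambda>x. v x - \<i> * w x))"
    using s[of "\<lambda>x. v x - \<i> * w x" "\<i>"] l2_diff[OF v l2_scale[OF w]]
    by (simp add: algebra_simps)
  have 4: "(\<integral>t. f t \<partial>sm (\<lambda>x. w x - \<i> * v x)) = (\<integral>t. f t \<partial>sm (\<lambda>x. v x + \<i> * w x))"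
    using s[of "\<lambda>x. v x + \<i> * w x" "-\<i>"] l2_add[OF v l2_scale[OF w]]
    by (simp add: algebra_simps)
  have "4 * Bf f v w = cnj (4 * Bf f w v)"
    unfolding Bf_expand[OF f v w] Bf_expand[OF f w v] 1 2 3 4 by simp
  then show ?thesis by simp
qed

text \<open>The four vectors are now multiples of \<open>v\<close>, with squared factors 4, 2, 0, 2;
  the two imaginary contributions cancel.\<close>

lemma Bf_diag:
  assumes f: "f \<in> borel_measurable borel" "\<And>t. \<bar>f t\<bar> \<le> D" and v: "v \<in> l2 S"
  shows "Bf f v v = of_real (\<integral>t. f t \<partial>sm v)"
proof -
  have s: "(\<integral>t. f t \<partial>sm (\<lambda>x. c * v x)) = (cmod c)\<^sup>2 * (\<integral>t. f t \<partial>sm v)" for c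
    by (rule sm_scale[OF v f])
  have 1: "(\<integral>t. f t \<partial>sm (\<lambda>x. v x + v x)) = 4 * (\<integral>t. f t \<partial>sm v)"
    using s[of 2] by (simp only: mult_2) simp
  have 2: "(\<integral>t. f t \<partial>sm (\<lambda>x. v x - v x)) = 0" using s[of 0] by simp
  have 3: "(\<integral>t. f t \<partial>sm (\<lambda>x. v x + \<i> * v x)) = 2 * (\<integral>t. f t \<partial>sm v)"
    using s[of "1 + \<i>"] by (simp add: distrib_right cmod_sq)
  have 4: "(\<integral>t. f t \<partial>sm (\<lambda>x. v x - \<i> * v x)) = 2 * (\<integral>t. f t \<partial>sm v)"
    using s[of "1 - \<i>"] by (simp add: left_diff_distrib cmod_sq)
  have "4 * Bf f v v = 4 * of_real (\<integral>t. f t \<partial>sm v)"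
    unfolding Bf_expand[OF f v v] 1 2 3 4 by simp
  then show ?thesis by simp
qed

lemma Bf_indicator_diag:
  assumes "B \<in> sets borel" "v \<in> l2 S"
  shows "Bf (indicator B) v v = of_real (measure (sm v) B)"
  using bounded_measureD[OF sm(1)[OF assms(2)]] assms(1) by (subst Bf_diag[OF borel_indicator assms(2)]) auto

lemma sm_measure_le:
  assumes "B \<in> sets borel" "v \<in> l2 S"
  shows "measure (sm v) B \<le> Re (l2_inner S v v)"
proof -
  note B = bounded_measureD[OF sm(1)[OF assms(2)]]
  have "measure (sm v) B \<le> measure (sm v) (space (sm v))"
    by (rule finite_measure.bounded_measure[OF B(2)])
  also have "\<dots> = Re (l2_inner S v v)" using sm(3)[OF assms(2), of 0] B by simp
  finally show ?thesis .
qed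

text \<open>Provides the continuity demanded by the Riesz representation: each indicator form is
  dominated on the diagonal by the total mass, which is the squared norm.\<close>

lemma Bf_bound:
  assumes B: "B \<in> sets borel" and v: "v \<in> l2 S" and w: "w \<in> l2 S"
  shows "(cmod (Bf (indicator B) v w))\<^sup>2 \<le> Re (l2_inner S v v) * Re (l2_inner S w w)"
proof -
  have "(cmod (Bf (indicator B) v w))\<^sup>2 \<le> Re (Bf (indicator B) v v) * Re (Bf (indicator B) w w)"
  proof (rule form_cauchy_schwarz[OF _ _ _ v w])
    show "Bf (indicator B) (\<lambda>x. c * u x + v x) w = c * Bf (indicator B) u w + Bf (indicator B) v w"
      if "u \<in> l2 S" "v \<in> l2 S" "w \<in> l2 S" for u v w c
      using that by (rule Bf_lin_left[OF borel_indicator[OF B]])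
    show "Bf (indicator B) u v = cnj (Bf (indicator B) v u)" if "u \<in> l2 S" "v \<in> l2 S" for u v
      using that by (rule Bf_hermitian[OF borel_indicator[OF B]])
    show "0 \<le> Re (Bf (indicator B) u u)" if "u \<in> l2 S" for u
      using Bf_indicator_diag[OF B that] by simp
  qed
  also have "\<dots> \<le> Re (l2_inner S v v) * Re (l2_inner S w w)"
    using sm_measure_le[OF B v] sm_measure_le[OF B w] Bf_indicator_diag[OF B v] Bf_indicator_diag[OF B w]
    by (auto intro!: mult_mono l2_inner_self_nonneg v)
  finally show ?thesis .
qed

section \<open>Construction of the spectral projections\<close>

definition E :: "real set \<Rightarrow> ('s \<Rightarrow> complex) \<Rightarrow> 's \<Rightarrow> complex" where
  "E B v = (\<lambda>x. if x \<in> S then Bf (indicator B) v (delta x) else 0)"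

lemma E:
  assumes B: "B \<in> sets borel" and v: "v \<in> l2 S"
  shows E_l2: "E B v \<in> l2 S" and E_inner: "w \<in> l2 S \<Longrightarrow> l2_inner S (E B v) w = Bf (indicator B) v w"
  unfolding E_def
  by (rule l2_riesz[OF Bf_lin_right[OF borel_indicator[OF B] _ _ v] Bf_bound[OF B v]]; assumption)+

text \<open>Multiplicativity by applying moment uniqueness twice: the measure of
  \<open>(v, T^n w)\<close> has density t^n, and from this the moments of \<open>(E C v, w)\<close>
  are those of the measure of \<open>(v, w)\<close> restricted to \<open>C\<close>.\<close>

lemma E_projection_aux:
  assumes B: "B \<in> sets borel" and C: "C \<in> sets borel" and v: "v \<in> l2 S" and w: "w \<in> l2 S"
  shows "Bf (indicator B) (E C v) w = Bf (indicator (B \<inter> C)) v w"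
proof -
  have 1: "Bf (indicator C) v ((T ^^ n) w) = Bf (\<lambda>t. indicator C t * t ^ n) v w" for n
  proof (rule polar_integral_eqI[OF sm(1), where S=S and C="K ^ n" and D=1])
    have "Bf (\<lambda>t. t ^ m) v ((T ^^ n) w) = Bf (\<lambda>t. t ^ m * t ^ n) v w" for m
      using v w Bf_power[of v w "m + n"]
      by (simp add: Bf_power Tpow_sym power_add[symmetric]) (simp add: Tpow_sym[symmetric] funpow_add)
    then show "(\<forall>m. Bf (\<lambda>t. t ^ m) v ((T ^^ n) w) = Bf (\<lambda>t. t ^ m * t ^ n) v w) \<or>
      (\<forall>B\<in>sets borel. Bf (indicator B) v ((T ^^ n) w) = Bf (\<lambda>t. indicator B t * t ^ n) v w)"
      by blast
  qed (use v w C in \<open>auto intro: power_bound_on\<close>)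
  have "Bf (indicator B) (E C v) w = Bf (\<lambda>t. indicator B t * indicator C t) v w"
  proof (rule polar_integral_eqI[OF sm(1), where S=S and C=1 and D=1])
    have "Bf (\<lambda>t. t ^ n) (E C v) w = Bf (\<lambda>t. t ^ n * indicator C t) v w" for n
      using v w C 1[of n] by (simp add: Bf_power E_l2 Tpow_sym E_inner mult.commute)
    then show "(\<forall>n. Bf (\<lambda>t. t ^ n) (E C v) w = Bf (\<lambda>t. t ^ n * indicator C t) v w) \<or>
      (\<forall>B\<in>sets borel. Bf (indicator B) (E C v) w = Bf (\<lambda>t. indicator B t * indicator C t) v w)"
      by blast
  qed (use v w B C E_l2 in \<open>auto simp: indicator_def\<close>)
  moreover have "(indicator (B \<inter> C) :: real \<Rightarrow> real) = (\<lambda>t. indicator B t * indicator C t)"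
    by (auto simp: indicator_def)
  ultimately show ?thesis by simp
qed

lemma E_mult:
  assumes "B \<in> sets borel" "C \<in> sets borel" "v \<in> l2 S"
  shows "E (B \<inter> C) v = E B (E C v)"
  by (rule l2_eqI[of _ S]) (use assms in \<open>auto simp: E_l2 E_inner E_projection_aux\<close>)

lemma E_self_adjoint:
  assumes B: "B \<in> sets borel"
  shows "self_adjoint_on S (E B)"
  unfolding self_adjoint_on_def l2_linear_def
proof (intro conjI ballI allI)
  fix v w c assume v: "v \<in> l2 S" and w: "w \<in> l2 S"
  show "E B v \<in> l2 S" by (rule E_l2[OF B v])
  show "E B (\<lambda>x. c * v x + w x) = (\<lambda>x. c * E B v x + E B w x)"
    by (rule l2_eqI[of _ S])
      (use v w B in \<open>auto simp: E_l2 E_inner l2_lincomb l2_inner_lincomb_left Bf_lin_left[OF borel_indicator]\<close>)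
  have "l2_inner S v (E B w) = cnj (Bf (indicator B) w v)"
    using E_inner[OF B w v] l2_inner_cnj by metis
  then show "l2_inner S (E B v) w = l2_inner S v (E B w)"
    using Bf_hermitian[OF borel_indicator[OF B] v w] by (simp add: E_inner[OF B v w])
qed

lemma E_spectral: "is_spectral_measure S T E"
proof -
  have pvm: "projection_valued_measure S E"
    unfolding projection_valued_measure_def orth_projection_on_def
  proof (intro conjI ballI allI impI)
    fix B assume B: "B \<in> sets (borel :: real measure)"
    show "self_adjoint_on S (E B)" by (rule E_self_adjoint[OF B])
    show "E B (E B v) = E B v" if "v \<in> l2 S" for v
      using E_mult[OF B B that] by simp
    show "E (B \<inter> C) v = E B (E C v)" if "C \<in> sets borel" "v \<in> l2 S" for C v
      by (rule E_mult[OF B that])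
  next
    fix v assume v: "v \<in> l2 S"
    \<comment> \<open>The total projection is the zeroth moment, hence the identity.\<close>
    have "indicator UNIV = (\<lambda>t::real. t ^ 0 :: real)" by auto
    then have "Bf (indicator UNIV) v w = l2_inner S v w" if "w \<in> l2 S" for w
      using Bf_power[OF v that, of 0] by (simp only: funpow.simps id_apply)
    then show "E UNIV v = v"
      by (intro l2_eqI[of _ S]) (use v in \<open>auto simp: E_l2 E_inner\<close>)
  next
    fix B :: "nat \<Rightarrow> real set" and v w
    assume B: "range B \<subseteq> sets borel" "disjoint_family B" and v: "v \<in> l2 S" and w: "w \<in> l2 S"
    have Bn: "B n \<in> sets borel" "\<Union> (range B) \<in> sets borel" for n using B by auto
    have m: "(\<lambda>n. complex_of_real (\<integral>t. indicator (B n) t \<partial>sm u)) sums of_real (\<integral>t. indicator (\<Union> (range B)) t \<partial>sm u)"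
      if "u \<in> l2 S" for u
    proof -
      note D = bounded_measureD[OF sm(1)[OF that]]
      have "(\<lambda>n. measure (sm u) (B n)) sums measure (sm u) (\<Union> (range B))"
        using B D by (intro finite_measure.finite_measure_UNION[OF D(2)]) auto
      then show ?thesis using D(4) by (intro sums_of_real) simp
    qed
    have eq: "Bf (indicator C) v w =
        (\<Sum>k<4. of_real (\<integral>t. indicator C t \<partial>sm (\<lambda>x. v x + \<i> ^ k * w x)) * (\<i> ^ k / 4))"
      if "C \<in> sets borel" for C
      by (rule polar_integral_eq[OF sm(1) v w borel_indicator[OF that]])
    \<comment> \<open>Countable additivity is inherited from the four positive measures in the
      polarization sum.\<close>
    have "(\<lambda>n. Bf (indicator (B n)) v w) sums Bf (indicator (\<Union> (range B))) v w"
      unfolding eq[OF Bn(1)] eq[OF Bn(2)]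
      by (intro sums_sum sums_mult2 m l2_add l2_scale v w)
    then show "(\<lambda>n. l2_inner S (E (B n) v) w) sums l2_inner S (E (\<Union>n. B n) v) w"
      using Bn v w by (simp add: E_inner)
  qed
  have supp: "E {-K..K} v = v" if v: "v \<in> l2 S" for v
  proof (rule l2_eqI[of _ S])
    fix w assume w: "w \<in> l2 S"
    have "(\<integral>t. indicator {-K..K} t \<partial>sm u) = Re (l2_inner S u u)" if u: "u \<in> l2 S" for u
    proof -
      note D = bounded_measureD[OF sm(1)[OF u]]
      have "(\<integral>t. indicator {-K..K} t \<partial>sm u) = (\<integral>t. t ^ 0 \<partial>sm u)"
      proof (rule integral_cong_AE)
        show "AE t in sm u. indicator {-K..K} t = t ^ 0"
          using D(3) by eventually_elim (auto simp: indicator_def)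
      qed (use D(1) in \<open>auto cong: measurable_cong_sets\<close>)
      then show ?thesis using sm(3)[OF u, of 0] by simp
    qed
    then have "Bf (indicator {-K..K}) v w = l2_inner S v w"
      using Tpow_self_adjoint[of 0]
      by (intro polar_integral_operator[OF sm(1) v w borel_indicator, where A="\<lambda>u. u"]) (auto simp: id_def)
    then show "l2_inner S (E {-K..K} v) w = l2_inner S v w" using v w by (simp add: E_inner)
  qed (use v E_l2 in auto)
  \<comment> \<open>The scalar measures of the constructed projections are the measures from which
    they were built, so the first moment gives back \<open>T\<close>.\<close>
  have scal: "scalar_spectral_measure S E v = sm v" if v: "v \<in> l2 S" for v
  proof -
    note D = bounded_measureD[OF sm(1)[OF v]]
    have "scalar_spectral_measure S E v = measure_of UNIV (sets borel) (emeasure (sm v))"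
      unfolding scalar_spectral_measure_def
    proof (rule measure_of_eq)
      fix B assume "B \<in> sigma_sets UNIV (sets (borel :: real measure))"
      then have B: "B \<in> sets borel" using sets.sigma_sets_eq[of "borel :: real measure"] by simp
      show "ennreal (Re (l2_inner S (E B v) v)) = emeasure (sm v) B"
        using D(2) by (simp add: E_inner[OF B v v] Bf_indicator_diag[OF B v] finite_measure.emeasure_eq_measure)
    qed simp
    also have "\<dots> = sm v" using measure_of_of_measure[of "sm v"] D by simp
    finally show ?thesis .
  qed
  have "l2_inner S (T v) v = of_real (\<integral>t. t \<partial>scalar_spectral_measure S E v)" if v: "v \<in> l2 S" for v
  proof -
    have "cnj (l2_inner S (T v) v) = l2_inner S (T v) v"
      using T_sym[OF v v] by (simp add: l2_inner_cnj)
    then have "of_real (Re (l2_inner S (T v) v)) = l2_inner S (T v) v"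
      by (metis Reals_cnj_iff of_real_Re)
    then show ?thesis using sm(3)[OF v, of 1] scal[OF v] by simp
  qed
  then show ?thesis unfolding is_spectral_measure_def using pvm supp by blast
qed

text \<open>For an arbitrary spectral measure \<open>F\<close>: the (polarized) measures of \<open>(T v, w)\<close> have density
  \<open>t\<close> with respect to those of \<open>(v, w)\<close>; so the moments of \<open>F\<close> are those of \<open>T\<close>.\<close>

lemma spectral_measure_unique:
  assumes F: "is_spectral_measure S T F" and v: "v \<in> l2 S" and B: "B \<in> sets borel"
  shows "Re (l2_inner S (F B v) v) = measure (sm v) B"
proof -
  have proj: "self_adjoint_on S (F B)" "\<And>v. v \<in> l2 S \<Longrightarrow> F B (F B v) = F B v" if "B \<in> sets borel" for B
    using F that by (auto simp: is_spectral_measure_def projection_valued_measure_def orth_projection_on_def)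
  have Fl2: "F B v \<in> l2 S" if "B \<in> sets borel" "v \<in> l2 S" for B v
    using proj(1)[OF that(1)] that(2) by (auto simp: self_adjoint_on_def l2_linear_def)
  have Fsym: "l2_inner S (F B v) w = l2_inner S v (F B w)" if "B \<in> sets borel" "v \<in> l2 S" "w \<in> l2 S" for B v w
    using proj(1)[OF that(1)] that by (auto simp: self_adjoint_on_def)
  have Funiv: "F UNIV v = v" if "v \<in> l2 S" for v
    using F that by (auto simp: is_spectral_measure_def projection_valued_measure_def)
  have Fint: "F (B \<inter> C) v = F B (F C v)" if "B \<in> sets borel" "C \<in> sets borel" "v \<in> l2 S" for B C v
    using F that by (auto simp: is_spectral_measure_def projection_valued_measure_def)
  have Fsums: "(\<lambda>n::nat. l2_inner S (F (B n) v) w) sums l2_inner S (F (\<Union>n. B n) v) w"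
    if "range B \<subseteq> sets borel" "disjoint_family B" "v \<in> l2 S" "w \<in> l2 S" for B v w
    using F that unfolding is_spectral_measure_def projection_valued_measure_def by blast
  \<comment> \<open>The support bound of \<open>F\<close> is unrelated to \<open>K\<close>; moment
    uniqueness allows different intervals.\<close>
  obtain K' where K': "\<And>v. v \<in> l2 S \<Longrightarrow> F {-K'..K'} v = v"
    using F by (auto simp: is_spectral_measure_def)
  have TF: "l2_inner S (T v) v = of_real (\<integral>t. t \<partial>scalar_spectral_measure S F v)" if "v \<in> l2 S" for v
    using F that by (auto simp: is_spectral_measure_def)
  define m where "m = scalar_spectral_measure S F"
  have Fpos: "0 \<le> Re (l2_inner S (F B v) v)" if "B \<in> sets borel" "v \<in> l2 S" for B v
    using Fsym[OF that(1) Fl2[OF that] that(2)] proj(2)[OF that] l2_inner_self_nonneg[OF Fl2[OF that]] by simp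
  have Fempty: "F {} v = (\<lambda>x. 0)" if v: "v \<in> l2 S" for v
  proof (rule l2_eqI[of _ S])
    fix w assume w: "w \<in> l2 S"
    have "(\<lambda>n::nat. l2_inner S (F {} v) w) sums l2_inner S (F {} v) w"
      using Fsums[of "\<lambda>_. {}" v w] v w by (simp add: disjoint_family_on_def)
    \<comment> \<open>A constant series converges only if its term is zero.\<close>
    then have "l2_inner S (F {} v) w = 0"
      using summable_LIMSEQ_zero sums_summable by (metis LIMSEQ_const_iff)
    then show "l2_inner S (F {} v) w = l2_inner S (\<lambda>x. 0) w" by simp
  qed (use v Fl2 in auto)
  have em: "emeasure (m v) B = ennreal (Re (l2_inner S (F B v) v))" if v: "v \<in> l2 S" and B: "B \<in> sets borel" for v B
    unfolding m_def scalar_spectral_measure_def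
  proof (rule emeasure_measure_of_sigma)
    show "sigma_algebra UNIV (sets (borel :: real measure))"
      using sets.sigma_algebra_axioms[of "borel :: real measure"] by simp
    show "positive (sets borel) (\<lambda>B. ennreal (Re (l2_inner S (F B v) v)))"
      using Fempty[OF v] by (simp add: positive_def)
    show "countably_additive (sets borel) (\<lambda>B. ennreal (Re (l2_inner S (F B v) v)))"
      unfolding countably_additive_def
    proof (intro allI impI)
      fix B :: "nat \<Rightarrow> real set"
      assume B: "range B \<subseteq> sets borel" "disjoint_family B"
      have "(\<lambda>n. Re (l2_inner S (F (B n) v) v)) sums Re (l2_inner S (F (\<Union>n. B n) v) v)"
        using Fsums[OF B v v] by (rule sums_Re)
      then show "(\<Sum>n. ennreal (Re (l2_inner S (F (B n) v) v))) = ennreal (Re (l2_inner S (F (\<Union> (range B)) v) v))"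
        using B Fpos v by (intro suminf_ennreal_eq) auto
    qed
    show "B \<in> sets borel" by (rule B)
  qed
  have sets_m: "sets (m v) = sets borel" for v
    unfolding m_def scalar_spectral_measure_def
    by (subst sets_measure_of) (auto simp: sets.sigma_sets_eq[of "borel :: real measure", simplified])
  have m: "bounded_measure K' (m v)" if v: "v \<in> l2 S" for v
  proof -
    have sp: "space (m v) = UNIV" using sets_eq_imp_space_eq[OF sets_m[of v]] by simp
    have "emeasure (m v) (space (m v)) \<noteq> \<infinity>" using em[OF v, of UNIV] sp by simp
    moreover have "AE t in m v. \<bar>t\<bar> \<le> K'"
    proof (rule AE_I[of _ _ "UNIV - {-K'..K'}"])
      have "F (UNIV - {-K'..K'}) v = F ((UNIV - {-K'..K'}) \<inter> {-K'..K'}) v"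
        using K'[OF v] v by (subst Fint) auto
      also have "(UNIV - {-K'..K'}) \<inter> {-K'..K'} = {}" by blast
      finally show "emeasure (m v) (UNIV - {-K'..K'}) = 0" using Fempty[OF v] v by (simp add: em)
    qed (use sets_m in auto)
    ultimately show ?thesis by (simp add: bounded_measure_def sets_m finite_measureI)
  qed
  have mind: "(\<integral>t. indicator B t \<partial>m v) = Re (l2_inner S (F B v) v)" if "B \<in> sets borel" "v \<in> l2 S" for B v
    using em[OF that(2,1)] bounded_measureD(4)[OF m[OF that(2)]] Fpos[OF that] by (simp add: measure_def)
  have Pind: "polar_integral m (indicator B) v w = l2_inner S (F B v) w"
    if "B \<in> sets borel" "v \<in> l2 S" "w \<in> l2 S" for B v w
    by (rule polar_integral_operator[OF m that(2,3) borel_indicator[OF that(1)] proj(1)[OF that(1)]]) (use that mind in auto)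
  have PT: "polar_integral m (\<lambda>t. t) v w = l2_inner S (T v) w" if "v \<in> l2 S" "w \<in> l2 S" for v w
    by (rule polar_integral_operator[OF m that, where D=K'])
      (use TF Tpow_self_adjoint[of 1] in \<open>auto simp: m_def\<close>)
  \<comment> \<open>On indicators this is \<open>(F C v, F B w) = (F (C \<inter> B) v, w)\<close>;
    the relation lemma extends it to the function \<open>t\<close>.\<close>
  have PB: "polar_integral m (\<lambda>t. t) v (F B w) = polar_integral m (\<lambda>t. t * indicator B t) v w"
    if B: "B \<in> sets borel" and vw: "v \<in> l2 S" "w \<in> l2 S" for B v w
  proof (rule polar_integral_eqI[OF m, where S=S and C=1 and D=K'])
    have "polar_integral m (indicator C) v (F B w) = polar_integral m (\<lambda>t. indicator C t * indicator B t) v w"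
      if C: "C \<in> sets borel" for C
    proof -
      have "polar_integral m (indicator C) v (F B w) = l2_inner S (F B (F C v)) w"
        using B C vw by (simp add: Pind Fl2 Fsym)
      also have "\<dots> = polar_integral m (indicator (C \<inter> B)) v w"
        using B C vw by (simp add: Pind Fint[symmetric] Int_commute)
      also have "(indicator (C \<inter> B) :: real \<Rightarrow> real) = (\<lambda>t. indicator C t * indicator B t)"
        by (auto simp: indicator_def)
      finally show ?thesis .
    qed
    then show "(\<forall>n. polar_integral m (\<lambda>t. t ^ n) v (F B w) = polar_integral m (\<lambda>t. t ^ n * indicator B t) v w) \<or>
      (\<forall>C\<in>sets borel. polar_integral m (indicator C) v (F B w) = polar_integral m (\<lambda>t. indicator C t * indicator B t) v w)"
      by blast
  qed (use B vw Fl2 in \<open>auto simp: indicator_def\<close>)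
  \<comment> \<open>By symmetry of the projections, \<open>(F B (T v), w) = (T v, F B w)\<close>, so
    the previous step identifies the density as \<open>t\<close>. Induction on \<open>n\<close> then
    yields all polarized moments.\<close>
  have PTv: "polar_integral m (\<lambda>t. t ^ n) (T v) w = polar_integral m (\<lambda>t. t ^ n * t) v w"
    if vw: "v \<in> l2 S" "w \<in> l2 S" for v w n
  proof (rule polar_integral_eqI[OF m, where S=S and C=K' and D="K' ^ n"])
    have "polar_integral m (indicator B) (T v) w = polar_integral m (\<lambda>t. indicator B t * t) v w"
      if B: "B \<in> sets borel" for B
      using PB[OF B vw] B vw by (simp add: Pind PT Fl2 Fsym mult.commute)
    then show "(\<forall>k. polar_integral m (\<lambda>t. t ^ k) (T v) w = polar_integral m (\<lambda>t. t ^ k * t) v w) \<or>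
      (\<forall>B\<in>sets borel. polar_integral m (indicator B) (T v) w = polar_integral m (\<lambda>t. indicator B t * t) v w)"
      by blast
  qed (use vw in \<open>auto intro: power_bound_on\<close>)
  have Ppow: "polar_integral m (\<lambda>t. t ^ n) v w = l2_inner S ((T ^^ n) v) w" if "v \<in> l2 S" "w \<in> l2 S" for v w n
    using that
  proof (induction n arbitrary: v)
    case 0
    have "indicator UNIV = (\<lambda>t::real. t ^ 0 :: real)" by auto
    then show ?case using Pind[of UNIV v w] Funiv 0 by simp
  next
    case (Suc n)
    then show ?case using PTv[of v w n] by (simp add: mult.commute funpow_swap1)
  qed
  have mom: "(\<integral>t. t ^ n \<partial>m v) = Re (l2_inner S ((T ^^ n) v) v)" for n
  proof -
    \<comment> \<open>Homogeneity is what recovers the moments of \<open>m v\<close> itself from the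
      polarized moments at \<open>(v, v)\<close>.\<close>
    have scale: "(\<integral>t. t ^ n \<partial>m (\<lambda>x. c * v x)) = (cmod c)\<^sup>2 * (\<integral>t. t ^ n \<partial>m v)" for c
    proof -
      have cv: "(\<lambda>x. c * v x) \<in> l2 S" using v by (rule l2_scale)
      have "m (\<lambda>x. c * v x) = density (m v) (\<lambda>_. ennreal ((cmod c)\<^sup>2))"
      proof (rule measure_eqI)
        fix B assume "B \<in> sets (m (\<lambda>x. c * v x))"
        then have B: "B \<in> sets borel" using sets_m by blast
        have "F B (\<lambda>x. c * v x) = (\<lambda>x. c * F B v x)"
        proof -
          have "F B (\<lambda>x. (c - 1) * v x + v x) = (\<lambda>x. (c - 1) * F B v x + F B v x)"
            using proj(1)[OF B] v by (auto simp: self_adjoint_on_def l2_linear_def)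
          then show ?thesis by (simp add: algebra_simps)
        qed
        then have "l2_inner S (F B (\<lambda>x. c * v x)) (\<lambda>x. c * v x) = of_real ((cmod c)\<^sup>2) * l2_inner S (F B v) v"
          using v Fl2[OF B v] by (simp add: l2_inner_scale l2_scale complex_norm_square[unfolded of_real_power])
        then show "emeasure (m (\<lambda>x. c * v x)) B = emeasure (density (m v) (\<lambda>_. ennreal ((cmod c)\<^sup>2))) B"
          using B sets_m Fpos[OF B v] by (simp add: em[OF cv B] em[OF v B] emeasure_density_const ennreal_mult)
      qed (simp add: sets_m)
      then show ?thesis
        using sets_m by (simp add: integral_density cong: measurable_cong_sets)
    qed
    have "4 * polar_integral m (\<lambda>t. t ^ n) v v = 4 * of_real (\<integral>t. t ^ n \<partial>m v)"
    proof -
      have s: "(\<integral>t. t ^ n \<partial>m (\<lambda>x. v x + v x)) = 4 * (\<integral>t. t ^ n \<partial>m v)"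
        "(\<integral>t. t ^ n \<partial>m (\<lambda>x. v x - v x)) = 0"
        "(\<integral>t. t ^ n \<partial>m (\<lambda>x. v x + \<i> * v x)) = 2 * (\<integral>t. t ^ n \<partial>m v)"
        "(\<integral>t. t ^ n \<partial>m (\<lambda>x. v x - \<i> * v x)) = 2 * (\<integral>t. t ^ n \<partial>m v)"
        subgoal using scale[of 2] by (simp only: mult_2) simp
        subgoal using scale[of 0] by simp
        subgoal using scale[of "1 + \<i>"] by (simp add: distrib_right cmod_sq)
        subgoal using scale[of "1 - \<i>"] by (simp add: left_diff_distrib cmod_sq)
        done
      have "4 * polar_integral m (\<lambda>t. t ^ n) v v
        = of_real (\<integral>t. t ^ n \<partial>m (\<lambda>x. v x + v x)) - of_real (\<integral>t. t ^ n \<partial>m (\<lambda>x. v x - v x))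
        + \<i> * of_real (\<integral>t. t ^ n \<partial>m (\<lambda>x. v x + \<i> * v x)) - \<i> * of_real (\<integral>t. t ^ n \<partial>m (\<lambda>x. v x - \<i> * v x))"
        by (subst polar_integral_eq[OF m v v _ power_bound_on])
          (simp_all add: numeral_eq_Suc sum.lessThan_Suc algebra_simps)
      then show ?thesis unfolding s by simp
    qed
    then have "complex_of_real (\<integral>t. t ^ n \<partial>m v) = l2_inner S ((T ^^ n) v) v"
      using Ppow[OF v v] by simp
    then show ?thesis by (metis Re_complex_of_real)
  qed
  have "m v = sm v"
    by (rule bounded_measure_unique[OF m[OF v] sm(1)[OF v]]) (simp add: mom sm(3)[OF v])
  then show ?thesis using em[OF v B] Fpos[OF B v] by (simp add: measure_def)
qed

end

section \<open>Logarithmic integrals under convergence of moments\<close>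

definition ln_nonneg :: "real measure \<Rightarrow> bool" where
  "ln_nonneg \<mu> \<longleftrightarrow> set_integrable \<mu> {0<..} ln \<and> 0 \<le> (LINT t:{0<..}|\<mu>. ln t)"

text \<open>Polynomial approximation is uniform on the common interval, and the zeroth moment keeps
  the masses bounded along the sequence.\<close>

lemma moments_tendsto_continuous:
  fixes f :: "real \<Rightarrow> real"
  assumes \<nu>: "\<And>k::nat. bounded_measure K (\<nu> k)" and \<mu>: "bounded_measure K \<mu>"
    and conv: "\<And>n. (\<lambda>k. \<integral>t. t ^ n \<partial>\<nu> k) \<longlonglongrightarrow> (\<integral>t. t ^ n \<partial>\<mu>)"
    and f: "continuous_on UNIV f"
  shows "(\<lambda>k. \<integral>t. f t \<partial>\<nu> k) \<longlonglongrightarrow> (\<integral>t. f t \<partial>\<mu>)"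
proof (rule tendstoI)
  fix r :: real assume r: "0 < r"
  let ?M = "measure \<mu> UNIV"
  \<comment> \<open>Chosen so that \<open>e * (M + 1) = r / 2\<close>: the errors are below r/2 for
    \<nu>, equal to r/2 - e for \<mu>, and below e for the polynomial, together less than r.\<close>
  define e where "e = r / 2 / (?M + 1)"
  have M0: "0 \<le> ?M" by simp
  then have nz: "?M + 1 \<noteq> 0" by linarith
  have e: "0 < e" using r by (simp add: e_def add_nonneg_pos)
  obtain p where p: "real_polynomial_function p" "\<And>x. x \<in> {-K..K} \<Longrightarrow> \<bar>f x - p x\<bar> < e"
    using Stone_Weierstrass_real_polynomial_function[OF _ continuous_on_subset[OF f subset_UNIV] e, of "{-K..K}"] by auto
  obtain a n where pe: "p = (\<lambda>x. \<Sum>i\<le>n. a i * x ^ i)"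
    using p(1) by (auto simp: real_polynomial_function_iff_sum)
  have pc: "continuous_on UNIV p" unfolding pe by (intro continuous_intros)
  have int: "integrable \<rho> g" if "bounded_measure K \<rho>" "continuous_on UNIV g" for \<rho> and g :: "real \<Rightarrow> real"
    using that by (intro bounded_measure_integrable_continuous[OF that(1)])
      (auto intro: borel_measurable_continuous_onI continuous_on_subset)
  have approx: "\<bar>(\<integral>t. f t \<partial>\<rho>) - (\<integral>t. p t \<partial>\<rho>)\<bar> \<le> e * measure \<rho> UNIV" if \<rho>: "bounded_measure K \<rho>" for \<rho>
  proof -
    note B = bounded_measureD[OF \<rho>]
    have fp: "integrable \<rho> (\<lambda>t. f t - p t)" using int[OF \<rho>] f pc by auto
    have "(\<integral>t. f t \<partial>\<rho>) - (\<integral>t. p t \<partial>\<rho>) = (\<integral>t. f t - p t \<partial>\<rho>)"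
      using int[OF \<rho> f] int[OF \<rho> pc] by simp
    also have "\<bar>\<dots>\<bar> \<le> (\<integral>t. \<bar>f t - p t\<bar> \<partial>\<rho>)" by (rule integral_abs_bound)
    also have "\<dots> \<le> (\<integral>t. e \<partial>\<rho>)"
    proof (rule integral_mono_AE)
      show "AE t in \<rho>. \<bar>f t - p t\<bar> \<le> e"
        using B(3)
      proof eventually_elim
        case (elim t)
        then have "t \<in> {-K..K}" by auto
        from p(2)[OF this] show ?case by simp
      qed
      show "integrable \<rho> (\<lambda>t. e)" using B by (intro integrable_bounded) auto
    qed (use fp in auto)
    also have "\<dots> = e * measure \<rho> UNIV" using B by simp
    finally show ?thesis .
  qed
  have pint: "(\<integral>t. p t \<partial>\<rho>) = (\<Sum>i\<le>n. a i * (\<integral>t. t ^ i \<partial>\<rho>))" if "bounded_measure K \<rho>" for \<rho>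
    unfolding pe using that by (subst Bochner_Integration.integral_sum) auto
  have "(\<lambda>k. \<integral>t. p t \<partial>\<nu> k) \<longlonglongrightarrow> (\<integral>t. p t \<partial>\<mu>)"
    unfolding pint[OF \<nu>] pint[OF \<mu>] by (intro tendsto_intros conv)
  then have e1: "\<forall>\<^sub>F k in sequentially. \<bar>(\<integral>t. p t \<partial>\<nu> k) - (\<integral>t. p t \<partial>\<mu>)\<bar> < e"
    using e by (auto simp: tendsto_iff dist_real_def)
  have "(\<lambda>k. measure (\<nu> k) UNIV) \<longlonglongrightarrow> ?M"
    using conv[of 0] bounded_measureD[OF \<nu>] bounded_measureD[OF \<mu>] by simp
  then have e2: "\<forall>\<^sub>F k in sequentially. measure (\<nu> k) UNIV < ?M + 1"
    by (rule order_tendstoD) simp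
  show "\<forall>\<^sub>F k in sequentially. dist (\<integral>t. f t \<partial>\<nu> k) (\<integral>t. f t \<partial>\<mu>) < r"
    using e1 e2
  proof eventually_elim
    case (elim k)
    have "e * measure (\<nu> k) UNIV < e * (?M + 1)" using elim e by simp
    moreover have re: "e * (?M + 1) = r / 2" using nz by (metis e_def nonzero_divide_eq_eq)
    ultimately have 1: "e * measure (\<nu> k) UNIV < r / 2" by metis
    have 2: "e * ?M = r / 2 - e" using re unfolding distrib_left mult_1_right by linarith
    have "\<bar>(\<integral>t. f t \<partial>\<nu> k) - (\<integral>t. f t \<partial>\<mu>)\<bar> < r"
      using approx[OF \<nu>[of k]] approx[OF \<mu>] elim(1) 1 2 by linarith
    then show ?case by (simp only: dist_real_def)
  qed
qed

lemma ln_nonneg_limit: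
  assumes \<nu>: "\<And>k::nat. bounded_measure K (\<nu> k)" "\<And>k. AE t in \<nu> k. 0 \<le> t" "\<And>k. ln_nonneg (\<nu> k)"
    and \<mu>: "bounded_measure K \<mu>" "AE t in \<mu>. 0 \<le> t"
    and conv: "\<And>n. (\<lambda>k. \<integral>t. t ^ n \<partial>\<nu> k) \<longlonglongrightarrow> (\<integral>t. t ^ n \<partial>\<mu>)"
  shows "ln_nonneg \<mu>"
proof -
  define f where "f e t = ln (max t e)" for e t :: real
  have int: "integrable \<rho> g" if "bounded_measure K \<rho>" "continuous_on UNIV g" for \<rho> and g :: "real \<Rightarrow> real"
    using that by (intro bounded_measure_integrable_continuous[OF that(1)])
      (auto intro: borel_measurable_continuous_onI continuous_on_subset)
  have fc: "continuous_on UNIV (f e)" if "0 < e" for e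
    unfolding f_def using that by (intro continuous_intros) auto
  have ind0: "integrable \<rho> (\<lambda>t. indicator {0} t * c)" "(\<integral>t. indicator {0} t * c \<partial>\<rho>) = measure \<rho> {0} * c"
    if "bounded_measure K \<rho>" for \<rho> and c :: real
  proof -
    note B = bounded_measureD[OF that]
    show "integrable \<rho> (\<lambda>t. indicator {0} t * c)"
      by (rule integrable_bounded[OF B(1,2), where C="\<bar>c\<bar>"]) (auto simp: indicator_def)
    show "(\<integral>t. indicator {0} t * c \<partial>\<rho>) = measure \<rho> {0} * c"
      using B by (subst integral_mult_left_zero) simp
  qed
  \<comment> \<open>Pointwise, \<open>f e\<close> is at least \<open>ln t\<close> for t > 0 and
    equals \<open>ln e\<close> at 0.\<close>
  have lower: "ln e * measure (\<nu> k) {0} \<le> (\<integral>t. f e t \<partial>\<nu> k)" if e: "0 < e" for e k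
  proof -
    have ln: "integrable (\<nu> k) (\<lambda>t. indicator {0<..} t * ln t)" "0 \<le> (\<integral>t. indicator {0<..} t * ln t \<partial>\<nu> k)"
      using \<nu>(3)[of k] by (auto simp: ln_nonneg_def set_integrable_def set_lebesgue_integral_def)
    have "ln e * measure (\<nu> k) {0} \<le> (\<integral>t. indicator {0<..} t * ln t \<partial>\<nu> k) + (\<integral>t. indicator {0} t * ln e \<partial>\<nu> k)"
      unfolding ind0(2)[OF \<nu>(1)] using ln(2) by (simp add: mult.commute)
    also have "\<dots> = (\<integral>t. indicator {0<..} t * ln t + indicator {0} t * ln e \<partial>\<nu> k)"
      using ln(1) ind0(1)[OF \<nu>(1)] by (intro Bochner_Integration.integral_add[symmetric])
    also have "\<dots> \<le> (\<integral>t. f e t \<partial>\<nu> k)"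
    proof (rule integral_mono_AE)
      show "AE t in \<nu> k. indicator {0<..} t * ln t + indicator {0} t * ln e \<le> f e t"
        using \<nu>(2)[of k]
      proof eventually_elim
        case (elim t)
        then show ?case using e by (cases "t = 0") (auto simp: f_def max_def)
      qed
      show "integrable (\<nu> k) (f e)" using \<nu>(1) fc[OF e] by (rule int)
    qed (intro Bochner_Integration.integrable_add ln ind0 \<nu>)
    finally show ?thesis .
  qed
  \<comment> \<open>Upper semicontinuity of the mass at 0: the atom is dominated by the integral of
    a continuous tent, which converges along the sequence and is close to the limit atom for a
    narrow tent.\<close>
  have atom: "\<forall>\<^sub>F k in sequentially. measure (\<nu> k) {0} \<le> measure \<mu> {0} + \<eta>" if \<eta>: "0 < \<eta>" for \<eta>
  proof -
    let ?g = "\<lambda>j t::real. max 0 (1 - real j * \<bar>t\<bar>)"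
    have gc: "continuous_on UNIV (?g j)" for j by (intro continuous_intros)
    note B = bounded_measureD[OF \<mu>(1)]
    have "(\<lambda>j. \<integral>t. ?g j t \<partial>\<mu>) \<longlonglongrightarrow> (\<integral>t. indicator {0} t \<partial>\<mu>)"
    proof (rule integral_dominated_convergence[where w="\<lambda>_. 1"])
      show "integrable \<mu> (\<lambda>_. 1::real)" using B by (intro integrable_bounded) auto
      show "AE t in \<mu>. (\<lambda>j. ?g j t) \<longlonglongrightarrow> indicator {0} t"
      proof (rule AE_I2)
        fix t :: real
        show "(\<lambda>j. ?g j t) \<longlonglongrightarrow> indicator {0} t"
        proof (cases "t = 0")
          case False
          then obtain n0 where n0: "1 < real n0 * \<bar>t\<bar>" using reals_Archimedean3[of "\<bar>t\<bar>"] by auto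
          have "\<forall>\<^sub>F n in sequentially. ?g n t = 0"
            using eventually_ge_at_top[of n0]
          proof eventually_elim
            case (elim n)
            then have "real n0 * \<bar>t\<bar> \<le> real n * \<bar>t\<bar>" by (intro mult_right_mono) auto
            then show ?case using n0 by auto
          qed
          then show ?thesis using False by (simp add: tendsto_eventually)
        qed simp
      qed
      show "AE t in \<mu>. norm (?g j t) \<le> 1" for j by (rule AE_I2) (auto simp: max_def)
    qed (use B(1) in \<open>auto cong: measurable_cong_sets\<close>)
    then have "(\<lambda>j. \<integral>t. ?g j t \<partial>\<mu>) \<longlonglongrightarrow> measure \<mu> {0}" using B by simp
    then have "\<forall>\<^sub>F j in sequentially. (\<integral>t. ?g j t \<partial>\<mu>) < measure \<mu> {0} + \<eta>"
      by (rule order_tendstoD) (use \<eta> in simp)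
    then obtain j where j: "(\<integral>t. ?g j t \<partial>\<mu>) < measure \<mu> {0} + \<eta>"
      using eventually_happens by fastforce
    have "\<forall>\<^sub>F k in sequentially. (\<integral>t. ?g j t \<partial>\<nu> k) < measure \<mu> {0} + \<eta>"
      by (rule order_tendstoD(2)[OF moments_tendsto_continuous[OF \<nu>(1) \<mu>(1) conv gc] j])
    then show ?thesis
    proof eventually_elim
      case (elim k)
      have "(\<integral>t. indicator {0} t * 1 \<partial>\<nu> k) \<le> (\<integral>t. ?g j t \<partial>\<nu> k)"
        by (rule integral_mono[OF ind0(1)[OF \<nu>(1)] int[OF \<nu>(1) gc]]) (auto simp: indicator_def)
      then show ?case using elim unfolding ind0(2)[OF \<nu>(1)] by simp
    qed
  qed
  have bound: "ln e * measure \<mu> {0} \<le> (\<integral>t. f e t \<partial>\<mu>)" if e: "0 < e" "e < 1" for e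
  proof -
    \<comment> \<open>The sign turns the upper estimate of the atoms into a lower estimate of the
      integrals; this is why \<open>e < 1\<close> is required.\<close>
    have neg: "ln e < 0" using e by simp
    have *: "ln e * (measure \<mu> {0} + \<eta>) \<le> (\<integral>t. f e t \<partial>\<mu>)" if \<eta>: "0 < \<eta>" for \<eta>
    proof (rule tendsto_lowerbound[OF moments_tendsto_continuous[OF \<nu>(1) \<mu>(1) conv fc[OF e(1)]]])
      show "\<forall>\<^sub>F k in sequentially. ln e * (measure \<mu> {0} + \<eta>) \<le> (\<integral>t. f e t \<partial>\<nu> k)"
        using atom[OF \<eta>]
      proof eventually_elim
        case (elim k)
        then have "ln e * (measure \<mu> {0} + \<eta>) \<le> ln e * measure (\<nu> k) {0}"
          using neg by (simp add: mult_le_cancel_left)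
        then show ?case using lower[OF e(1), of k] by linarith
      qed
    qed simp
    have "((\<lambda>\<eta>. ln e * (measure \<mu> {0} + \<eta>)) \<longlongrightarrow> ln e * (measure \<mu> {0} + 0)) (at_right 0)"
      by (intro tendsto_intros)
    moreover have "\<forall>\<^sub>F \<eta> in at_right 0. ln e * (measure \<mu> {0} + \<eta>) \<le> (\<integral>t. f e t \<partial>\<mu>)"
      by (intro eventually_mono[OF eventually_at_right_less]) (rule *)
    ultimately have "ln e * (measure \<mu> {0} + 0) \<le> (\<integral>t. f e t \<partial>\<mu>)"
      by (rule tendsto_upperbound) simp
    then show ?thesis by simp
  qed
  \<comment> \<open>The summand 2 keeps every cutoff, including the one for n = 0, strictly below
    1.\<close>
  define e where "e n = 1 / (real n + 2)" for n :: nat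
  have e: "0 < e n" "e n < 1" for n by (auto simp: e_def)
  have e_dec: "e n \<le> e m" if "m \<le> n" for m n using that by (simp add: e_def frac_le)
  \<comment> \<open>The truncated logarithm with the atom removed. The minus sign makes the sequence
    increase, and since its integrals are at most 0, monotone convergence yields integrability of
    the logarithm along with the sign.\<close>
  define h where "h n t = - (f (e n) t - indicator {0} t * ln (e n))" for n t
  have h_int: "integrable \<mu> (h n)" for n
    unfolding h_def by (intro Bochner_Integration.integrable_minus Bochner_Integration.integrable_diff int[OF \<mu>(1) fc] ind0[OF \<mu>(1)] e)
  have h_le: "(\<integral>t. h n t \<partial>\<mu>) \<le> 0" for n
  proof -
    have "(\<integral>t. h n t \<partial>\<mu>) = - ((\<integral>t. f (e n) t \<partial>\<mu>) - (\<integral>t. indicator {0} t * ln (e n) \<partial>\<mu>))"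
      unfolding h_def using int[OF \<mu>(1) fc[OF e(1)[of n]]] ind0(1)[OF \<mu>(1)]
      by (subst Bochner_Integration.integral_minus, subst Bochner_Integration.integral_diff) auto
    then show ?thesis unfolding ind0(2)[OF \<mu>(1)] using bound[OF e[of n]] by (simp add: mult.commute)
  qed
  have h_t: "h n t = (if t = 0 then 0 else - ln (max t (e n)))" if "0 \<le> t" for n t
    using e[of n] by (auto simp: h_def f_def max_def)
  have h_mono: "AE t in \<mu>. mono (\<lambda>n. h n t)"
    using \<mu>(2)
  proof eventually_elim
    case (elim t)
    have "ln (max t (e n)) \<le> ln (max t (e m))" if "m \<le> n" for m n
      using e[of n] e_dec[OF that] by (intro ln_mono) auto
    then show ?case using elim by (auto simp: mono_def h_t)
  qed
  have h_lim: "AE t in \<mu>. (\<lambda>n. h n t) \<longlonglongrightarrow> - (indicator {0<..} t * ln t)"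
    using \<mu>(2)
  proof eventually_elim
    case (elim t)
    show ?case
    proof (cases "t = 0")
      case True
      then show ?thesis using h_t[OF elim] by simp
    next
      case False
      have "e \<longlonglongrightarrow> 0" unfolding e_def
        by (intro tendsto_divide_0[OF tendsto_const] filterlim_at_top_imp_at_infinity)
          (use filterlim_tendsto_add_at_top[OF tendsto_const[of 2] filterlim_real_sequentially] in \<open>simp add: add.commute\<close>)
      then have "\<forall>\<^sub>F n in sequentially. e n < t"
        using False elim by (intro order_tendstoD(2)) auto
      then have "\<forall>\<^sub>F n in sequentially. h n t = - (indicator {0<..} t * ln t)"
        by eventually_elim (use False elim in \<open>auto simp: h_t max_def\<close>)
      then show ?thesis by (rule tendsto_eventually)
    qed
  qed
  have "(\<lambda>n. \<integral>t. h n t \<partial>\<mu>) \<longlonglongrightarrow> (SUP n. \<integral>t. h n t \<partial>\<mu>)"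
  proof (rule LIMSEQ_incseq_SUP)
    show "bdd_above (range (\<lambda>n. \<integral>t. h n t \<partial>\<mu>))" using h_le by (auto simp: bdd_above_def)
    show "incseq (\<lambda>n. \<integral>t. h n t \<partial>\<mu>)"
      unfolding incseq_def
    proof (intro allI impI integral_mono_AE h_int)
      fix m n :: nat assume "m \<le> n"
      then show "AE t in \<mu>. h m t \<le> h n t" using h_mono by (auto simp: mono_def elim!: eventually_mono)
    qed
  qed
  moreover have "(SUP n. \<integral>t. h n t \<partial>\<mu>) \<le> 0" using h_le by (intro cSUP_least) auto
  ultimately obtain x where x: "(\<lambda>n. \<integral>t. h n t \<partial>\<mu>) \<longlonglongrightarrow> x" "x \<le> 0" by blast
  have meas: "(\<lambda>t. - (indicator {0<..} t * ln t)) \<in> borel_measurable \<mu>"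
    using bounded_measureD(1)[OF \<mu>(1)] by (auto cong: measurable_cong_sets)
  have "has_bochner_integral \<mu> (\<lambda>t. - (indicator {0<..} t * ln t)) x"
    by (rule has_bochner_integral_monotone_convergence[OF h_int h_mono h_lim x(1) meas])
  then have "has_bochner_integral \<mu> (\<lambda>t. indicator {0<..} t * ln t) (- x)"
    using has_bochner_integral_minus by fastforce
  then show ?thesis
    using x(2) by (auto simp: ln_nonneg_def set_integrable_def set_lebesgue_integral_def
        has_bochner_integral_iff)
qed

lemma ln_nonneg_square:
  assumes \<mu>: "bounded_measure K \<mu>" "AE t in \<mu>. 0 \<le> t" and sq: "ln_nonneg (distr \<mu> borel (\<lambda>t. t\<^sup>2))"
  shows "ln_nonneg \<mu>"
proof -
  have [measurable_cong]: "sets \<mu> = sets borel" using bounded_measureD[OF \<mu>(1)] by blast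
  let ?f = "\<lambda>t::real. indicator {0<..} (t\<^sup>2) *\<^sub>R ln (t\<^sup>2)"
  have "integrable \<mu> ?f" "0 \<le> (\<integral>t. ?f t \<partial>\<mu>)"
    using sq by (simp_all add: ln_nonneg_def set_integrable_def set_lebesgue_integral_def
        integrable_distr_eq integral_distr)
  moreover have AE: "AE t in \<mu>. ?f t = 2 * (indicator {0<..} t *\<^sub>R ln t)"
    using \<mu>(2)
  proof eventually_elim
    case (elim t)
    then show ?case by (cases "t = 0") (auto simp: ln_realpow indicator_def)
  qed
  ultimately have "integrable \<mu> (\<lambda>t. 2 * (indicator {0<..} t *\<^sub>R ln t))"
    "0 \<le> (\<integral>t. 2 * (indicator {0<..} t *\<^sub>R ln t) \<partial>\<mu>)"
    using integrable_cong_AE[OF _ _ AE] integral_cong_AE[OF _ _ AE] by simp_all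
  then show ?thesis
    by (simp add: ln_nonneg_def set_integrable_def set_lebesgue_integral_def)
qed

lemma ln_nonneg_scale:
  assumes "sets \<mu> = sets borel" "ln_nonneg \<mu>" "0 < c"
  shows "ln_nonneg (density \<mu> (\<lambda>_. ennreal c))"
proof -
  have [measurable_cong]: "sets \<mu> = sets borel" by fact
  show ?thesis
    using assms by (simp add: ln_nonneg_def set_integrable_def set_lebesgue_integral_def
        integrable_real_density integral_real_density)
qed

section \<open>The spectral measure of a trace\<close>

lemma ln_det_nonneg_iff:
  "0 \<le> ln_det G d T \<longleftrightarrow> ln_nonneg (interval_measure (spectral_density G d T))"
  by (simp add: ln_det_def ln_nonneg_def)

lemma vn_trace_matrix_eq:
  assumes "\<one>\<^bsub>G\<^esub> \<in> carrier G"
  shows "vn_trace_matrix G d P = (\<Sum>i<d. P (delta (i, \<one>\<^bsub>G\<^esub>)) (i, \<one>\<^bsub>G\<^esub>))"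
  unfolding vn_trace_matrix_def
proof (rule sum.cong)
  fix i :: nat
  have e: "(\<lambda>x. if x = \<one>\<^bsub>G\<^esub> then 1 else 0) = delta \<one>\<^bsub>G\<^esub>" by (simp add: delta_def)
  have "(\<lambda>(k, y). if k = i then delta \<one>\<^bsub>G\<^esub> y else 0) = delta (i, \<one>\<^bsub>G\<^esub>)"
    by (auto simp: delta_def)
  then show "vn_trace G (op_entry P i i) = P (delta (i, \<one>\<^bsub>G\<^esub>)) (i, \<one>\<^bsub>G\<^esub>)"
    using assms by (simp add: vn_trace_def Let_def e op_entry_def l2_inner_delta)
qed simp

text \<open>The density function is the distribution function of the measure whose moments are the
  traces of the powers. This identification also supplies the monotonicity, right continuity and
  limits that \<open>interval_measure\<close> requires.\<close>

lemma trace_measure: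
  assumes one: "\<one>\<^bsub>G\<^esub> \<in> carrier G" and T: "positive_operator (l2_sum_index G d) T K"
  defines "e \<equiv> \<lambda>i. delta (i, \<one>\<^bsub>G\<^esub>)"
  defines "\<rho> \<equiv> interval_measure (spectral_density G d T)"
  shows "bounded_measure K \<rho>" "AE t in \<rho>. 0 \<le> t"
    "(\<integral>t. t ^ n \<partial>\<rho>) = (\<Sum>i<d. Re ((T ^^ n) (e i) (i, \<one>\<^bsub>G\<^esub>)))"
proof -
  let ?S = "l2_sum_index G d"
  interpret positive_operator ?S T K by (rule T)
  have S: "(i, \<one>\<^bsub>G\<^esub>) \<in> ?S" if "i < d" for i using that one by (simp add: l2_sum_index_def)
  have e: "e i \<in> l2 ?S" if "i < d" for i unfolding e_def using S[OF that] by simp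
  have e_inner: "l2_inner ?S v (e i) = v (i, \<one>\<^bsub>G\<^esub>)" if "i < d" for v i
    unfolding e_def using S[OF that] by (rule l2_inner_delta)
  obtain \<mu> where \<mu>: "bounded_measure K \<mu>" "AE t in \<mu>. 0 \<le> t"
    "\<And>n. (\<integral>t. t ^ n \<partial>\<mu>) = (\<Sum>i<d. Re (l2_inner ?S ((T ^^ n) (e i)) (e i)))"
    using spectral_moments_exist[of d e] e by blast
  note M = bounded_measureD[OF \<mu>(1)]
  \<comment> \<open>The choice operator has a witness, the constructed \<open>E\<close>; its result
    may be a different spectral measure.\<close>
  have F: "is_spectral_measure ?S T (spectral_projection ?S T)"
    unfolding spectral_projection_def by (rule someI[of _ E]) (rule E_spectral)
  have sum: "measure \<mu> B = (\<Sum>i<d. measure (sm (e i)) B)" if B: "B \<in> sets borel" for B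
  proof -
    \<comment> \<open>The index \<open>d\<close> carries the trace measure with weight -1, so
      additivity becomes a vanishing combination of moments.\<close>
    let ?m = "\<lambda>i. if i < d then sm (e i) else \<mu>" and ?c = "\<lambda>i. if i < d then 1 else - 1 :: complex"
    have m: "bounded_measure K (?m i)" for i using sm(1)[OF e] \<mu>(1) by simp
    have int: "(\<integral>t. f t *\<^sub>R c \<partial>?m i) = of_real (\<integral>t. f t \<partial>?m i) * c" if "integrable (?m i) f" for f :: "real \<Rightarrow> real" and c :: complex and i
      using that by (subst integral_scaleR_left) (auto simp: scaleR_conv_of_real)
    have split: "(\<Sum>i\<le>d. g i) = g d + (\<Sum>i<d. g i)" for g :: "nat \<Rightarrow> complex"
      by (simp add: lessThan_Suc_atMost[symmetric] sum.lessThan_Suc)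
    have "(\<Sum>i\<le>d. \<integral>t. indicator B t *\<^sub>R ?c i \<partial>?m i) = 0"
    proof (rule combination_from_moments[OF _ m, where C=1 and D=1])
      show "(\<Sum>i\<le>d. \<integral>t. t ^ n *\<^sub>R ?c i \<partial>?m i) = 0" for n
        unfolding int[OF bounded_measure_integrable_power[OF m]] split
        using \<mu>(3)[of n] sm(3)[OF e] by simp
    qed (use B in auto)
    moreover have "integrable (?m i) (indicator B :: real \<Rightarrow> real)" for i
      by (rule bounded_measure_integrable[OF m[of i], where C=1]) (use B in \<open>auto simp: indicator_def\<close>)
    moreover have "(\<integral>t. indicator B t \<partial>?m i) = measure (?m i) B" for i
      using bounded_measureD[OF m[of i]] B by simp
    ultimately have "(\<Sum>i\<le>d. of_real (measure (?m i) B) * ?c i) = 0"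
      using int[of _ "indicator B"] by (simp only:)
    then have "complex_of_real (measure \<mu> B) = of_real (\<Sum>i<d. measure (sm (e i)) B)"
      unfolding split by simp
    then show ?thesis using of_real_eq_iff by blast
  qed
  have dens: "spectral_density G d T t = cdf \<mu> t" for t
  proof -
    have "spectral_density G d T t = (\<Sum>i<d. Re (l2_inner ?S (spectral_projection ?S T {0..t} (e i)) (e i)))"
      unfolding spectral_density_def vn_trace_matrix_eq[OF one] Re_sum
      by (rule sum.cong) (simp_all add: e_inner, simp add: e_def)
    also have "\<dots> = (\<Sum>i<d. measure (sm (e i)) {0..t})"
      by (rule sum.cong) (simp_all add: spectral_measure_unique[OF F e])
    also have "\<dots> = measure \<mu> {0..t}" by (simp add: sum)
    \<comment> \<open>The density uses {0..t}; the missing half line has no mass because the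
      operator is positive. This covers negative \<open>t\<close> as well.\<close>
    also have "\<dots> = measure \<mu> {..t}"
    proof (rule finite_measure.finite_measure_eq_AE[OF M(2)])
      show "AE x in \<mu>. x \<in> {0..t} \<longleftrightarrow> x \<in> {..t}" using \<mu>(2) by eventually_elim auto
    qed (use M in auto)
    finally show ?thesis by (simp add: cdf_def)
  qed
  have fb: "finite_borel_measure \<mu>"
    using M by (intro finite_borel_measure.intro finite_borel_measure_axioms.intro) auto
  interpret \<mu>: finite_borel_measure \<mu> by (rule fb)
  have F_eq: "spectral_density G d T = cdf \<mu>" using dens by blast
  have cdf: "cdf \<rho> = cdf \<mu>"
    unfolding \<rho>_def F_eq
    by (rule cdf_interval_measure) (auto intro: \<mu>.cdf_nondecreasing \<mu>.cdf_is_right_cont \<mu>.cdf_lim_at_bot)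
  have "finite_borel_measure \<rho>"
    unfolding \<rho>_def F_eq
    by (rule finite_borel_measure_interval_measure[where m="measure \<mu> (space \<mu>)"])
      (auto intro: \<mu>.cdf_nondecreasing \<mu>.cdf_is_right_cont \<mu>.cdf_lim_at_bot \<mu>.cdf_lim_at_top)
  then have eq: "\<rho> = \<mu>" using fb cdf by (intro cdf_unique')
  show "bounded_measure K \<rho>" "AE t in \<rho>. 0 \<le> t" using eq \<mu> by auto
  show "(\<integral>t. t ^ n \<partial>\<rho>) = (\<Sum>i<d. Re ((T ^^ n) (e i) (i, \<one>\<^bsub>G\<^esub>)))"
    using \<mu>(3)[of n] eq by (simp add: e_inner)
qed

section \<open>Hermitian matrices over the integral group ring\<close>

definition supp :: "('a \<Rightarrow> int) \<Rightarrow> 'a set" where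
  "supp a = {g. a g \<noteq> 0}"

text \<open>Equality with the adjoint matrix for the involution g \<mapsto> g^-1 of the group ring;
  integers need no conjugation.\<close>

definition hermitian_matrix :: "('a, 'm) monoid_scheme \<Rightarrow> nat \<Rightarrow> (nat \<Rightarrow> nat \<Rightarrow> 'a \<Rightarrow> int) \<Rightarrow> bool" where
  "hermitian_matrix G d A \<longleftrightarrow> (\<forall>i<d. \<forall>j<d. A i j \<in> int_group_ring G \<and>
     (\<forall>g\<in>carrier G. A j i (inv\<^bsub>G\<^esub> g) = A i j g))"

text \<open>The l1-norm of a row of coefficients; for a hermitian matrix its maximum bounds the
  operator norm.\<close>

definition row_sum :: "nat \<Rightarrow> (nat \<Rightarrow> nat \<Rightarrow> 'a \<Rightarrow> int) \<Rightarrow> nat \<Rightarrow> real" where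
  "row_sum d A i = (\<Sum>j<d. \<Sum>g\<in>supp (A i j). real_of_int \<bar>A i j g\<bar>)"

lemma int_group_ring_supp:
  "a \<in> int_group_ring G \<Longrightarrow> finite (supp a)" "a \<in> int_group_ring G \<Longrightarrow> supp a \<subseteq> carrier G"
  by (auto simp: int_group_ring_def supp_def)

lemma matrix_op_outside: "p \<notin> l2_sum_index G d \<Longrightarrow> matrix_op G d A v p = 0"
  by (cases p) (auto simp: matrix_op_def l2_sum_index_def left_mult_op_def)

lemma matrix_op_apply:
  assumes "i < d" "x \<in> carrier G" "\<And>j. j < d \<Longrightarrow> finite (supp (A i j))"
  shows "matrix_op G d A v (i, x) =
    (\<Sum>(j, g)\<in>(SIGMA j:{..<d}. supp (A i j)). of_int (A i j g) * v (j, inv\<^bsub>G\<^esub> g \<otimes>\<^bsub>G\<^esub> x))"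
  using assms by (subst sum.Sigma[symmetric]) (auto simp: matrix_op_def left_mult_op_def supp_def)

text \<open>A matrix unit times the left translation by \<open>g\<close>. Every matrix operator is a
  finite integral combination of these, indexed by \<open>entries\<close>.\<close>

definition elem_op :: "('a, 'm) monoid_scheme \<Rightarrow> nat \<Rightarrow> nat \<Rightarrow> 'a \<Rightarrow> (nat \<times> 'a \<Rightarrow> complex) \<Rightarrow> nat \<times> 'a \<Rightarrow> complex" where
  "elem_op G i j g v = (\<lambda>(k, x). if k = i \<and> x \<in> carrier G then v (j, inv\<^bsub>G\<^esub> g \<otimes>\<^bsub>G\<^esub> x) else 0)"

definition entries :: "nat \<Rightarrow> (nat \<Rightarrow> nat \<Rightarrow> 'a \<Rightarrow> int) \<Rightarrow> (nat \<times> nat \<times> 'a) set" where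
  "entries d A = (SIGMA i:{..<d}. SIGMA j:{..<d}. supp (A i j))"

context group
begin

abbreviation "Sd d \<equiv> l2_sum_index G d"

section \<open>Adjoints and norm bounds of matrices over the group ring\<close>

lemma translation_bij: "g \<in> carrier G \<Longrightarrow> bij_betw (\<lambda>x. inv g \<otimes> x) (carrier G) (carrier G)"
  by (rule bij_betw_byWitness[where f'="\<lambda>x. g \<otimes> x"]) (auto simp: m_assoc[symmetric])

lemma elem_op_inner_sum:
  assumes i: "i < d" and j: "j < d" and g: "g \<in> carrier G"
  shows "l2_inner (Sd d) (elem_op G i j g v) w = (\<Sum>\<^sub>\<infinity>x\<in>carrier G. v (j, inv g \<otimes> x) * cnj (w (i, x)))"
proof -
  have "l2_inner (Sd d) (elem_op G i j g v) w
      = (\<Sum>\<^sub>\<infinity>p\<in>Pair i ` carrier G. elem_op G i j g v p * cnj (w p))"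
    unfolding l2_inner_def
    by (rule infsum_cong_neutral) (use i in \<open>auto simp: elem_op_def l2_sum_index_def\<close>)
  also have "\<dots> = (\<Sum>\<^sub>\<infinity>x\<in>carrier G. elem_op G i j g v (i, x) * cnj (w (i, x)))"
    by (subst infsum_reindex) (auto simp: inj_on_def comp_def)
  also have "\<dots> = (\<Sum>\<^sub>\<infinity>x\<in>carrier G. v (j, inv g \<otimes> x) * cnj (w (i, x)))"
    by (rule infsum_cong) (simp add: elem_op_def)
  finally show ?thesis .
qed

lemma elem_op_adjoint:
  assumes i: "i < d" and j: "j < d" and g: "g \<in> carrier G"
  shows "l2_inner (Sd d) (elem_op G i j g v) w = l2_inner (Sd d) v (elem_op G j i (inv g) w)"
proof -
  have "l2_inner (Sd d) v (elem_op G j i (inv g) w) = cnj (l2_inner (Sd d) (elem_op G j i (inv g) w) v)"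
    by (simp add: l2_inner_cnj)
  also have "\<dots> = (\<Sum>\<^sub>\<infinity>x\<in>carrier G. v (j, x) * cnj (w (i, g \<otimes> x)))"
    using i j g by (simp add: elem_op_inner_sum mult.commute flip: infsum_cnj)
  also have "\<dots> = (\<Sum>\<^sub>\<infinity>x\<in>carrier G. v (j, inv g \<otimes> x) * cnj (w (i, g \<otimes> (inv g \<otimes> x))))"
    by (rule infsum_reindex_bij_betw[OF translation_bij[OF g], symmetric])
  also have "\<dots> = (\<Sum>\<^sub>\<infinity>x\<in>carrier G. v (j, inv g \<otimes> x) * cnj (w (i, x)))"
    by (rule infsum_cong) (use g in \<open>simp add: m_assoc[symmetric]\<close>)
  finally show ?thesis using elem_op_inner_sum[OF i j g] by simp
qed

lemma component_summable:
  assumes "v \<in> l2 (Sd d)" "i < d"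
  shows "(\<lambda>x. (cmod (v (i, x)))\<^sup>2) summable_on carrier G"
proof -
  have "(\<lambda>p. (cmod (v p))\<^sup>2) summable_on Pair i ` carrier G"
    by (rule summable_on_subset_banach[OF l2_summable[OF assms(1)]])
      (use assms(2) in \<open>auto simp: l2_sum_index_def\<close>)
  then show ?thesis by (subst (asm) summable_on_reindex) (auto simp: inj_on_def comp_def)
qed

definition comp_norm :: "(nat \<times> 'a \<Rightarrow> complex) \<Rightarrow> nat \<Rightarrow> real" where
  "comp_norm v i = (\<Sum>\<^sub>\<infinity>x\<in>carrier G. (cmod (v (i, x)))\<^sup>2)"

lemma comp_norm_sum:
  assumes "v \<in> l2 (Sd d)"
  shows "Re (l2_inner (Sd d) v v) = (\<Sum>i<d. comp_norm v i)"
proof -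
  have "Re (l2_inner (Sd d) v v) = (\<Sum>\<^sub>\<infinity>p\<in>Sd d. (cmod (v p))\<^sup>2)"
    by (simp add: l2_inner_self[OF assms])
  also have "\<dots> = (\<Sum>\<^sub>\<infinity>i\<in>{..<d}. \<Sum>\<^sub>\<infinity>x\<in>carrier G. (cmod (v (i, x)))\<^sup>2)"
    unfolding l2_sum_index_def
    using infsum_Sigma_banach[of "\<lambda>p. (cmod (v p))\<^sup>2" "{..<d}" "\<lambda>_. carrier G"] l2_summable[OF assms]
    by (simp add: l2_sum_index_def)
  finally show ?thesis by (simp add: comp_norm_def)
qed

lemma elem_op_l2:
  assumes v: "v \<in> l2 (Sd d)" and i: "i < d" and j: "j < d" and g: "g \<in> carrier G"
  shows "elem_op G i j g v \<in> l2 (Sd d)"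
proof -
  have "(\<lambda>x. (cmod (v (j, inv g \<otimes> x)))\<^sup>2) summable_on carrier G"
    using component_summable[OF v j] summable_on_reindex_bij_betw[OF translation_bij[OF g], of "\<lambda>x. (cmod (v (j, x)))\<^sup>2"]
    by simp
  then have "(\<lambda>p. (cmod (elem_op G i j g v p))\<^sup>2) summable_on Pair i ` carrier G"
    by (subst summable_on_reindex) (auto simp: inj_on_def comp_def elem_op_def cong: summable_on_cong)
  then have "(\<lambda>p. (cmod (elem_op G i j g v p))\<^sup>2) summable_on Sd d"
    by (subst summable_on_cong_neutral[where T="Pair i ` carrier G"])
      (use i in \<open>auto simp: elem_op_def l2_sum_index_def\<close>)
  then show ?thesis using i by (auto simp: l2_def elem_op_def l2_sum_index_def)
qed

text \<open>The estimate 2|ab| \<le> |a|^2 + |b|^2 under the sum, with translation invariance of the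
  component norms; row and column are charged equally.\<close>

lemma elem_op_form_bound:
  assumes v: "v \<in> l2 (Sd d)" and i: "i < d" and j: "j < d" and g: "g \<in> carrier G"
  shows "cmod (l2_inner (Sd d) (elem_op G i j g v) v) \<le> (comp_norm v i + comp_norm v j) / 2"
proof -
  let ?f = "\<lambda>x. v (j, inv g \<otimes> x) * cnj (v (i, x))"
  let ?h = "\<lambda>x. ((cmod (v (i, x)))\<^sup>2 + (cmod (v (j, inv g \<otimes> x)))\<^sup>2) / 2"
  have si: "(\<lambda>x. (cmod (v (i, x)))\<^sup>2) summable_on carrier G" by (rule component_summable[OF v i])
  have sj: "(\<lambda>x. (cmod (v (j, inv g \<otimes> x)))\<^sup>2) summable_on carrier G"
    using component_summable[OF v j] summable_on_reindex_bij_betw[OF translation_bij[OF g], of "\<lambda>x. (cmod (v (j, x)))\<^sup>2"]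
    by simp
  have b: "cmod (?f x) \<le> ?h x" for x
    using sum_squares_bound[of "cmod (v (j, inv g \<otimes> x))" "cmod (v (i, x))"] by (simp add: norm_mult)
  have "(\<lambda>x. ((cmod (v (i, x)))\<^sup>2 + (cmod (v (j, inv g \<otimes> x)))\<^sup>2) * (1/2)) summable_on carrier G"
    by (intro summable_on_cmult_left summable_on_add si sj)
  then have sh: "?h summable_on carrier G" by simp
  have "(\<Sum>\<^sub>\<infinity>x\<in>carrier G. (cmod (v (j, inv g \<otimes> x)))\<^sup>2) = comp_norm v j"
    unfolding comp_norm_def by (rule infsum_reindex_bij_betw[OF translation_bij[OF g]])
  moreover have "(\<Sum>\<^sub>\<infinity>x\<in>carrier G. ?h x) = (\<Sum>\<^sub>\<infinity>x\<in>carrier G. (cmod (v (i, x)))\<^sup>2 + (cmod (v (j, inv g \<otimes> x)))\<^sup>2) / 2"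
    using infsum_cmult_left'[of "\<lambda>x. (cmod (v (i, x)))\<^sup>2 + (cmod (v (j, inv g \<otimes> x)))\<^sup>2" "1/2" "carrier G"] by simp
  ultimately have h: "(\<Sum>\<^sub>\<infinity>x\<in>carrier G. ?h x) = (comp_norm v i + comp_norm v j) / 2"
    by (simp add: infsum_add[OF si sj] comp_norm_def)
  have "cmod (\<Sum>\<^sub>\<infinity>x\<in>carrier G. ?f x) \<le> (\<Sum>\<^sub>\<infinity>x\<in>carrier G. ?h x)"
  proof (rule norm_infsum_le[OF has_sum_infsum has_sum_infsum[OF sh] b])
    have "(\<lambda>x. norm (?f x)) summable_on carrier G"
      by (rule summable_on_comparison_test[OF sh]) (use b in auto)
    then show "?f summable_on carrier G" by (rule Infinite_Sum.abs_summable_summable)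
  qed
  then show ?thesis using h elem_op_inner_sum[OF i j g] by simp
qed

context
  fixes d A
  assumes A: "hermitian_matrix G d A"
begin

lemma entry_in_group_ring: "i < d \<Longrightarrow> j < d \<Longrightarrow> A i j \<in> int_group_ring G"
  using A by (simp add: hermitian_matrix_def)

lemma finite_supp: "i < d \<Longrightarrow> j < d \<Longrightarrow> finite (supp (A i j))"
  using int_group_ring_supp(1)[OF entry_in_group_ring] .

lemma supp_carrier: "i < d \<Longrightarrow> j < d \<Longrightarrow> g \<in> supp (A i j) \<Longrightarrow> g \<in> carrier G"
  using int_group_ring_supp(2)[OF entry_in_group_ring] by blast

lemma finite_entries: "finite (entries d A)"
  unfolding entries_def by (intro finite_SigmaI finite_supp) auto

lemma entriesD:
  "(i, j, g) \<in> entries d A \<Longrightarrow> i < d" "(i, j, g) \<in> entries d A \<Longrightarrow> j < d"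
  "(i, j, g) \<in> entries d A \<Longrightarrow> g \<in> carrier G"
  using supp_carrier by (auto simp: entries_def)

lemma matrix_op_eq_sum:
  "matrix_op G d A v = (\<lambda>p. \<Sum>(i, j, g)\<in>entries d A. of_int (A i j g) * elem_op G i j g v p)"
proof
  fix p :: "nat \<times> 'a"
  obtain k x where p: "p = (k, x)" by (cases p)
  show "matrix_op G d A v p = (\<Sum>(i, j, g)\<in>entries d A. of_int (A i j g) * elem_op G i j g v p)"
  proof (cases "p \<in> Sd d")
    case False
    then have "elem_op G i j g v p = 0" if "(i, j, g) \<in> entries d A" for i j g
      using entriesD(1)[OF that] p by (auto simp: elem_op_def l2_sum_index_def)
    then have "(\<Sum>(i, j, g)\<in>entries d A. of_int (A i j g) * elem_op G i j g v p) = 0"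
      by (intro sum.neutral) auto
    then show ?thesis using matrix_op_outside[OF False] by simp
  next
    case True
    then have k: "k < d" and x: "x \<in> carrier G" using p by (auto simp: l2_sum_index_def)
    let ?B = "\<lambda>i. SIGMA j:{..<d}. supp (A i j)"
    have "(\<Sum>(i, j, g)\<in>entries d A. of_int (A i j g) * elem_op G i j g v p)
        = (\<Sum>i<d. \<Sum>(j, g)\<in>?B i. of_int (A i j g) * elem_op G i j g v p)"
      unfolding entries_def by (subst sum.Sigma) (auto intro!: finite_SigmaI finite_supp)
    also have "\<dots> = (\<Sum>i\<in>{k}. \<Sum>(j, g)\<in>?B i. of_int (A i j g) * elem_op G i j g v p)"
      by (rule sum.mono_neutral_right) (use k in \<open>auto simp: p elem_op_def intro!: sum.neutral\<close>)
    also have "\<dots> = matrix_op G d A v p"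
      using k x by (simp add: p matrix_op_apply[OF k x finite_supp] elem_op_def)
    finally show ?thesis by simp
  qed
qed

lemma elem_op_entries:
  "v \<in> l2 (Sd d) \<Longrightarrow> p \<in> entries d A \<Longrightarrow> elem_op G (fst p) (fst (snd p)) (snd (snd p)) v \<in> l2 (Sd d)"
  by (cases p) (auto intro!: elem_op_l2 dest: entriesD)

lemma matrix_op_l2: "v \<in> l2 (Sd d) \<Longrightarrow> matrix_op G d A v \<in> l2 (Sd d)"
  unfolding matrix_op_eq_sum split_beta by (rule l2_sum[OF finite_entries elem_op_entries])

lemma matrix_op_inner:
  assumes "v \<in> l2 (Sd d)" "w \<in> l2 (Sd d)"
  shows "l2_inner (Sd d) (matrix_op G d A v) w
    = (\<Sum>(i, j, g)\<in>entries d A. of_int (A i j g) * l2_inner (Sd d) (elem_op G i j g v) w)"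
  unfolding matrix_op_eq_sum split_beta
  by (rule l2_inner_sum[OF finite_entries elem_op_entries]) (use assms in auto)

lemma matrix_op_lin: "matrix_op G d A (\<lambda>x. c * v x + w x) = (\<lambda>x. c * matrix_op G d A v x + matrix_op G d A w x)"
  unfolding matrix_op_eq_sum
  by (auto simp: fun_eq_iff elem_op_def sum_distrib_left sum.distrib[symmetric] algebra_simps split_beta
      intro!: sum.cong)

text \<open>Taking adjoints permutes the entries of a hermitian matrix. This gives self-adjointness
  and exchanges row sums with column sums.\<close>

lemma entries_swap: "bij_betw (\<lambda>(i, j, g). (j, i, inv g)) (entries d A) (entries d A)"
proof (rule bij_betw_byWitness[where f'="\<lambda>(i, j, g). (j, i, inv g)"])
  have "(j, i, inv g) \<in> entries d A" if "(i, j, g) \<in> entries d A" for i j g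
    using that entriesD[OF that] A by (auto simp: entries_def supp_def hermitian_matrix_def)
  then show "(\<lambda>(i, j, g). (j, i, inv g)) ` entries d A \<subseteq> entries d A"
    "(\<lambda>(i, j, g). (j, i, inv g)) ` entries d A \<subseteq> entries d A" by auto
qed (use entriesD in auto)

lemma matrix_op_self_adjoint: "self_adjoint_on (Sd d) (matrix_op G d A)"
  unfolding self_adjoint_on_def l2_linear_def
proof (intro conjI ballI allI)
  fix v w assume v: "v \<in> l2 (Sd d)" and w: "w \<in> l2 (Sd d)"
  have "l2_inner (Sd d) v (matrix_op G d A w) = cnj (l2_inner (Sd d) (matrix_op G d A w) v)"
    by (simp add: l2_inner_cnj)
  also have "\<dots> = (\<Sum>(i, j, g)\<in>entries d A. of_int (A i j g) * l2_inner (Sd d) v (elem_op G i j g w))"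
    by (simp add: matrix_op_inner[OF w v] split_beta l2_inner_cnj)
  also have "\<dots> = (\<Sum>(i, j, g)\<in>entries d A. of_int (A j i (inv g)) * l2_inner (Sd d) v (elem_op G j i (inv g) w))"
    by (subst sum.reindex_bij_betw[OF entries_swap, symmetric]) (simp add: split_beta)
  also have "\<dots> = (\<Sum>(i, j, g)\<in>entries d A. of_int (A i j g) * l2_inner (Sd d) (elem_op G i j g v) w)"
  proof (rule sum.cong, simp, clarify)
    fix i j g assume p: "(i, j, g) \<in> entries d A"
    note e = entriesD[OF p]
    have "A j i (inv g) = A i j g" using A e by (simp add: hermitian_matrix_def)
    then show "of_int (A j i (inv g)) * l2_inner (Sd d) v (elem_op G j i (inv g) w)
      = of_int (A i j g) * l2_inner (Sd d) (elem_op G i j g v) w"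
      by (simp add: elem_op_adjoint[OF e])
  qed
  finally show "l2_inner (Sd d) (matrix_op G d A v) w = l2_inner (Sd d) v (matrix_op G d A w)"
    by (simp add: matrix_op_inner[OF v w])
qed (use matrix_op_l2 matrix_op_lin in auto)

lemma entries_row_sum:
  "(\<Sum>(i, j, g)\<in>entries d A. real_of_int \<bar>A i j g\<bar> * f i) = (\<Sum>i<d. row_sum d A i * f i)"
proof -
  let ?B = "\<lambda>i. SIGMA j:{..<d}. supp (A i j)"
  have "(\<Sum>(i, j, g)\<in>entries d A. real_of_int \<bar>A i j g\<bar> * f i)
      = (\<Sum>i<d. \<Sum>(j, g)\<in>?B i. real_of_int \<bar>A i j g\<bar> * f i)"
    unfolding entries_def by (subst sum.Sigma) (auto intro!: finite_SigmaI finite_supp)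
  also have "\<dots> = (\<Sum>i<d. row_sum d A i * f i)"
  proof (rule sum.cong)
    fix i assume "i \<in> {..<d}"
    then show "(\<Sum>(j, g)\<in>?B i. real_of_int \<bar>A i j g\<bar> * f i) = row_sum d A i * f i"
      unfolding row_sum_def
      by (subst sum.Sigma[symmetric]) (auto simp: finite_supp sum_distrib_right)
  qed simp
  finally show ?thesis .
qed

text \<open>A Schur test: half of the bound comes from row sums and half from column sums, and the
  two agree by hermitian symmetry.\<close>

lemma matrix_op_form_bound:
  assumes R: "\<And>i. i < d \<Longrightarrow> row_sum d A i \<le> R" and v: "v \<in> l2 (Sd d)"
  shows "\<bar>Re (l2_inner (Sd d) (matrix_op G d A v) v)\<bar> \<le> R * Re (l2_inner (Sd d) v v)"
proof -
  let ?n = "comp_norm v"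
  have n0: "0 \<le> ?n i" for i by (simp add: comp_norm_def infsum_nonneg)
  have "\<bar>Re (l2_inner (Sd d) (matrix_op G d A v) v)\<bar> \<le> cmod (l2_inner (Sd d) (matrix_op G d A v) v)"
    by (rule abs_Re_le_cmod)
  also have "\<dots> \<le> (\<Sum>(i, j, g)\<in>entries d A. cmod (of_int (A i j g) * l2_inner (Sd d) (elem_op G i j g v) v))"
    unfolding matrix_op_inner[OF v v] split_beta by (rule norm_sum)
  also have "\<dots> \<le> (\<Sum>(i, j, g)\<in>entries d A. real_of_int \<bar>A i j g\<bar> * ((?n i + ?n j) / 2))"
  proof (rule sum_mono, clarify)
    fix i j g assume p: "(i, j, g) \<in> entries d A"
    show "cmod (of_int (A i j g) * l2_inner (Sd d) (elem_op G i j g v) v)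
      \<le> real_of_int \<bar>A i j g\<bar> * ((?n i + ?n j) / 2)"
      unfolding norm_mult norm_of_int of_int_abs
      by (rule mult_left_mono[OF elem_op_form_bound[OF v entriesD[OF p]]]) simp
  qed
  also have "\<dots> = ((\<Sum>(i, j, g)\<in>entries d A. real_of_int \<bar>A i j g\<bar> * ?n i)
      + (\<Sum>(i, j, g)\<in>entries d A. real_of_int \<bar>A i j g\<bar> * ?n j)) / 2"
    by (simp add: split_beta sum.distrib[symmetric] sum_divide_distrib distrib_left add_divide_distrib)
  also have "(\<Sum>(i, j, g)\<in>entries d A. real_of_int \<bar>A i j g\<bar> * ?n j)
      = (\<Sum>(i, j, g)\<in>entries d A. real_of_int \<bar>A j i (inv g)\<bar> * ?n i)"
    by (subst sum.reindex_bij_betw[OF entries_swap, symmetric]) (simp add: split_beta)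
  also have "\<dots> = (\<Sum>(i, j, g)\<in>entries d A. real_of_int \<bar>A i j g\<bar> * ?n i)"
  proof (rule sum.cong, simp, clarify)
    fix i j g assume p: "(i, j, g) \<in> entries d A"
    show "real_of_int \<bar>A j i (inv g)\<bar> * ?n i = real_of_int \<bar>A i j g\<bar> * ?n i"
      using A entriesD[OF p] by (simp add: hermitian_matrix_def)
  qed
  also have "((\<Sum>(i, j, g)\<in>entries d A. real_of_int \<bar>A i j g\<bar> * ?n i)
      + (\<Sum>(i, j, g)\<in>entries d A. real_of_int \<bar>A i j g\<bar> * ?n i)) / 2 = (\<Sum>i<d. row_sum d A i * ?n i)"
    using entries_row_sum[of ?n] by simp
  also have "\<dots> \<le> (\<Sum>i<d. R * ?n i)" using R n0 by (intro sum_mono mult_right_mono) auto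
  also have "\<dots> = R * Re (l2_inner (Sd d) v v)" by (simp add: comp_norm_sum[OF v] sum_distrib_left)
  finally show ?thesis .
qed

text \<open>Passes from the form to the operator: the form bound at v + w and v - w with w = T v /
  R, combined with the parallelogram identity.\<close>

lemma matrix_op_norm_bound:
  assumes R: "\<And>i. i < d \<Longrightarrow> row_sum d A i \<le> R" "0 < R" and v: "v \<in> l2 (Sd d)"
  shows "Re (l2_inner (Sd d) (matrix_op G d A v) (matrix_op G d A v)) \<le> R\<^sup>2 * Re (l2_inner (Sd d) v v)"
proof -
  let ?T = "matrix_op G d A" and ?I = "l2_inner (Sd d)"
  define r where "r = complex_of_real (1 / R)"
  have r: "cnj r = r" "Re (r * z) = Re z / R" for z by (simp_all add: r_def)
  define w where "w = (\<lambda>x. r * ?T v x)"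
  have Tv: "?T v \<in> l2 (Sd d)" by (rule matrix_op_l2[OF v])
  have w: "w \<in> l2 (Sd d)" unfolding w_def using Tv by (rule l2_scale)
  have Tw: "?T w \<in> l2 (Sd d)" by (rule matrix_op_l2[OF w])
  have sym: "?I (?T w) v = cnj (?I (?T v) w)"
    using matrix_op_self_adjoint w v by (simp add: self_adjoint_on_def l2_inner_cnj)
  have p: "(\<lambda>x. v x + w x) \<in> l2 (Sd d)" and m: "(\<lambda>x. v x - w x) \<in> l2 (Sd d)"
    using v w by (auto intro: l2_add l2_diff)
  have "?T (\<lambda>x. v x + w x) = (\<lambda>x. ?T v x + ?T w x)" using matrix_op_lin[of 1 v w] by simp
  moreover have "?T (\<lambda>x. v x - w x) = (\<lambda>x. ?T v x - ?T w x)"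
    using matrix_op_lin[of "-1" w v] by simp
  ultimately have "?I (?T (\<lambda>x. v x + w x)) (\<lambda>x. v x + w x) - ?I (?T (\<lambda>x. v x - w x)) (\<lambda>x. v x - w x)
      = 2 * (?I (?T v) w + ?I (?T w) v)"
    using v w Tv Tw p m by (simp add: l2_inner_add l2_inner_diff)
  then have "4 * Re (?I (?T v) w) = Re (?I (?T (\<lambda>x. v x + w x)) (\<lambda>x. v x + w x)) - Re (?I (?T (\<lambda>x. v x - w x)) (\<lambda>x. v x - w x))"
    unfolding sym by (auto simp: complex_eq_iff)
  also have "\<dots> \<le> R * Re (?I (\<lambda>x. v x + w x) (\<lambda>x. v x + w x)) + R * Re (?I (\<lambda>x. v x - w x) (\<lambda>x. v x - w x))"
    using matrix_op_form_bound[OF R(1) p] matrix_op_form_bound[OF R(1) m] by linarith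
  also have "\<dots> = 2 * R * (Re (?I v v) + Re (?I w w))"
    using v w p m by (simp add: l2_inner_add l2_inner_diff algebra_simps)
  also have "Re (?I w w) = Re (?I (?T v) (?T v)) / R\<^sup>2"
    using Tv by (simp add: w_def l2_inner_scale l2_scale power2_eq_square r del: times_complex.sel)
  also have "Re (?I (?T v) w) = Re (?I (?T v) (?T v)) / R"
    using Tv by (simp add: w_def l2_inner_scale r del: times_complex.sel)
  finally show ?thesis using R(2) by (simp add: field_simps power2_eq_square)
qed

end

end

section \<open>Approximation of the determinant\<close>

text \<open>The convolution product of \<open>A\<close> with itself. Explicit integer coefficients
  are needed, because the determinant hypothesis speaks of matrices over the integral group
  ring.\<close>

definition matrix_square ::
  "('a, 'm) monoid_scheme \<Rightarrow> nat \<Rightarrow> (nat \<Rightarrow> nat \<Rightarrow> 'a \<Rightarrow> int) \<Rightarrow> nat \<Rightarrow> nat \<Rightarrow> 'a \<Rightarrow> int" where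
  "matrix_square G d A i j g = (if g \<in> carrier G
     then \<Sum>l<d. \<Sum>h\<in>supp (A i l). A i l h * A l j (inv\<^bsub>G\<^esub> h \<otimes>\<^bsub>G\<^esub> g) else 0)"

text \<open>The trace of the n-th power, through iterates of the operator, so that powers in the
  group ring do not have to be formed.\<close>

definition trace_moment ::
  "('a, 'm) monoid_scheme \<Rightarrow> nat \<Rightarrow> (nat \<Rightarrow> nat \<Rightarrow> 'a \<Rightarrow> int) \<Rightarrow> nat \<Rightarrow> real" where
  "trace_moment G d A n =
     (\<Sum>i<d. Re ((matrix_op G d A ^^ n) (delta (i, \<one>\<^bsub>G\<^esub>)) (i, \<one>\<^bsub>G\<^esub>)))"

context group
begin

lemma matrix_op_delta:
  assumes i: "i < d" and x: "x \<in> carrier G" and y: "y \<in> carrier G" and j: "j < d"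
    and A: "\<And>j. j < d \<Longrightarrow> A i j \<in> int_group_ring G"
  shows "matrix_op G d A (delta (j, y)) (i, x) = of_int (A i j (x \<otimes> inv y))"
proof -
  let ?B = "SIGMA j:{..<d}. supp (A i j)"
  have fin: "finite ?B" using int_group_ring_supp(1)[OF A] by auto
  have "matrix_op G d A (delta (j, y)) (i, x)
      = (\<Sum>(k, g)\<in>?B. of_int (A i k g) * delta (j, y) (k, inv g \<otimes> x))"
    by (rule matrix_op_apply[where A=A, OF i x int_group_ring_supp(1)[OF A]])
  also have "\<dots> = (\<Sum>p\<in>?B. if p = (j, x \<otimes> inv y) then of_int (A i j (x \<otimes> inv y)) else 0)"
  proof (rule sum.cong, simp, clarify)
    fix k g assume "k < d" "g \<in> supp (A i k)"
    then have g: "g \<in> carrier G" using int_group_ring_supp(2)[OF A] by blast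
    have "inv g \<otimes> x = y \<longleftrightarrow> g = x \<otimes> inv y"
      using g x y by (metis inv_closed inv_inv inv_mult_group inv_solve_left' m_closed inv_solve_right')
    then show "of_int (A i k g) * delta (j, y) (k, inv g \<otimes> x)
      = (if (k, g) = (j, x \<otimes> inv y) then of_int (A i j (x \<otimes> inv y)) else 0)"
      by (auto simp: delta_def)
  qed
  also have "\<dots> = of_int (A i j (x \<otimes> inv y))"
    using fin j by (simp add: sum.delta) (auto simp: supp_def)
  finally show ?thesis .
qed

text \<open>Coefficients are matrix elements: symmetry is tested on \<open>delta (j, \<one>)\<close>
  and \<open>delta (i, g)\<close>.\<close>

lemma hermitian_of_self_adjoint:
  assumes A: "\<And>i j. i < d \<Longrightarrow> j < d \<Longrightarrow> A i j \<in> int_group_ring G"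
    and sa: "self_adjoint_on (Sd d) (matrix_op G d A)"
  shows "hermitian_matrix G d A"
  unfolding hermitian_matrix_def
proof (intro allI impI conjI ballI)
  fix i j g assume i: "i < d" and j: "j < d" and g: "g \<in> carrier G"
  have S: "(j, \<one>) \<in> Sd d" "(i, g) \<in> Sd d" using i j g by (auto simp: l2_sum_index_def)
  have "l2_inner (Sd d) (matrix_op G d A (delta (j, \<one>))) (delta (i, g))
      = l2_inner (Sd d) (delta (j, \<one>)) (matrix_op G d A (delta (i, g)))"
    using sa S by (simp add: self_adjoint_on_def)
  then have "of_int (A i j g) = cnj (of_int (A j i (inv g)) :: complex)"
    using i j g by (simp add: l2_inner_delta[OF S(1)] l2_inner_delta[OF S(2)] matrix_op_delta A)
  then show "A j i (inv g) = A i j g" by simp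
qed (use A in auto)

lemma matrix_op_square:
  assumes A: "hermitian_matrix G d A"
  shows "matrix_op G d (matrix_square G d A) = (\<lambda>v. matrix_op G d A (matrix_op G d A v))"
    and "i < d \<Longrightarrow> j < d \<Longrightarrow> matrix_square G d A i j \<in> int_group_ring G"
proof -
  define Q where "Q = (\<Union>i<d. \<Union>j<d. supp (A i j))"
  \<comment> \<open>One finite set that contains the supports of all entries of the square, so that
    the sums over \<open>g\<close> can be exchanged with those over the factors.\<close>
  define F where "F = (\<lambda>(h, h'). h \<otimes> h') ` (Q \<times> Q)"
  have Q: "finite Q" "Q \<subseteq> carrier G"
    unfolding Q_def using finite_supp[OF A] supp_carrier[OF A] by auto
  have QA: "supp (A i j) \<subseteq> Q" if "i < d" "j < d" for i j using that by (auto simp: Q_def)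
  have F: "finite F" "F \<subseteq> carrier G" using Q by (auto simp: F_def)
  have supp2: "supp (matrix_square G d A i j) \<subseteq> F" if i: "i < d" and j: "j < d" for i j
  proof
    fix g assume g: "g \<in> supp (matrix_square G d A i j)"
    then have gc: "g \<in> carrier G" by (auto simp: supp_def matrix_square_def split: if_splits)
    then have "(\<Sum>l<d. \<Sum>h\<in>supp (A i l). A i l h * A l j (inv h \<otimes> g)) \<noteq> 0"
      using g by (simp add: supp_def matrix_square_def)
    then obtain l where l: "l < d" "(\<Sum>h\<in>supp (A i l). A i l h * A l j (inv h \<otimes> g)) \<noteq> 0"
      by (auto elim: sum.not_neutral_contains_not_neutral)
    then obtain h where h: "h \<in> supp (A i l)" "A i l h * A l j (inv h \<otimes> g) \<noteq> 0"
      by (auto elim: sum.not_neutral_contains_not_neutral)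
    then have "h \<in> Q" "inv h \<otimes> g \<in> Q" using QA i j l(1) by (auto simp: supp_def)
    moreover from this have "g = h \<otimes> (inv h \<otimes> g)" using Q gc by (auto simp: m_assoc[symmetric])
    ultimately show "g \<in> F" unfolding F_def by force
  qed
  show "matrix_square G d A i j \<in> int_group_ring G" if "i < d" "j < d"
    using supp2[OF that] F finite_subset unfolding int_group_ring_def supp_def by blast
  show "matrix_op G d (matrix_square G d A) = (\<lambda>v. matrix_op G d A (matrix_op G d A v))"
  proof (intro ext)
    fix v p
    show "matrix_op G d (matrix_square G d A) v p = matrix_op G d A (matrix_op G d A v) p"
    proof (cases "p \<in> Sd d")
      case True
      then obtain i x where p: "p = (i, x)" and i: "i < d" and x: "x \<in> carrier G"
        by (auto simp: l2_sum_index_def)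
      have fin2: "finite (supp (matrix_square G d A i j))" if "j < d" for j
        using supp2[OF i that] F finite_subset by blast
      have inner: "(\<Sum>g\<in>F. of_int (A l j (inv h \<otimes> g)) * v (j, inv g \<otimes> x))
          = (\<Sum>h'\<in>supp (A l j). of_int (A l j h') * v (j, inv h' \<otimes> (inv h \<otimes> x)))"
        if l: "l < d" and j: "j < d" and h: "h \<in> supp (A i l)" for l j h
      proof -
        have hQ: "h \<in> Q" "h \<in> carrier G" using QA[OF i l] h Q by auto
        have "(\<Sum>g\<in>F. of_int (A l j (inv h \<otimes> g)) * v (j, inv g \<otimes> x))
            = (\<Sum>g\<in>(\<lambda>h'. h \<otimes> h') ` supp (A l j). of_int (A l j (inv h \<otimes> g)) * v (j, inv g \<otimes> x))"
        proof (rule sum.mono_neutral_right[OF F(1)])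
          show "(\<lambda>h'. h \<otimes> h') ` supp (A l j) \<subseteq> F"
            using hQ QA[OF l j] unfolding F_def by force
          show "\<forall>g\<in>F - (\<lambda>h'. h \<otimes> h') ` supp (A l j). of_int (A l j (inv h \<otimes> g)) * v (j, inv g \<otimes> x) = 0"
          proof
            fix g assume g: "g \<in> F - (\<lambda>h'. h \<otimes> h') ` supp (A l j)"
            have "g = h \<otimes> (inv h \<otimes> g)" using g F hQ by (auto simp: m_assoc[symmetric])
            then have "inv h \<otimes> g \<notin> supp (A l j)" using g by blast
            then show "of_int (A l j (inv h \<otimes> g)) * v (j, inv g \<otimes> x) = 0" by (simp add: supp_def)
          qed
        qed
        also have "\<dots> = (\<Sum>h'\<in>supp (A l j). of_int (A l j (inv h \<otimes> (h \<otimes> h'))) * v (j, inv (h \<otimes> h') \<otimes> x))"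
          using hQ supp_carrier[OF A l j] by (subst sum.reindex) (auto simp: inj_on_def)
        also have "\<dots> = (\<Sum>h'\<in>supp (A l j). of_int (A l j h') * v (j, inv h' \<otimes> (inv h \<otimes> x)))"
          using hQ x supp_carrier[OF A l j]
          by (intro sum.cong) (auto simp: m_assoc[symmetric] inv_mult_group)
        finally show ?thesis .
      qed
      have "matrix_op G d (matrix_square G d A) v p
          = (\<Sum>j<d. \<Sum>g\<in>supp (matrix_square G d A i j). of_int (matrix_square G d A i j g) * v (j, inv g \<otimes> x))"
        using fin2 by (simp add: p matrix_op_apply[where A="matrix_square G d A", OF i x fin2] sum.Sigma)
      also have "\<dots> = (\<Sum>j<d. \<Sum>g\<in>F. of_int (matrix_square G d A i j g) * v (j, inv g \<otimes> x))"
        by (intro sum.cong refl sum.mono_neutral_left F) (use supp2[OF i] in \<open>auto simp: supp_def\<close>)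
      also have "\<dots> = (\<Sum>j<d. \<Sum>g\<in>F. \<Sum>l<d. \<Sum>h\<in>supp (A i l).
          of_int (A i l h) * (of_int (A l j (inv h \<otimes> g)) * v (j, inv g \<otimes> x)))"
        using F(2) by (intro sum.cong refl) (auto simp: matrix_square_def sum_distrib_right mult.assoc)
      also have "\<dots> = (\<Sum>j<d. \<Sum>l<d. \<Sum>h\<in>supp (A i l). \<Sum>g\<in>F.
          of_int (A i l h) * (of_int (A l j (inv h \<otimes> g)) * v (j, inv g \<otimes> x)))"
      proof (rule sum.cong[OF refl])
        fix j
        show "(\<Sum>g\<in>F. \<Sum>l<d. \<Sum>h\<in>supp (A i l). of_int (A i l h) * (of_int (A l j (inv h \<otimes> g)) * v (j, inv g \<otimes> x)))
          = (\<Sum>l<d. \<Sum>h\<in>supp (A i l). \<Sum>g\<in>F. of_int (A i l h) * (of_int (A l j (inv h \<otimes> g)) * v (j, inv g \<otimes> x)))"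
          by (subst sum.swap, rule sum.cong[OF refl], rule sum.swap)
      qed
      also have "\<dots> = (\<Sum>j<d. \<Sum>l<d. \<Sum>h\<in>supp (A i l).
          of_int (A i l h) * (\<Sum>h'\<in>supp (A l j). of_int (A l j h') * v (j, inv h' \<otimes> (inv h \<otimes> x))))"
        by (intro sum.cong refl) (simp only: sum_distrib_left[symmetric] inner lessThan_iff)
      also have "\<dots> = (\<Sum>l<d. \<Sum>h\<in>supp (A i l). \<Sum>j<d.
          of_int (A i l h) * (\<Sum>h'\<in>supp (A l j). of_int (A l j h') * v (j, inv h' \<otimes> (inv h \<otimes> x))))"
        by (subst sum.swap, rule sum.cong[OF refl], rule sum.swap)
      also have "\<dots> = (\<Sum>l<d. \<Sum>h\<in>supp (A i l). of_int (A i l h) * matrix_op G d A v (l, inv h \<otimes> x))"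
      proof (intro sum.cong refl)
        fix l h assume l: "l \<in> {..<d}" and h: "h \<in> supp (A i l)"
        have hx: "inv h \<otimes> x \<in> carrier G" using supp_carrier[OF A i, of l h] l h x by simp
        have "matrix_op G d A v (l, inv h \<otimes> x)
            = (\<Sum>j<d. \<Sum>h'\<in>supp (A l j). of_int (A l j h') * v (j, inv h' \<otimes> (inv h \<otimes> x)))"
          using l finite_supp[OF A, of l] by (subst matrix_op_apply) (auto simp: hx sum.Sigma)
        then show "(\<Sum>j<d. of_int (A i l h) * (\<Sum>h'\<in>supp (A l j). of_int (A l j h') * v (j, inv h' \<otimes> (inv h \<otimes> x))))
            = of_int (A i l h) * matrix_op G d A v (l, inv h \<otimes> x)"
          by (simp add: sum_distrib_left)
      qed
      also have "\<dots> = matrix_op G d A (matrix_op G d A v) p"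
        using finite_supp[OF A i] by (simp add: p matrix_op_apply[where A=A, OF i x finite_supp[OF A i]] sum.Sigma)
      finally show ?thesis .
    qed (simp add: matrix_op_outside)
  qed
qed

text \<open>The form of the square at \<open>v\<close> is the squared norm of \<open>A v\<close>;
  this gives positivity and, by the norm bound, the constant.\<close>

lemma square_positive_operator:
  assumes A: "hermitian_matrix G d A" and R: "\<And>i. i < d \<Longrightarrow> row_sum d A i \<le> R" "0 < R"
  shows "positive_operator (Sd d) (matrix_op G d (matrix_square G d A)) (R\<^sup>2)"
proof
  let ?T = "matrix_op G d A"
  have l2: "?T v \<in> l2 (Sd d)" if "v \<in> l2 (Sd d)" for v by (rule matrix_op_l2[OF A that])
  have sym: "l2_inner (Sd d) (?T v) w = l2_inner (Sd d) v (?T w)" if "v \<in> l2 (Sd d)" "w \<in> l2 (Sd d)" for v w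
    using matrix_op_self_adjoint[OF A] that by (simp add: self_adjoint_on_def)
  have nonneg: "0 \<le> Re (l2_inner (Sd d) v (?T (?T v)))" if "v \<in> l2 (Sd d)" for v
    using sym[OF that l2[OF that]] l2_inner_self_nonneg[OF l2[OF that]] by simp
  show "positive_self_adjoint_on (Sd d) (matrix_op G d (matrix_square G d A))"
    unfolding matrix_op_square(1)[OF A] positive_self_adjoint_on_def self_adjoint_on_def l2_linear_def
    by (auto simp: l2 sym matrix_op_lin[OF A] nonneg)
  show "Re (l2_inner (Sd d) (matrix_op G d (matrix_square G d A) v) v) \<le> R\<^sup>2 * Re (l2_inner (Sd d) v v)"
    if "v \<in> l2 (Sd d)" for v
    unfolding matrix_op_square(1)[OF A]
    using matrix_op_norm_bound[OF A R that] that by (simp add: sym l2)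
qed (use R in simp)

lemma square_trace_moments:
  assumes A: "hermitian_matrix G d A"
  shows "(\<Sum>i<d. Re ((matrix_op G d (matrix_square G d A) ^^ n) (delta (i, \<one>)) (i, \<one>)))
    = trace_moment G d A (2 * n)"
proof -
  have "matrix_op G d (matrix_square G d A) = matrix_op G d A ^^ 2"
    unfolding matrix_op_square(1)[OF A] by (simp add: fun_eq_iff numeral_2_eq_2)
  then show ?thesis by (simp add: trace_moment_def funpow_mult)
qed

text \<open>The squares \<open>B\<^sub>k\<^sup>2\<close> are positive whether or not the \<open>B\<^sub>k\<close> are, and their
  moments approximate those of \<open>A\<^sup>2\<close>.\<close>

lemma determinant_from_approximation:
  fixes H :: "nat \<Rightarrow> ('c, 'n) monoid_scheme"
  assumes A: "\<And>i j. i < d \<Longrightarrow> j < d \<Longrightarrow> A i j \<in> int_group_ring G"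
    and pos: "positive_self_adjoint_on (Sd d) (matrix_op G d A)"
    and H: "\<And>k. group (H k)" "\<And>k. semi_integral_determinant (H k)"
    and B: "\<And>k. hermitian_matrix (H k) (D k) (B k)" "\<And>k i. i < D k \<Longrightarrow> row_sum (D k) (B k) i \<le> R"
    and c: "\<And>k. 0 < c k"
    and conv: "\<And>n. (\<lambda>k. c k * trace_moment (H k) (D k) (B k) (2 * n)) \<longlonglongrightarrow> trace_moment G d A (2 * n)"
  shows "0 \<le> ln_det G d (matrix_op G d A)"
proof -
  have hA: "hermitian_matrix G d A"
    using hermitian_of_self_adjoint A pos by (simp add: positive_self_adjoint_on_def)
  \<comment> \<open>A sum dominates every row, and the summand 1 keeps the bound positive for d = 0
    or A = 0.\<close>
  define K where "K = 1 + (\<Sum>i<d. row_sum d A i)"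
  have row0: "0 \<le> row_sum d A i" for i by (simp add: row_sum_def sum_nonneg)
  have K: "0 < K" unfolding K_def using row0 by (intro add_pos_nonneg sum_nonneg) auto
  have rowK: "row_sum d A i \<le> K" if "i < d" for i
    using member_le_sum[of i "{..<d}" "row_sum d A"] that row0 by (simp add: K_def)
  have poA: "positive_operator (Sd d) (matrix_op G d A) K"
  proof
    show "Re (l2_inner (Sd d) (matrix_op G d A v) v) \<le> K * Re (l2_inner (Sd d) v v)" if "v \<in> l2 (Sd d)" for v
      using matrix_op_form_bound[OF hA rowK that] by linarith
  qed (use pos K in auto)
  define \<rho> where "\<rho> = interval_measure (spectral_density G d (matrix_op G d A))"
  note tA = trace_measure[OF one_closed poA, folded \<rho>_def]
  have [measurable_cong]: "sets \<rho> = sets borel" using bounded_measureD[OF tA(1)] by blast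
  let ?\<rho>2 = "distr \<rho> borel (\<lambda>t. t\<^sup>2)"
  have bm2: "bounded_measure (K\<^sup>2) ?\<rho>2"
  proof -
    have "AE t in \<rho>. \<bar>t\<^sup>2\<bar> \<le> K\<^sup>2"
      using bounded_measureD(3)[OF tA(1)] by eventually_elim (rule power_bound_on)
    moreover have "finite_measure ?\<rho>2"
      using bounded_measureD(2)[OF tA(1)] by (intro finite_measure.finite_measure_distr) auto
    ultimately show ?thesis unfolding bounded_measure_def by (simp add: AE_distr_iff)
  qed
  have pos2: "AE t in ?\<rho>2. 0 \<le> t" by (subst AE_distr_iff) auto
  have mom2: "(\<integral>t. t ^ n \<partial>?\<rho>2) = trace_moment G d A (2 * n)" for n
  proof -
    have "(\<integral>t. t ^ n \<partial>?\<rho>2) = (\<integral>t. t ^ (2 * n) \<partial>\<rho>)"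
      by (subst integral_distr) (auto simp: power_mult)
    then show ?thesis using tA(3)[of "2 * n"] by (simp add: trace_moment_def)
  qed
  define R' where "R' = max R 1"
  define \<nu> where "\<nu> k = interval_measure (spectral_density (H k) (D k)
      (matrix_op (H k) (D k) (matrix_square (H k) (D k) (B k))))" for k
  have poB: "positive_operator (l2_sum_index (H k) (D k))
      (matrix_op (H k) (D k) (matrix_square (H k) (D k) (B k))) (R'\<^sup>2)" for k
    by (rule group.square_positive_operator[OF H(1) B(1)])
      (use B(2) in \<open>auto simp: R'_def le_max_iff_disj\<close>)
  have one: "\<one>\<^bsub>H k\<^esub> \<in> carrier (H k)" for k using H(1) by (simp add: group.is_monoid)
  note tB = trace_measure[OF one poB, folded \<nu>_def]
  \<comment> \<open>The place where the determinant hypothesis on the approximating groups enters: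
    the square is integral and positive.\<close>
  have lnB: "ln_nonneg (\<nu> k)" for k
  proof -
    have "0 \<le> ln_det (H k) (D k) (matrix_op (H k) (D k) (matrix_square (H k) (D k) (B k)))"
      using H(2)[of k] group.matrix_op_square(2)[OF H(1) B(1), of _ k] positive_operator.psa[OF poB[of k]]
      unfolding semi_integral_determinant_def by blast
    then show ?thesis by (simp add: ln_det_nonneg_iff \<nu>_def)
  qed
  \<comment> \<open>The factor normalizes the trace when the approximating matrices grow in size; a
    positive factor does not affect the sign of the logarithmic integral.\<close>
  let ?\<nu> = "\<lambda>k. density (\<nu> k) (\<lambda>_. ennreal (c k))"
  let ?K = "max (K\<^sup>2) (R'\<^sup>2)"
  have "ln_nonneg ?\<rho>2"
  proof (rule ln_nonneg_limit[where \<nu>="?\<nu>" and K="?K"])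
    fix k
    note M = bounded_measureD[OF tB(1)[of k]]
    have "finite_measure (?\<nu> k)"
      using finite_measure.emeasure_finite[OF M(2), of "space (\<nu> k)"]
      by (intro finite_measureI) (simp add: emeasure_density nn_integral_cmult ennreal_mult_eq_top_iff)
    then have "bounded_measure (R'\<^sup>2) (?\<nu> k)" using M by (simp add: bounded_measure_def AE_density)
    then show "bounded_measure ?K (?\<nu> k)" by (rule bounded_measure_mono) simp
    show "AE t in ?\<nu> k. 0 \<le> t" using tB(2)[of k] by (simp add: AE_density)
    show "ln_nonneg (?\<nu> k)" by (rule ln_nonneg_scale[OF M(1) lnB c])
  next
    show "bounded_measure ?K ?\<rho>2" by (rule bounded_measure_mono[OF bm2]) simp
    show "AE t in ?\<rho>2. 0 \<le> t" by (rule pos2)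
    show "(\<lambda>k. \<integral>t. t ^ n \<partial>?\<nu> k) \<longlonglongrightarrow> (\<integral>t. t ^ n \<partial>?\<rho>2)" for n
    proof -
      have "(\<integral>t. t ^ n \<partial>?\<nu> k) = c k * trace_moment (H k) (D k) (B k) (2 * n)" for k
      proof -
        have "(\<integral>t. t ^ n \<partial>?\<nu> k) = (\<integral>t. c k * t ^ n \<partial>\<nu> k)"
          using c[of k] bounded_measureD(1)[OF tB(1)[of k]]
          by (subst integral_density) (auto cong: measurable_cong_sets simp: less_imp_le)
        then show ?thesis
          using tB(3)[of k n] group.square_trace_moments[OF H(1) B(1), of n k] by simp
      qed
      then show ?thesis using conv[of n] mom2 by simp
    qed
  qed
  then have "ln_nonneg \<rho>" by (rule ln_nonneg_square[OF tA(1,2)])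
  then show ?thesis by (simp add: ln_det_nonneg_iff \<rho>_def)
qed

end

section \<open>Local isomorphisms\<close>

text \<open>\<open>B m\<close> is the region reached after \<open>m\<close> steps. One application
  of the operator moves agreement on \<open>B (Suc m)\<close> back to \<open>B m\<close>, so the
  n-th iterate on \<open>B 0\<close> depends only on data over \<open>B n\<close>. This serves
  homomorphisms, right translations and compressions alike.\<close>

lemma local_isomorphism_power:
  fixes T :: "('a \<Rightarrow> 'c) \<Rightarrow> 'a \<Rightarrow> 'c" and T' :: "('b \<Rightarrow> 'c) \<Rightarrow> 'b \<Rightarrow> 'c"
  assumes step: "\<And>m b v v'. m < n \<Longrightarrow> b \<in> B m \<Longrightarrow> (\<And>c. c \<in> B (Suc m) \<Longrightarrow> v c = v' (\<iota> c)) \<Longrightarrow>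
      T v b = T' v' (\<iota> b)"
    and init: "\<And>b. b \<in> B n \<Longrightarrow> u b = u' (\<iota> b)" and a: "a \<in> B 0"
  shows "(T ^^ n) u a = (T' ^^ n) u' (\<iota> a)"
proof -
  have "k \<le> n \<Longrightarrow> b \<in> B (n - k) \<Longrightarrow> (T ^^ k) u b = (T' ^^ k) u' (\<iota> b)" for k b
  proof (induction k arbitrary: b)
    case 0
    then show ?case using init by simp
  next
    case (Suc k)
    have "Suc (n - Suc k) = n - k" using Suc.prems by simp
    then have "T ((T ^^ k) u) b = T' ((T' ^^ k) u') (\<iota> b)"
      using Suc by (intro step[of "n - Suc k"]) auto
    then show ?case by simp
  qed
  from this[of n a] show ?thesis using a by simp
qed

text \<open>The points visited by \<open>n\<close> applications of the operator from the unit; the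
  inverse is the one in \<open>left_mult_op\<close>.\<close>

fun walk :: "('a, 'm) monoid_scheme \<Rightarrow> 'a set \<Rightarrow> nat \<Rightarrow> 'a set" where
  "walk G V 0 = {\<one>\<^bsub>G\<^esub>}" |
  "walk G V (Suc m) = (\<lambda>(g, x). inv\<^bsub>G\<^esub> g \<otimes>\<^bsub>G\<^esub> x) ` (V \<times> walk G V m)"

lemma walk_finite: "finite V \<Longrightarrow> finite (walk G V m)"
  by (induction m) auto

lemma (in group) walk_carrier: "V \<subseteq> carrier G \<Longrightarrow> walk G V m \<subseteq> carrier G"
  by (induction m) auto

text \<open>Stated on a finite set without a direction for the groups, since the original matrix may
  live on either side of the homomorphism.\<close>

definition support_transport ::
  "nat \<Rightarrow> ('a \<Rightarrow> 'b) \<Rightarrow> 'a set \<Rightarrow> (nat \<Rightarrow> nat \<Rightarrow> 'a \<Rightarrow> int) \<Rightarrow> (nat \<Rightarrow> nat \<Rightarrow> 'b \<Rightarrow> int) \<Rightarrow> bool" where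
  "support_transport d \<psi> V A B \<longleftrightarrow> finite V \<and> inj_on \<psi> V \<and>
     (\<forall>i<d. \<forall>j<d. supp (A i j) \<subseteq> V \<and> supp (B i j) \<subseteq> \<psi> ` V \<and> (\<forall>g\<in>V. B i j (\<psi> g) = A i j g))"

lemma support_transportD:
  assumes "support_transport d \<psi> V A B" "i < d" "j < d"
  shows "supp (A i j) \<subseteq> V" "supp (B i j) \<subseteq> \<psi> ` V" "g \<in> V \<Longrightarrow> B i j (\<psi> g) = A i j g"
  using assms by (auto simp: support_transport_def)

lemma support_transport_bij:
  assumes "support_transport d \<psi> V A B" "i < d" "j < d"
  shows "bij_betw \<psi> (supp (A i j)) (supp (B i j))"
  unfolding bij_betw_def
proof
  show "inj_on \<psi> (supp (A i j))"
    using assms unfolding support_transport_def by (meson inj_on_subset)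
  show "\<psi> ` supp (A i j) = supp (B i j)"
    using support_transportD[OF assms] by (auto simp: supp_def)
qed

lemma row_sum_transport:
  assumes "support_transport d \<psi> V A B" "i < d"
  shows "row_sum d B i = row_sum d A i"
  unfolding row_sum_def
proof (rule sum.cong)
  fix j assume "j \<in> {..<d}"
  then have j: "j < d" by simp
  have "(\<Sum>g\<in>supp (B i j). real_of_int \<bar>B i j g\<bar>) = (\<Sum>g\<in>supp (A i j). real_of_int \<bar>B i j (\<psi> g)\<bar>)"
    by (rule sum.reindex_bij_betw[OF support_transport_bij[OF assms j], symmetric])
  also have "\<dots> = (\<Sum>g\<in>supp (A i j). real_of_int \<bar>A i j g\<bar>)"
    using support_transportD[OF assms j] by (intro sum.cong) auto
  finally show "(\<Sum>g\<in>supp (B i j). real_of_int \<bar>B i j g\<bar>) = (\<Sum>g\<in>supp (A i j). real_of_int \<bar>A i j g\<bar>)" .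
qed simp

text \<open>A diagonal entry of the n-th power counts weighted walks of length \<open>n\<close> that
  return to the unit. It therefore suffices that the homomorphism does not send a nontrivial
  endpoint to the unit.\<close>

lemma trace_moment_transport:
  fixes G :: "('a, 'm) monoid_scheme" and H :: "('b, 'n) monoid_scheme"
  assumes G: "group G" and H: "group H" and \<psi>: "\<psi> \<in> hom G H"
    and V: "V \<subseteq> carrier G" "support_transport d \<psi> V A B"
    and triv: "\<And>x. x \<in> walk G V n \<Longrightarrow> \<psi> x = \<one>\<^bsub>H\<^esub> \<Longrightarrow> x = \<one>\<^bsub>G\<^esub>"
  shows "trace_moment G d A n = trace_moment H d B n"
  unfolding trace_moment_def
proof (rule sum.cong)
  interpret G: group G by (rule G)
  interpret H: group H by (rule H)
  interpret \<psi>: group_hom G H \<psi> using \<psi> by unfold_locales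
  fix i assume "i \<in> {..<d}"
  then have i: "i < d" by simp
  let ?\<iota> = "\<lambda>(j, x). (j, \<psi> x)"
  have fV: "finite V" using V(2) by (simp add: support_transport_def)
  have finA: "finite (supp (A i j))" "finite (supp (B i j))" if "i < d" "j < d" for i j
    using finite_subset[OF support_transportD(1)[OF V(2) that] fV]
      finite_subset[OF support_transportD(2)[OF V(2) that] finite_imageI[OF fV]] by auto
  have "(matrix_op G d A ^^ n) (delta (i, \<one>\<^bsub>G\<^esub>)) (i, \<one>\<^bsub>G\<^esub>)
      = (matrix_op H d B ^^ n) (delta (i, \<one>\<^bsub>H\<^esub>)) (?\<iota> (i, \<one>\<^bsub>G\<^esub>))"
  proof (rule local_isomorphism_power[where B="\<lambda>m. {..<d} \<times> walk G V m"])
    fix m b and v :: "nat \<times> 'a \<Rightarrow> complex" and v' :: "nat \<times> 'b \<Rightarrow> complex"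
    assume b: "b \<in> {..<d} \<times> walk G V m" and vv: "\<And>c. c \<in> {..<d} \<times> walk G V (Suc m) \<Longrightarrow> v c = v' (?\<iota> c)"
    obtain k x where bk: "b = (k, x)" and k: "k < d" and x: "x \<in> walk G V m" using b by auto
    have xc: "x \<in> carrier G" using G.walk_carrier[OF V(1)] x by blast
    have "matrix_op H d B v' (k, \<psi> x)
        = (\<Sum>j<d. \<Sum>h\<in>supp (B k j). of_int (B k j h) * v' (j, inv\<^bsub>H\<^esub> h \<otimes>\<^bsub>H\<^esub> \<psi> x))"
      using finA[OF k] xc by (subst matrix_op_apply) (auto simp: k sum.Sigma)
    also have "\<dots> = (\<Sum>j<d. \<Sum>g\<in>supp (A k j). of_int (A k j g) * v (j, inv\<^bsub>G\<^esub> g \<otimes>\<^bsub>G\<^esub> x))"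
    proof (rule sum.cong)
      fix j assume "j \<in> {..<d}"
      then have j: "j < d" by simp
      have "(\<Sum>h\<in>supp (B k j). of_int (B k j h) * v' (j, inv\<^bsub>H\<^esub> h \<otimes>\<^bsub>H\<^esub> \<psi> x))
          = (\<Sum>g\<in>supp (A k j). of_int (B k j (\<psi> g)) * v' (j, inv\<^bsub>H\<^esub> (\<psi> g) \<otimes>\<^bsub>H\<^esub> \<psi> x))"
        by (rule sum.reindex_bij_betw[OF support_transport_bij[OF V(2) k j], symmetric])
      also have "\<dots> = (\<Sum>g\<in>supp (A k j). of_int (A k j g) * v (j, inv\<^bsub>G\<^esub> g \<otimes>\<^bsub>G\<^esub> x))"
      proof (rule sum.cong)
        fix g assume "g \<in> supp (A k j)"
        then have gV: "g \<in> V" using support_transportD(1)[OF V(2) k j] by blast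
        then have g: "g \<in> carrier G" using V(1) by blast
        have "(j, inv\<^bsub>G\<^esub> g \<otimes>\<^bsub>G\<^esub> x) \<in> {..<d} \<times> walk G V (Suc m)" using j gV x by force
        from vv[OF this] have "v (j, inv\<^bsub>G\<^esub> g \<otimes>\<^bsub>G\<^esub> x) = v' (j, inv\<^bsub>H\<^esub> (\<psi> g) \<otimes>\<^bsub>H\<^esub> \<psi> x)"
          using g xc by simp
        moreover have "B k j (\<psi> g) = A k j g" using support_transportD(3)[OF V(2) k j gV] .
        ultimately show "of_int (B k j (\<psi> g)) * v' (j, inv\<^bsub>H\<^esub> (\<psi> g) \<otimes>\<^bsub>H\<^esub> \<psi> x)
            = of_int (A k j g) * v (j, inv\<^bsub>G\<^esub> g \<otimes>\<^bsub>G\<^esub> x)" by simp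
      qed simp
      finally show "(\<Sum>h\<in>supp (B k j). of_int (B k j h) * v' (j, inv\<^bsub>H\<^esub> h \<otimes>\<^bsub>H\<^esub> \<psi> x))
          = (\<Sum>g\<in>supp (A k j). of_int (A k j g) * v (j, inv\<^bsub>G\<^esub> g \<otimes>\<^bsub>G\<^esub> x))" .
    qed simp
    also have "\<dots> = matrix_op G d A v (k, x)"
      using finA[OF k] xc by (subst matrix_op_apply) (auto simp: k sum.Sigma)
    finally show "matrix_op G d A v b = matrix_op H d B v' (?\<iota> b)" by (simp add: bk)
  next
    fix b assume b: "b \<in> {..<d} \<times> walk G V n"
    then obtain k x where bk: "b = (k, x)" and x: "x \<in> walk G V n" by auto
    have "\<psi> x = \<one>\<^bsub>H\<^esub> \<longleftrightarrow> x = \<one>\<^bsub>G\<^esub>" using triv[OF x] by auto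
    then show "delta (i, \<one>\<^bsub>G\<^esub>) b = delta (i, \<one>\<^bsub>H\<^esub>) (?\<iota> b)" by (auto simp: bk delta_def)
  qed (use i in auto)
  then show "Re ((matrix_op G d A ^^ n) (delta (i, \<one>\<^bsub>G\<^esub>)) (i, \<one>\<^bsub>G\<^esub>))
      = Re ((matrix_op H d B ^^ n) (delta (i, \<one>\<^bsub>H\<^esub>)) (i, \<one>\<^bsub>H\<^esub>))" by simp
qed simp

section \<open>Subgroups and limits\<close>

lemma row_sum_nonneg: "0 \<le> row_sum d A i"
  by (simp add: row_sum_def sum_nonneg)

context group
begin

lemma semi_integral_if_moments_agree:
  assumes approx: "\<And>d A N. hermitian_matrix G d A \<Longrightarrow>
    \<exists>(H :: ('c, 'n) monoid_scheme) B. group H \<and> semi_integral_determinant H \<and> hermitian_matrix H d B \<and>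
      (\<forall>i<d. row_sum d B i = row_sum d A i) \<and> (\<forall>n\<le>N. trace_moment H d B n = trace_moment G d A n)"
  shows "semi_integral_determinant G"
  unfolding semi_integral_determinant_def
proof (intro allI impI)
  fix d A
  assume A: "\<forall>i<d. \<forall>j<d. A i j \<in> int_group_ring G"
    and pos: "positive_self_adjoint_on (Sd d) (matrix_op G d A)"
  have hA: "hermitian_matrix G d A"
    using hermitian_of_self_adjoint A pos by (simp add: positive_self_adjoint_on_def)
  have "\<forall>k. \<exists>(H :: ('c, 'n) monoid_scheme) B. group H \<and> semi_integral_determinant H \<and> hermitian_matrix H d B \<and>
      (\<forall>i<d. row_sum d B i = row_sum d A i) \<and> (\<forall>n\<le>2 * k. trace_moment H d B n = trace_moment G d A n)"
    using approx[OF hA] by blast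
  then obtain H :: "nat \<Rightarrow> ('c, 'n) monoid_scheme" and B where
    H: "\<And>k. group (H k)" "\<And>k. semi_integral_determinant (H k)" "\<And>k. hermitian_matrix (H k) d (B k)"
      "\<And>k i. i < d \<Longrightarrow> row_sum d (B k) i = row_sum d A i"
      "\<And>k n. n \<le> 2 * k \<Longrightarrow> trace_moment (H k) d (B k) n = trace_moment G d A n"
    by metis
  show "0 \<le> ln_det G d (matrix_op G d A)"
  proof (rule determinant_from_approximation[where H=H and D="\<lambda>_. d" and B=B and c="\<lambda>_. 1" and R="\<Sum>i<d. row_sum d A i"])
    show "row_sum d (B k) i \<le> (\<Sum>i<d. row_sum d A i)" if "i < d" for k i
      unfolding H(4)[OF that] by (rule member_le_sum) (use that in \<open>simp_all add: row_sum_nonneg\<close>)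
    show "(\<lambda>k. 1 * trace_moment (H k) d (B k) (2 * n)) \<longlonglongrightarrow> trace_moment G d A (2 * n)" for n
    proof (rule tendsto_eventually)
      show "\<forall>\<^sub>F k in sequentially. 1 * trace_moment (H k) d (B k) (2 * n) = trace_moment G d A (2 * n)"
        using eventually_ge_at_top[of n] by eventually_elim (simp add: H(5))
    qed
  qed (use A pos H in auto)
qed

definition support_union :: "nat \<Rightarrow> (nat \<Rightarrow> nat \<Rightarrow> 'a \<Rightarrow> int) \<Rightarrow> 'a set" where
  "support_union d A = (\<Union>i<d. \<Union>j<d. supp (A i j))"

lemma support_union:
  assumes A: "hermitian_matrix G d A"
  shows "finite (support_union d A)" "support_union d A \<subseteq> carrier G"
    "g \<in> support_union d A \<Longrightarrow> inv g \<in> support_union d A"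
    "i < d \<Longrightarrow> j < d \<Longrightarrow> supp (A i j) \<subseteq> support_union d A"
proof -
  show "finite (support_union d A)" "support_union d A \<subseteq> carrier G"
    unfolding support_union_def using finite_supp[OF A] supp_carrier[OF A] by auto
  show "inv g \<in> support_union d A" if g: "g \<in> support_union d A"
  proof -
    obtain i j where ij: "i < d" "j < d" "g \<in> supp (A i j)" using g by (auto simp: support_union_def)
    then have "A j i (inv g) = A i j g" using A supp_carrier[OF A ij] by (simp add: hermitian_matrix_def)
    then have "inv g \<in> supp (A j i)" using ij by (simp add: supp_def)
    then show ?thesis using ij by (auto simp: support_union_def)
  qed
qed (auto simp: support_union_def)

lemma semi_integral_if_residually:
  assumes res: "\<And>F. finite F \<Longrightarrow> F \<subseteq> carrier G \<Longrightarrow>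
    \<exists>(H :: ('c, 'n) monoid_scheme) \<psi>. group H \<and> semi_integral_determinant H \<and> \<psi> \<in> hom G H \<and>
      (\<forall>x\<in>F. \<psi> x = \<one>\<^bsub>H\<^esub> \<longrightarrow> x = \<one>)"
  shows "semi_integral_determinant G"
proof (rule semi_integral_if_moments_agree)
  fix d A N assume A: "hermitian_matrix G d A"
  define V where "V = support_union d A"
  note V = support_union[OF A, folded V_def]
  \<comment> \<open>The walks fix the moments; the quotients of support elements force injectivity
    on the support.\<close>
  define F where "F = (\<Union>m\<le>N. walk G V m) \<union> (\<lambda>(g, h). inv g \<otimes> h) ` (V \<times> V)"
  have "finite F" unfolding F_def using V(1) by (simp add: walk_finite)
  moreover have "F \<subseteq> carrier G" unfolding F_def using V(2) walk_carrier[OF V(2)] by auto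
  ultimately obtain H :: "('c, 'n) monoid_scheme" and \<psi> where
    H: "group H" "semi_integral_determinant H" "\<psi> \<in> hom G H" and triv: "\<And>x. x \<in> F \<Longrightarrow> \<psi> x = \<one>\<^bsub>H\<^esub> \<Longrightarrow> x = \<one>"
    using res by metis
  interpret H: group H by (rule H(1))
  interpret \<psi>: group_hom G H \<psi> using H(3) by unfold_locales
  have inj: "inj_on \<psi> V"
  proof (rule inj_onI)
    fix g h assume g: "g \<in> V" and h: "h \<in> V" and eq: "\<psi> g = \<psi> h"
    have c: "g \<in> carrier G" "h \<in> carrier G" using V(2) g h by auto
    have "\<psi> (inv g \<otimes> h) = \<one>\<^bsub>H\<^esub>" using c eq by simp
    moreover have "inv g \<otimes> h \<in> F" unfolding F_def using g h by force
    ultimately have "inv g \<otimes> h = \<one>" using triv by blast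
    then show "g = h" using c by (metis inv_equality inv_inv inv_closed)
  qed
  define B where "B i j h = (if h \<in> \<psi> ` V then A i j (inv_into V \<psi> h) else 0)" for i j h
  have B: "B i j (\<psi> g) = A i j g" if "g \<in> V" for i j g
    using that inj by (simp add: B_def)
  have tr: "support_transport d \<psi> V A B"
    unfolding support_transport_def using V inj B by (auto simp: supp_def B_def)
  have "hermitian_matrix H d B"
    unfolding hermitian_matrix_def
  proof (intro allI impI conjI ballI)
    fix i j assume ij: "i < d" "j < d"
    have "supp (B i j) \<subseteq> \<psi> ` V" by (auto simp: supp_def B_def)
    moreover have "\<psi> ` V \<subseteq> carrier H" using V(2) by auto
    ultimately show "B i j \<in> int_group_ring H"
      using V(1) finite_subset[of "supp (B i j)" "\<psi> ` V"] by (auto simp: int_group_ring_def supp_def)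
    fix h assume h: "h \<in> carrier H"
    show "B j i (inv\<^bsub>H\<^esub> h) = B i j h"
    proof (cases "h \<in> \<psi> ` V")
      case True
      then obtain g where g: "g \<in> V" "h = \<psi> g" by blast
      have gc: "g \<in> carrier G" using g V(2) by blast
      have "B j i (inv\<^bsub>H\<^esub> h) = B j i (\<psi> (inv g))" using g gc by simp
      also have "\<dots> = A j i (inv g)" using V(3) g by (intro B) auto
      also have "\<dots> = A i j g" using A ij gc by (simp add: hermitian_matrix_def)
      finally show ?thesis using B g by simp
    next
      case False
      have "inv\<^bsub>H\<^esub> h \<notin> \<psi> ` V"
      proof
        assume "inv\<^bsub>H\<^esub> h \<in> \<psi> ` V"
        then obtain g where g: "g \<in> V" "inv\<^bsub>H\<^esub> h = \<psi> g" by blast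
        then have "h = \<psi> (inv g)" using h V(2) by (metis H.inv_inv \<psi>.hom_inv subsetD)
        then show False using False V(3) g by blast
      qed
      then show ?thesis using False by (simp add: B_def)
    qed
  qed
  moreover have "\<forall>n\<le>N. trace_moment H d B n = trace_moment G d A n"
  proof (intro allI impI)
    fix n assume "n \<le> N"
    then have "walk G V n \<subseteq> F" by (auto simp: F_def)
    then show "trace_moment H d B n = trace_moment G d A n"
      using triv by (intro trace_moment_transport[OF is_group H(1) H(3) V(2) tr, symmetric]) auto
  qed
  ultimately show "\<exists>(H :: ('c, 'n) monoid_scheme) B. group H \<and> semi_integral_determinant H \<and> hermitian_matrix H d B \<and>
      (\<forall>i<d. row_sum d B i = row_sum d A i) \<and> (\<forall>n\<le>N. trace_moment H d B n = trace_moment G d A n)"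
    using H row_sum_transport[OF tr] by blast
qed

text \<open>Here the group is approximated by groups mapping to it; \<open>s\<close> lifts a finite symmetric set.\<close>

lemma semi_integral_if_locally:
  assumes loc: "\<And>W N. finite W \<Longrightarrow> W \<subseteq> carrier G \<Longrightarrow>
    \<exists>(H :: ('c, 'n) monoid_scheme) \<psi> s. group H \<and> semi_integral_determinant H \<and> \<psi> \<in> hom H G \<and>
      (\<forall>w\<in>W. s w \<in> carrier H \<and> \<psi> (s w) = w \<and> (inv w \<in> W \<longrightarrow> s (inv w) = inv\<^bsub>H\<^esub> (s w))) \<and>
      (\<forall>m\<le>N. \<forall>x\<in>walk H (s ` W) m. \<psi> x = \<one> \<longrightarrow> x = \<one>\<^bsub>H\<^esub>)"
  shows "semi_integral_determinant G"
proof (rule semi_integral_if_moments_agree)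
  fix d A and N :: nat assume A: "hermitian_matrix G d A"
  define W where "W = support_union d A"
  note W = support_union[OF A, folded W_def]
  obtain H :: "('c, 'n) monoid_scheme" and \<psi> s where
    H: "group H" "semi_integral_determinant H" "\<psi> \<in> hom H G"
    and s: "\<And>w. w \<in> W \<Longrightarrow> s w \<in> carrier H" "\<And>w. w \<in> W \<Longrightarrow> \<psi> (s w) = w"
      "\<And>w. w \<in> W \<Longrightarrow> s (inv w) = inv\<^bsub>H\<^esub> (s w)"
    and triv: "\<And>m x. m \<le> N \<Longrightarrow> x \<in> walk H (s ` W) m \<Longrightarrow> \<psi> x = \<one> \<Longrightarrow> x = \<one>\<^bsub>H\<^esub>"
    using loc[OF W(1,2), of N] W(3) by metis
  interpret H: group H by (rule H(1))
  define V where "V = s ` W"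
  \<comment> \<open>Pulled back from the quotient side but cut to the chosen lifts, so that the
    support is finite; compatibility of \<open>s\<close> with inverses makes it hermitian.\<close>
  define B where "B i j h = (if h \<in> V then A i j (\<psi> h) else 0)" for i j h
  have V: "finite V" "V \<subseteq> carrier H" using W(1) s(1) by (auto simp: V_def)
  have tr: "support_transport d \<psi> V B A"
    unfolding support_transport_def
  proof (intro conjI allI impI ballI)
    show "inj_on \<psi> V" by (rule inj_onI) (auto simp: V_def s(2))
    fix i j assume ij: "i < d" "j < d"
    show "supp (B i j) \<subseteq> V" by (auto simp: supp_def B_def)
    have "\<psi> ` V = W" using s(2) by (auto simp: V_def image_iff)
    then show "supp (A i j) \<subseteq> \<psi> ` V" using W(4)[OF ij] by simp
  qed (simp_all add: B_def V)
  have "hermitian_matrix H d B"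
    unfolding hermitian_matrix_def
  proof (intro allI impI conjI ballI)
    fix i j assume ij: "i < d" "j < d"
    have "supp (B i j) \<subseteq> V" by (auto simp: supp_def B_def)
    then show "B i j \<in> int_group_ring H"
      using V finite_subset[of "supp (B i j)" V] by (auto simp: int_group_ring_def supp_def)
    fix h assume h: "h \<in> carrier H"
    show "B j i (inv\<^bsub>H\<^esub> h) = B i j h"
    proof (cases "h \<in> V")
      case True
      then obtain w where w: "w \<in> W" "h = s w" by (auto simp: V_def)
      have iw: "inv w \<in> W" using W(3) w by blast
      have ih: "inv\<^bsub>H\<^esub> h = s (inv w)" using s(3) w by simp
      then have "B j i (inv\<^bsub>H\<^esub> h) = A j i (inv w)" using iw s(2)[OF iw] by (simp add: B_def V_def)
      also have "\<dots> = A i j w" using A ij w W(2) by (auto simp: hermitian_matrix_def)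
      finally show ?thesis using True w s(2) by (simp add: B_def)
    next
      case False
      have "inv\<^bsub>H\<^esub> h \<notin> V"
      proof
        assume "inv\<^bsub>H\<^esub> h \<in> V"
        then obtain w where w: "w \<in> W" "inv\<^bsub>H\<^esub> h = s w" by (auto simp: V_def)
        then have "h = s (inv w)" using s(3) h by (metis H.inv_inv)
        then show False using False W(3) w by (auto simp: V_def)
      qed
      then show ?thesis using False by (simp add: B_def)
    qed
  qed
  moreover have "\<forall>n\<le>N. trace_moment H d B n = trace_moment G d A n"
    using triv by (auto intro!: trace_moment_transport[OF H(1) is_group H(3) V(2) tr] simp: V_def)
  ultimately show "\<exists>(H :: ('c, 'n) monoid_scheme) B. group H \<and> semi_integral_determinant H \<and> hermitian_matrix H d B \<and>
      (\<forall>i<d. row_sum d B i = row_sum d A i) \<and> (\<forall>n\<le>N. trace_moment H d B n = trace_moment G d A n)"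
    using H row_sum_transport[OF tr] by metis
qed

end

text \<open>The inclusion is injective, so the ambient group itself serves for every finite
  set.\<close>

lemma semi_integral_subgroup:
  fixes G :: "('a, 'm) monoid_scheme"
  assumes G: "group G" and H: "subgroup H G" and sid: "semi_integral_determinant G"
  shows "semi_integral_determinant (G\<lparr>carrier := H\<rparr>)"
proof (rule group.semi_integral_if_residually)
  show "group (G\<lparr>carrier := H\<rparr>)" by (rule subgroup.subgroup_is_group[OF H G])
  fix F assume "finite F" "F \<subseteq> carrier (G\<lparr>carrier := H\<rparr>)"
  have "(\<lambda>x. x) \<in> hom (G\<lparr>carrier := H\<rparr>) G"
    using subgroup.mem_carrier[OF H] by (auto simp: hom_def)
  then show "\<exists>(K :: ('a, 'm) monoid_scheme) \<psi>. group K \<and> semi_integral_determinant K \<and> \<psi> \<in> hom (G\<lparr>carrier := H\<rparr>) K \<and>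
      (\<forall>x\<in>F. \<psi> x = \<one>\<^bsub>K\<^esub> \<longrightarrow> x = \<one>\<^bsub>G\<lparr>carrier := H\<rparr>\<^esub>)"
    using G sid by (intro exI[of _ G] exI[of _ "\<lambda>x. x"]) auto
qed

section \<open>Limits over directed index sets\<close>

lemma directed_finite_bound:
  assumes dir: "directed_index I r" and J: "finite J" "J \<subseteq> I"
  shows "\<exists>k\<in>I. \<forall>j\<in>J. (j, k) \<in> r"
  using J
proof (induction J)
  case empty
  then show ?case using dir by (auto simp: directed_index_def)
next
  case (insert j J)
  then obtain k where k: "k \<in> I" "\<forall>j\<in>J. (j, k) \<in> r" by auto
  moreover have "j \<in> I" using insert by simp
  ultimately obtain l where l: "l \<in> I" "(j, l) \<in> r" "(k, l) \<in> r"
    using dir unfolding directed_index_def by blast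
  have "trans r" using dir by (simp add: directed_index_def preorder_on_def)
  then have "(j', l) \<in> r" if "j' \<in> J" for j' using k(2) l(3) that by (blast dest: transD)
  then show ?case using l by blast
qed

lemma directed_indexD:
  assumes "directed_index I r"
  shows "i \<in> I \<Longrightarrow> (i, i) \<in> r" "(i, j) \<in> r \<Longrightarrow> (j, k) \<in> r \<Longrightarrow> (i, k) \<in> r"
    "(i, j) \<in> r \<Longrightarrow> i \<in> I" "(i, j) \<in> r \<Longrightarrow> j \<in> I"
proof -
  have p: "refl_on I r" "trans r" "r \<subseteq> I \<times> I"
    using assms by (auto simp: directed_index_def preorder_on_def)
  show "i \<in> I \<Longrightarrow> (i, i) \<in> r" "(i, j) \<in> r \<Longrightarrow> (j, k) \<in> r \<Longrightarrow> (i, k) \<in> r"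
    "(i, j) \<in> r \<Longrightarrow> i \<in> I" "(i, j) \<in> r \<Longrightarrow> j \<in> I"
    using p by (auto dest: refl_onD transD)
qed

text \<open>A nontrivial element is detected by some coordinate, hence by every later one;
  directedness finds one coordinate for a finite set.\<close>

lemma semi_integral_inverse_limit:
  fixes G :: "'i \<Rightarrow> 'a monoid" and \<pi> :: "'b monoid"
  assumes sys: "inverse_system I r G \<phi>" and sid: "\<And>i. i \<in> I \<Longrightarrow> semi_integral_determinant (G i)"
    and \<pi>: "group \<pi>" and iso: "\<pi> \<cong> inverse_limit I r G \<phi>"
  shows "semi_integral_determinant \<pi>"
proof (rule group.semi_integral_if_residually[OF \<pi>])
  have dir: "directed_index I r" and G: "\<And>i. i \<in> I \<Longrightarrow> group (G i)"
    and \<phi>: "\<And>i j. (i, j) \<in> r \<Longrightarrow> \<phi> i j \<in> hom (G j) (G i)"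
    using sys by (auto simp: inverse_system_def)
  interpret \<pi>: group \<pi> by (rule \<pi>)
  obtain f where f: "f \<in> hom \<pi> (inverse_limit I r G \<phi>)" "bij_betw f (carrier \<pi>) (carrier (inverse_limit I r G \<phi>))"
    using iso by (auto simp: is_iso_def iso_def)
  have fE: "f x \<in> (\<Pi>\<^sub>E i\<in>I. carrier (G i))" "\<And>i j. (i, j) \<in> r \<Longrightarrow> \<phi> i j (f x j) = f x i" if "x \<in> carrier \<pi>" for x
    using hom_in_carrier[OF f(1) that] by (auto simp: inverse_limit_def)
  have hom: "(\<lambda>x. f x i) \<in> hom \<pi> (G i)" if i: "i \<in> I" for i
  proof (rule homI)
    show "f x i \<in> carrier (G i)" if "x \<in> carrier \<pi>" for x using fE(1)[OF that] i by auto
    show "f (x \<otimes>\<^bsub>\<pi>\<^esub> y) i = f x i \<otimes>\<^bsub>G i\<^esub> f y i" if "x \<in> carrier \<pi>" "y \<in> carrier \<pi>" for x y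
      using hom_mult[OF f(1) that] i by (simp add: inverse_limit_def)
  qed
  have one: "f \<one>\<^bsub>\<pi>\<^esub> i = \<one>\<^bsub>G i\<^esub>" if "i \<in> I" for i
    using hom_one[OF hom[OF that] \<pi> G[OF that]] .
  have sep: "x = \<one>\<^bsub>\<pi>\<^esub>" if x: "x \<in> carrier \<pi>" and x1: "\<And>i. i \<in> I \<Longrightarrow> f x i = \<one>\<^bsub>G i\<^esub>" for x
  proof -
    have "f x = f \<one>\<^bsub>\<pi>\<^esub>"
      using fE(1)[OF x] fE(1)[OF \<pi>.one_closed] x1 one by (intro PiE_ext[of _ I "\<lambda>i. carrier (G i)"]) auto
    then show ?thesis using f(2) x \<pi>.one_closed by (auto simp: bij_betw_def dest: inj_onD)
  qed
  fix F assume F: "finite F" "F \<subseteq> carrier \<pi>"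
  \<comment> \<open>With the implication inside, an index exists for the unit as well, as the index
    set is nonempty.\<close>
  have "\<forall>x\<in>F. \<exists>i\<in>I. f x i = \<one>\<^bsub>G i\<^esub> \<longrightarrow> x = \<one>\<^bsub>\<pi>\<^esub>"
    using sep F dir by (metis (no_types, lifting) directed_index_def ex_in_conv subsetD)
  then obtain ix where ix: "\<And>x. x \<in> F \<Longrightarrow> ix x \<in> I" "\<And>x. x \<in> F \<Longrightarrow> f x (ix x) = \<one>\<^bsub>G (ix x)\<^esub> \<Longrightarrow> x = \<one>\<^bsub>\<pi>\<^esub>"
    by metis
  obtain k where k: "k \<in> I" "\<And>x. x \<in> F \<Longrightarrow> (ix x, k) \<in> r"
    using directed_finite_bound[OF dir, of "ix ` F"] F(1) ix(1) by auto
  have "x = \<one>\<^bsub>\<pi>\<^esub>" if x: "x \<in> F" and x1: "f x k = \<one>\<^bsub>G k\<^esub>" for x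
  proof -
    have "f x (ix x) = \<phi> (ix x) k (f x k)" using fE(2)[OF _ k(2)[OF x]] F(2) x by auto
    also have "\<dots> = \<one>\<^bsub>G (ix x)\<^esub>"
      using hom_one[OF \<phi>[OF k(2)[OF x]] G[OF k(1)] G[OF ix(1)[OF x]]] x1 by simp
    finally show ?thesis using ix(2) x by blast
  qed
  then show "\<exists>(H :: 'a monoid) \<psi>. group H \<and> semi_integral_determinant H \<and> \<psi> \<in> hom \<pi> H \<and>
      (\<forall>x\<in>F. \<psi> x = \<one>\<^bsub>H\<^esub> \<longrightarrow> x = \<one>\<^bsub>\<pi>\<^esub>)"
    using G[OF k(1)] sid[OF k(1)] hom[OF k(1)] by blast
qed

lemma walk_hom_image:
  assumes G: "group G" and H: "group H" and \<phi>: "\<phi> \<in> hom G H" and V: "V \<subseteq> carrier G"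
  shows "walk H (\<phi> ` V) m = \<phi> ` walk G V m"
proof (induction m)
  case 0
  show ?case using hom_one[OF \<phi> G H] by simp
next
  case (Suc m)
  interpret group_hom G H \<phi> using G H \<phi> by (simp add: group_hom_def group_hom_axioms_def)
  have "inv\<^bsub>H\<^esub> (\<phi> g) \<otimes>\<^bsub>H\<^esub> \<phi> x = \<phi> (inv\<^bsub>G\<^esub> g \<otimes>\<^bsub>G\<^esub> x)" if "g \<in> V" "x \<in> walk G V m" for g x
    using that V G.walk_carrier[OF V, of m] by (auto simp: subset_iff)
  then show ?case unfolding walk.simps Suc by (force simp: image_iff)
qed

text \<open>Two indices are needed: at \<open>i\<close> the finite set has lifts, but products of
  lifts that are trivial in the limit may be nontrivial there; at the later \<open>j\<close> these
  finitely many products have become trivial. This copes with structure maps that are not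
  injective.\<close>

lemma semi_integral_directed_union:
  fixes G :: "'i \<Rightarrow> 'a monoid" and \<pi> :: "'b monoid"
  assumes sys: "direct_system I r G \<phi>" and sid: "\<And>i. i \<in> I \<Longrightarrow> semi_integral_determinant (G i)"
    and \<pi>: "group \<pi>"
    and \<psi>: "\<And>i. i \<in> I \<Longrightarrow> \<psi> i \<in> hom (G i) \<pi>"
    and compat: "\<And>i j x. (i, j) \<in> r \<Longrightarrow> x \<in> carrier (G i) \<Longrightarrow> \<psi> j (\<phi> i j x) = \<psi> i x"
    and surj: "\<And>y. y \<in> carrier \<pi> \<Longrightarrow> \<exists>i\<in>I. \<exists>x\<in>carrier (G i). \<psi> i x = y"
    and ker: "\<And>i x. i \<in> I \<Longrightarrow> x \<in> carrier (G i) \<Longrightarrow> \<psi> i x = \<one>\<^bsub>\<pi>\<^esub> \<Longrightarrow> \<exists>j. (i, j) \<in> r \<and> \<phi> i j x = \<one>\<^bsub>G j\<^esub>"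
  shows "semi_integral_determinant \<pi>"
proof (rule group.semi_integral_if_locally[OF \<pi>])
  have dir: "directed_index I r" and G: "\<And>i. i \<in> I \<Longrightarrow> group (G i)"
    and \<phi>: "\<And>i j. (i, j) \<in> r \<Longrightarrow> \<phi> i j \<in> hom (G i) (G j)"
    and \<phi>2: "\<And>i j k x. (i, j) \<in> r \<Longrightarrow> (j, k) \<in> r \<Longrightarrow> x \<in> carrier (G i) \<Longrightarrow> \<phi> j k (\<phi> i j x) = \<phi> i k x"
    using sys by (auto simp: direct_system_def)
  note D = directed_indexD[OF dir]
  interpret \<pi>: group \<pi> by (rule \<pi>)
  fix W and N :: nat assume W: "finite W" "W \<subseteq> carrier \<pi>"
  have "\<forall>w\<in>W. \<exists>i x. i \<in> I \<and> x \<in> carrier (G i) \<and> \<psi> i x = w" using surj W(2) by blast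
  then obtain iw xw where w: "\<And>w. w \<in> W \<Longrightarrow> iw w \<in> I" "\<And>w. w \<in> W \<Longrightarrow> xw w \<in> carrier (G (iw w))"
    "\<And>w. w \<in> W \<Longrightarrow> \<psi> (iw w) (xw w) = w" by metis
  obtain i where i: "i \<in> I" "\<And>w. w \<in> W \<Longrightarrow> (iw w, i) \<in> r"
    using directed_finite_bound[OF dir, of "iw ` W"] W(1) w(1) by auto
  define s where "s w = \<phi> (iw w) i (xw w)" for w
  have s: "s w \<in> carrier (G i)" "\<psi> i (s w) = w" if "w \<in> W" for w
    using hom_in_carrier[OF \<phi>[OF i(2)[OF that]] w(2)[OF that]] compat[OF i(2)[OF that] w(2)[OF that]] w(3)[OF that]
    by (auto simp: s_def)
  interpret Gi: group "G i" by (rule G[OF i(1)])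
  have sW: "s ` W \<subseteq> carrier (G i)" using s by auto
  \<comment> \<open>All products whose triviality matters: the walks for the moments, and the
    products of two lifts so that lifts of inverses become inverse at \<open>j\<close>.\<close>
  define X where "X = (\<Union>m\<le>N. walk (G i) (s ` W) m) \<union> (\<lambda>(v, w). s v \<otimes>\<^bsub>G i\<^esub> s w) ` (W \<times> W)"
  have X: "finite X" "X \<subseteq> carrier (G i)"
    unfolding X_def using W(1) walk_finite[of "s ` W"] Gi.walk_carrier[OF sW] s by auto
  have "\<forall>x\<in>X. \<exists>j. (i, j) \<in> r \<and> (\<psi> i x = \<one>\<^bsub>\<pi>\<^esub> \<longrightarrow> \<phi> i j x = \<one>\<^bsub>G j\<^esub>)"
    using ker[OF i(1)] X(2) D(1)[OF i(1)] by blast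
  then obtain jx where jx: "\<And>x. x \<in> X \<Longrightarrow> (i, jx x) \<in> r"
    "\<And>x. x \<in> X \<Longrightarrow> \<psi> i x = \<one>\<^bsub>\<pi>\<^esub> \<Longrightarrow> \<phi> i (jx x) x = \<one>\<^bsub>G (jx x)\<^esub>" by metis
  obtain j where j: "j \<in> I" "(i, j) \<in> r" "\<And>x. x \<in> X \<Longrightarrow> (jx x, j) \<in> r"
    using directed_finite_bound[OF dir, of "insert i (jx ` X)"] X(1) i(1) D(4)[OF jx(1)] by auto
  interpret Gj: group "G j" by (rule G[OF j(1)])
  have kill: "\<phi> i j x = \<one>\<^bsub>G j\<^esub>" if x: "x \<in> X" and x1: "\<psi> i x = \<one>\<^bsub>\<pi>\<^esub>" for x
  proof -
    have "\<phi> i j x = \<phi> (jx x) j (\<phi> i (jx x) x)"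
      using \<phi>2[OF jx(1)[OF x] j(3)[OF x]] X(2) x by auto
    then show ?thesis
      using jx(2)[OF x x1] hom_one[OF \<phi>[OF j(3)[OF x]] G[OF D(3)[OF j(3)[OF x]]] G[OF j(1)]] by simp
  qed
  let ?s = "\<lambda>w. \<phi> i j (s w)"
  have s': "?s w \<in> carrier (G j)" "\<psi> j (?s w) = w" if "w \<in> W" for w
    using s[OF that] hom_in_carrier[OF \<phi>[OF j(2)]] compat[OF j(2)] by auto
  have inv: "?s (inv\<^bsub>\<pi>\<^esub> w) = inv\<^bsub>G j\<^esub> (?s w)" if w: "w \<in> W" "inv\<^bsub>\<pi>\<^esub> w \<in> W" for w
  proof -
    have "\<psi> i (s w \<otimes>\<^bsub>G i\<^esub> s (inv\<^bsub>\<pi>\<^esub> w)) = \<one>\<^bsub>\<pi>\<^esub>"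
      using hom_mult[OF \<psi>[OF i(1)] s(1)[OF w(1)] s(1)[OF w(2)]] s(2) w W(2) by auto
    moreover have "s w \<otimes>\<^bsub>G i\<^esub> s (inv\<^bsub>\<pi>\<^esub> w) \<in> X" unfolding X_def using w by force
    ultimately have "?s w \<otimes>\<^bsub>G j\<^esub> ?s (inv\<^bsub>\<pi>\<^esub> w) = \<one>\<^bsub>G j\<^esub>"
      using kill hom_mult[OF \<phi>[OF j(2)] s(1)[OF w(1)] s(1)[OF w(2)]] by simp
    then show ?thesis using s'(1) w by (metis Gj.inv_equality Gj.inv_inv Gj.inv_closed)
  qed
  have triv: "x = \<one>\<^bsub>G j\<^esub>" if m: "m \<le> N" "x \<in> walk (G j) (?s ` W) m" "\<psi> j x = \<one>\<^bsub>\<pi>\<^esub>" for m x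
  proof -
    have "?s ` W = \<phi> i j ` s ` W" by auto
    then obtain y where y: "y \<in> walk (G i) (s ` W) m" "x = \<phi> i j y"
      using m(2) walk_hom_image[OF G[OF i(1)] G[OF j(1)] \<phi>[OF j(2)] sW] by auto
    then have "y \<in> X" using m(1) by (auto simp: X_def)
    moreover from this have "\<psi> i y = \<one>\<^bsub>\<pi>\<^esub>" using compat[OF j(2), of y] X(2) y(2) m(3) by auto
    ultimately show ?thesis using kill y(2) by blast
  qed
  show "\<exists>(H :: 'a monoid) \<psi> s. group H \<and> semi_integral_determinant H \<and> \<psi> \<in> hom H \<pi> \<and>
      (\<forall>w\<in>W. s w \<in> carrier H \<and> \<psi> (s w) = w \<and> (inv\<^bsub>\<pi>\<^esub> w \<in> W \<longrightarrow> s (inv\<^bsub>\<pi>\<^esub> w) = inv\<^bsub>H\<^esub> (s w))) \<and>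
      (\<forall>m\<le>N. \<forall>x\<in>walk H (s ` W) m. \<psi> x = \<one>\<^bsub>\<pi>\<^esub> \<longrightarrow> x = \<one>\<^bsub>H\<^esub>)"
    using G[OF j(1)] sid[OF j(1)] \<psi>[OF j(1)] s' inv triv
    by (intro exI[of _ "G j"] exI[of _ "\<psi> j"] exI[of _ ?s]) blast
qed

text \<open>Extracts from the quotient construction what the previous lemma uses: compatible maps
  that are jointly surjective and whose kernels die at a later index.\<close>

lemma semi_integral_direct_limit:
  fixes G :: "'i \<Rightarrow> 'a monoid" and \<pi> :: "'b monoid"
  assumes sys: "direct_system I r G \<phi>" and sid: "\<And>i. i \<in> I \<Longrightarrow> semi_integral_determinant (G i)"
    and \<pi>: "group \<pi>" and iso: "\<pi> \<cong> direct_limit I r G \<phi>"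
  shows "semi_integral_determinant \<pi>"
proof -
  let ?L = "direct_limit I r G \<phi>" and ?R = "direct_limit_rel I r G \<phi>"
  have dir: "directed_index I r" and G: "\<And>i. i \<in> I \<Longrightarrow> group (G i)"
    and \<phi>: "\<And>i j. (i, j) \<in> r \<Longrightarrow> \<phi> i j \<in> hom (G i) (G j)"
    and \<phi>1: "\<And>i x. i \<in> I \<Longrightarrow> x \<in> carrier (G i) \<Longrightarrow> \<phi> i i x = x"
    and \<phi>2: "\<And>i j k x. (i, j) \<in> r \<Longrightarrow> (j, k) \<in> r \<Longrightarrow> x \<in> carrier (G i) \<Longrightarrow> \<phi> j k (\<phi> i j x) = \<phi> i k x"
    using sys by (auto simp: direct_system_def)
  note D = directed_indexD[OF dir]
  interpret \<pi>: group \<pi> by (rule \<pi>)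
  have R_iff: "((i, x), (j, y)) \<in> ?R \<longleftrightarrow> i \<in> I \<and> x \<in> carrier (G i) \<and> j \<in> I \<and> y \<in> carrier (G j) \<and>
      (\<exists>k. (i, k) \<in> r \<and> (j, k) \<in> r \<and> \<phi> i k x = \<phi> j k y)" for i x j y
    by (auto simp: direct_limit_rel_def)
  have later: "\<phi> i m x = \<phi> j m y" if "(i, k) \<in> r" "(j, k) \<in> r" "\<phi> i k x = \<phi> j k y" "(k, m) \<in> r"
      "x \<in> carrier (G i)" "y \<in> carrier (G j)" for i j k m x y
    using \<phi>2[OF that(1,4,5)] \<phi>2[OF that(2,4,6)] that(3) by simp
  have equiv: "equiv (SIGMA i:I. carrier (G i)) ?R"
  proof (rule equivI)
    show "?R \<subseteq> (SIGMA i:I. carrier (G i)) \<times> (SIGMA i:I. carrier (G i))"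
      by (auto simp: direct_limit_rel_def)
    show "refl_on (SIGMA i:I. carrier (G i)) ?R"
    proof (rule refl_onI, clarify)
      fix i x assume "i \<in> I" "x \<in> carrier (G i)"
      then show "((i, x), (i, x)) \<in> ?R" using D(1)[of i] by (auto simp: R_iff)
    qed
    show "sym ?R"
    proof (rule symI, clarify)
      fix i x j y assume "((i, x), (j, y)) \<in> ?R"
      then show "((j, y), (i, x)) \<in> ?R" unfolding R_iff by metis
    qed
    show "trans ?R"
    proof (rule transI, clarify)
      fix i x j y k z assume a: "((i, x), (j, y)) \<in> ?R" "((j, y), (k, z)) \<in> ?R"
      then obtain l l' where l: "(i, l) \<in> r" "(j, l) \<in> r" "\<phi> i l x = \<phi> j l y"
        and l': "(j, l') \<in> r" "(k, l') \<in> r" "\<phi> j l' y = \<phi> k l' z" unfolding R_iff by blast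
      obtain m where m: "(l, m) \<in> r" "(l', m) \<in> r"
        using directed_finite_bound[OF dir, of "{l, l'}"] D(4)[OF l(1)] D(4)[OF l'(1)] by auto
      have "\<phi> i m x = \<phi> j m y" using a by (intro later[OF l m(1)]) (auto simp: R_iff)
      also have "\<dots> = \<phi> k m z" using a by (intro later[OF l' m(2)]) (auto simp: R_iff)
      finally show "((i, x), (k, z)) \<in> ?R" using a D(2)[OF l(1) m(1)] D(2)[OF l'(2) m(2)] by (auto simp: R_iff)
    qed
  qed
  define cls where "cls i x = ?R `` {(i, x)}" for i x
  have cls_eq: "cls i x = cls j y \<longleftrightarrow> ((i, x), (j, y)) \<in> ?R"
    if "i \<in> I" "x \<in> carrier (G i)" "j \<in> I" "y \<in> carrier (G j)" for i x j y
    unfolding cls_def using eq_equiv_class_iff[OF equiv] that by simp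
  have carr: "carrier ?L = {cls i x | i x. i \<in> I \<and> x \<in> carrier (G i)}"
    by (auto simp: direct_limit_def quotient_def cls_def)
  have mult: "cls i x \<otimes>\<^bsub>?L\<^esub> cls i y = cls i (x \<otimes>\<^bsub>G i\<^esub> y)"
    if i: "i \<in> I" and x: "x \<in> carrier (G i)" and y: "y \<in> carrier (G i)" for i x y
  proof -
    \<comment> \<open>Every member of the union defining the product is the same class: a common
      upper bound of the three indices makes the representatives agree.\<close>
    have each: "cls k (\<phi> i' k x' \<otimes>\<^bsub>G k\<^esub> \<phi> j' k y') = cls i (x \<otimes>\<^bsub>G i\<^esub> y)"
      if "(i', x') \<in> cls i x" "(j', y') \<in> cls i y" and k: "(i', k) \<in> r" "(j', k) \<in> r" for i' x' j' y' k
    proof -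
      have a: "((i, x), (i', x')) \<in> ?R" "((i, y), (j', y')) \<in> ?R" using that by (auto simp: cls_def)
      then have c: "x' \<in> carrier (G i')" "y' \<in> carrier (G j')" by (auto simp: R_iff)
      obtain l l' where l: "(i, l) \<in> r" "(i', l) \<in> r" "\<phi> i l x = \<phi> i' l x'"
        and l': "(i, l') \<in> r" "(j', l') \<in> r" "\<phi> i l' y = \<phi> j' l' y'"
        using a unfolding R_iff by blast
      obtain m where m: "(l, m) \<in> r" "(l', m) \<in> r" "(k, m) \<in> r"
        using directed_finite_bound[OF dir, of "{l, l', k}"] D(4)[OF l(1)] D(4)[OF l'(1)] D(4)[OF k(1)] by auto
      have im: "(i, m) \<in> r" using D(2)[OF l(1) m(1)] .
      have kI: "k \<in> I" using D(4)[OF k(1)] .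
      interpret Gk: group "G k" by (rule G[OF kI])
      interpret Gi: group "G i" by (rule G[OF i])
      have ck: "\<phi> i' k x' \<in> carrier (G k)" "\<phi> j' k y' \<in> carrier (G k)"
        using hom_in_carrier[OF \<phi>[OF k(1)] c(1)] hom_in_carrier[OF \<phi>[OF k(2)] c(2)] by auto
      have "\<phi> k m (\<phi> i' k x' \<otimes>\<^bsub>G k\<^esub> \<phi> j' k y') = \<phi> i' m x' \<otimes>\<^bsub>G m\<^esub> \<phi> j' m y'"
        using hom_mult[OF \<phi>[OF m(3)] ck] \<phi>2[OF k(1) m(3) c(1)] \<phi>2[OF k(2) m(3) c(2)] by simp
      also have "\<dots> = \<phi> i m x \<otimes>\<^bsub>G m\<^esub> \<phi> i m y"
        using later[OF l m(1) x c(1)] later[OF l' m(2) y c(2)] by simp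
      also have "\<dots> = \<phi> i m (x \<otimes>\<^bsub>G i\<^esub> y)" using hom_mult[OF \<phi>[OF im] x y] by simp
      finally show ?thesis
        using i x y kI ck m(3) im by (subst cls_eq) (auto simp: R_iff)
    qed
    have self: "(i, x) \<in> cls i x" "(i, y) \<in> cls i y" "(i, i) \<in> r"
      using i x y D(1)[OF i] by (auto simp: cls_def R_iff)
    have "cls i x \<otimes>\<^bsub>?L\<^esub> cls i y = (\<Union>(i', x')\<in>cls i x. \<Union>(j', y')\<in>cls i y.
        \<Union>k\<in>{k. (i', k) \<in> r \<and> (j', k) \<in> r}. cls k (\<phi> i' k x' \<otimes>\<^bsub>G k\<^esub> \<phi> j' k y'))"
      by (simp add: direct_limit_def cls_def)
    also have "\<dots> = cls i (x \<otimes>\<^bsub>G i\<^esub> y)"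
    proof (intro equalityI subsetI)
      fix z assume "z \<in> (\<Union>(i', x')\<in>cls i x. \<Union>(j', y')\<in>cls i y.
        \<Union>k\<in>{k. (i', k) \<in> r \<and> (j', k) \<in> r}. cls k (\<phi> i' k x' \<otimes>\<^bsub>G k\<^esub> \<phi> j' k y'))"
      then obtain i' x' j' y' k where "(i', x') \<in> cls i x" "(j', y') \<in> cls i y" "(i', k) \<in> r" "(j', k) \<in> r"
        "z \<in> cls k (\<phi> i' k x' \<otimes>\<^bsub>G k\<^esub> \<phi> j' k y')" by auto
      then show "z \<in> cls i (x \<otimes>\<^bsub>G i\<^esub> y)" using each by blast
    next
      fix z assume "z \<in> cls i (x \<otimes>\<^bsub>G i\<^esub> y)"
      then have "z \<in> cls i (\<phi> i i x \<otimes>\<^bsub>G i\<^esub> \<phi> i i y)" using each[OF self(1,2) self(3) self(3)] by simp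
      then show "z \<in> (\<Union>(i', x')\<in>cls i x. \<Union>(j', y')\<in>cls i y.
        \<Union>k\<in>{k. (i', k) \<in> r \<and> (j', k) \<in> r}. cls k (\<phi> i' k x' \<otimes>\<^bsub>G k\<^esub> \<phi> j' k y'))"
        using self by (intro UN_I[of "(i, x)"] UN_I[of "(i, y)"]) auto
    qed
    finally show ?thesis .
  qed
  obtain f where f: "f \<in> hom \<pi> ?L" "bij_betw f (carrier \<pi>) (carrier ?L)"
    using iso by (auto simp: is_iso_def iso_def)
  define \<psi> where "\<psi> i x = inv_into (carrier \<pi>) f (cls i x)" for i x
  have \<psi>: "\<psi> i x \<in> carrier \<pi>" "f (\<psi> i x) = cls i x" if "i \<in> I" "x \<in> carrier (G i)" for i x
  proof -
    have "cls i x \<in> f ` carrier \<pi>" using that carr f(2) by (auto simp: bij_betw_def)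
    from inv_into_into[OF this] f_inv_into_f[OF this]
    show "\<psi> i x \<in> carrier \<pi>" "f (\<psi> i x) = cls i x"
      unfolding \<psi>_def .
  qed
  have finj: "a = b" if "f a = f b" "a \<in> carrier \<pi>" "b \<in> carrier \<pi>" for a b
    using f(2) that by (auto simp: bij_betw_def dest: inj_onD)
  have \<psi>_hom: "\<psi> i \<in> hom (G i) \<pi>" if i: "i \<in> I" for i
  proof (rule homI)
    interpret Gi: group "G i" by (rule G[OF i])
    fix x y assume xy: "x \<in> carrier (G i)" "y \<in> carrier (G i)"
    have "f (\<psi> i x \<otimes>\<^bsub>\<pi>\<^esub> \<psi> i y) = cls i (x \<otimes>\<^bsub>G i\<^esub> y)"
      using hom_mult[OF f(1) \<psi>(1)[OF i xy(1)] \<psi>(1)[OF i xy(2)]] \<psi>(2) i xy mult by simp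
    then show "\<psi> i (x \<otimes>\<^bsub>G i\<^esub> y) = \<psi> i x \<otimes>\<^bsub>\<pi>\<^esub> \<psi> i y"
      using \<psi> i xy by (intro finj) auto
  qed (use \<psi> i in auto)
  have \<psi>_eq: "\<psi> i x = \<psi> j y \<longleftrightarrow> ((i, x), (j, y)) \<in> ?R"
    if "i \<in> I" "x \<in> carrier (G i)" "j \<in> I" "y \<in> carrier (G j)" for i x j y
    using cls_eq[OF that] \<psi>(2)[OF that(1,2)] \<psi>(2)[OF that(3,4)] by (metis \<psi>_def)
  show ?thesis
  proof (rule semi_integral_directed_union[OF sys sid \<pi> \<psi>_hom])
    show "\<psi> j (\<phi> i j x) = \<psi> i x" if ij: "(i, j) \<in> r" and x: "x \<in> carrier (G i)" for i j x
    proof -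
      have c: "\<phi> i j x \<in> carrier (G j)" using hom_in_carrier[OF \<phi>[OF ij] x] .
      have "\<phi> j j (\<phi> i j x) = \<phi> i j x" using \<phi>1[OF D(4)[OF ij] c] .
      then show ?thesis
        using ij x c D(3)[OF ij] D(4)[OF ij] D(1)[OF D(4)[OF ij]] by (subst \<psi>_eq) (auto simp: R_iff)
    qed
    show "\<exists>i\<in>I. \<exists>x\<in>carrier (G i). \<psi> i x = y" if y: "y \<in> carrier \<pi>" for y
    proof -
      have "f y \<in> carrier ?L" using hom_in_carrier[OF f(1) y] .
      then obtain i x where ix: "i \<in> I" "x \<in> carrier (G i)" "f y = cls i x" using carr by auto
      then have "\<psi> i x = y" using \<psi>[OF ix(1,2)] y by (intro finj) auto
      then show ?thesis using ix by blast
    qed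
    show "\<exists>j. (i, j) \<in> r \<and> \<phi> i j x = \<one>\<^bsub>G j\<^esub>" if i: "i \<in> I" and x: "x \<in> carrier (G i)" and e: "\<psi> i x = \<one>\<^bsub>\<pi>\<^esub>" for i x
    proof -
      interpret Gi: group "G i" by (rule G[OF i])
      have "\<psi> i x = \<psi> i \<one>\<^bsub>G i\<^esub>" using e hom_one[OF \<psi>_hom[OF i] G[OF i] \<pi>] by simp
      then obtain k where k: "(i, k) \<in> r" "\<phi> i k x = \<phi> i k \<one>\<^bsub>G i\<^esub>"
        using \<psi>_eq[OF i x i Gi.one_closed] by (auto simp: R_iff)
      then show ?thesis using hom_one[OF \<phi>[OF k(1)] G[OF i] G[OF D(4)[OF k(1)]]] by auto
    qed
  qed
qed

section \<open>Amenable extensions\<close>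

text \<open>In the coordinates \<open>x = \<tau>\<^sub>m\<^sup>-\<^sup>1 u\<close> with \<open>u \<in> U\<close>, the block \<open>(m, n)\<close> of left multiplication
  by \<open>A\<close> is left multiplication by \<open>w \<mapsto> A (\<tau>\<^sub>m\<^sup>-\<^sup>1 w \<tau>\<^sub>n)\<close>. The inverses matter: a step by \<open>g\<close>
  moves the coset \<open>\<tau>\<^sub>m U\<close> to \<open>\<tau>\<^sub>m g U\<close>, whose distance does not depend on \<open>m\<close> for a left invariant
  metric.\<close>

definition section_matrix ::
  "('a, 'm) monoid_scheme \<Rightarrow> 'a set \<Rightarrow> (nat \<Rightarrow> nat \<Rightarrow> 'a \<Rightarrow> int) \<Rightarrow> (nat \<Rightarrow> nat) \<Rightarrow> (nat \<Rightarrow> 'a) \<Rightarrow>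
    nat \<Rightarrow> nat \<Rightarrow> 'a \<Rightarrow> int" where
  "section_matrix G U A ix \<tau> m n w =
     (if w \<in> U then A (ix m) (ix n) (inv\<^bsub>G\<^esub> (\<tau> m) \<otimes>\<^bsub>G\<^esub> w \<otimes>\<^bsub>G\<^esub> \<tau> n) else 0)"

context group
begin

lemma cancel_left [simp]:
  "x \<in> carrier G \<Longrightarrow> y \<in> carrier G \<Longrightarrow> inv x \<otimes> (x \<otimes> y) = y"
  "x \<in> carrier G \<Longrightarrow> y \<in> carrier G \<Longrightarrow> x \<otimes> (inv x \<otimes> y) = y"
  by (simp_all add: m_assoc[symmetric])

text \<open>An index \<open>m < D\<close> stands for a row \<open>ix m\<close> of the matrix
  together with the coset of \<open>\<tau> m\<close>; the separation hypothesis says that different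
  indices give different pairs.\<close>

context
  fixes U d A and D :: nat and ix :: "nat \<Rightarrow> nat" and \<tau> :: "nat \<Rightarrow> 'a"
  assumes U: "U \<lhd> G" and A: "hermitian_matrix G d A"
    and ix: "\<And>m. m < D \<Longrightarrow> ix m < d" and \<tau>: "\<And>m. m < D \<Longrightarrow> \<tau> m \<in> carrier G"
    and sep: "\<And>m n. m < D \<Longrightarrow> n < D \<Longrightarrow> ix m = ix n \<Longrightarrow> inv (\<tau> m) \<otimes> \<tau> n \<in> U \<Longrightarrow> m = n"
begin

abbreviation "block \<equiv> section_matrix G U A ix \<tau>"
abbreviation "GU \<equiv> G\<lparr>carrier := U\<rparr>"

lemma subU: "subgroup U G"
  using U by (rule normal_imp_subgroup)

lemma U_carrier [simp]: "u \<in> U \<Longrightarrow> u \<in> carrier G"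
  using subgroup.mem_carrier[OF subU] .

lemma invH: "u \<in> U \<Longrightarrow> inv\<^bsub>GU\<^esub> u = inv u"
  by (rule m_inv_consistent[OF subU])

lemma conj_closed: "x \<in> carrier G \<Longrightarrow> u \<in> U \<Longrightarrow> inv x \<otimes> (u \<otimes> x) \<in> U"
  "x \<in> carrier G \<Longrightarrow> u \<in> U \<Longrightarrow> x \<otimes> (u \<otimes> inv x) \<in> U"
  using normal.inv_op_closed1[OF U] normal.inv_op_closed2[OF U] by (simp_all add: m_assoc)

text \<open>Translates a step of the compressed matrix from block \<open>m\<close> into the column
  and group element of the corresponding step of \<open>A\<close>.\<close>

definition move :: "nat \<Rightarrow> nat \<times> 'a \<Rightarrow> nat \<times> 'a" where
  "move m = (\<lambda>(n, w). (ix n, inv (\<tau> m) \<otimes> w \<otimes> \<tau> n))"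

text \<open>Since \<open>U\<close> is normal, the group element determines the coset of
  \<open>\<tau> n\<close>, and separation recovers \<open>n\<close>.\<close>

lemma move_inj: "m < D \<Longrightarrow> inj_on (move m) ({..<D} \<times> U)"
proof (rule inj_onI, clarify)
  fix n w n' w'
  assume m: "m < D" and n: "n < D" "n' < D" and w: "w \<in> U" "w' \<in> U"
    and eq: "move m (n, w) = move m (n', w')"
  note c = \<tau>[OF m] \<tau>[OF n(1)] \<tau>[OF n(2)] U_carrier[OF w(1)] U_carrier[OF w(2)]
  have e: "ix n = ix n'" "inv (\<tau> m) \<otimes> (w \<otimes> \<tau> n) = inv (\<tau> m) \<otimes> (w' \<otimes> \<tau> n')"
    using eq c by (simp_all add: move_def m_assoc)
  then have e2: "w \<otimes> \<tau> n = w' \<otimes> \<tau> n'" using c by simp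
  have "\<tau> n' = inv w' \<otimes> (w \<otimes> \<tau> n)" unfolding e2 using c by simp
  then have "inv (\<tau> n) \<otimes> \<tau> n' = inv (\<tau> n) \<otimes> ((inv w' \<otimes> w) \<otimes> \<tau> n)" using c by (simp add: m_assoc)
  also have "\<dots> \<in> U"
    using w by (intro conj_closed c subgroup.m_closed[OF subU] subgroup.m_inv_closed[OF subU])
  finally have nn: "n = n'" using sep n e(1) by blast
  then have "w = w'" using e2 c by simp
  with nn show "n = n' \<and> w = w'" by simp
qed

lemma supp_section:
  "supp (block m n) = {w \<in> U. inv (\<tau> m) \<otimes> w \<otimes> \<tau> n \<in> supp (A (ix m) (ix n))}"
  by (auto simp: supp_def section_matrix_def)

lemma finite_supp_section:
  assumes "m < D" "n < D" shows "finite (supp (block m n))"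
proof -
  have "move m ` ({n} \<times> supp (block m n)) \<subseteq> {ix n} \<times> supp (A (ix m) (ix n))"
    by (auto simp: move_def supp_section)
  then have "finite (move m ` ({n} \<times> supp (block m n)))"
    using finite_supp[OF A ix[OF assms(1)] ix[OF assms(2)]] finite_subset by blast
  moreover have "inj_on (move m) ({n} \<times> supp (block m n))"
    by (rule inj_on_subset[OF move_inj[OF assms(1)]]) (use assms in \<open>auto simp: supp_section\<close>)
  ultimately have "finite ({n} \<times> supp (block m n))" by (rule finite_imageD)
  then show ?thesis using finite_cartesian_productD2 by blast
qed

lemma hermitian_section: "hermitian_matrix GU D block"
  unfolding hermitian_matrix_def
proof (intro allI impI conjI ballI)
  fix m n assume mn: "m < D" "n < D"
  show "block m n \<in> int_group_ring GU"
    using finite_supp_section[OF mn] by (auto simp: int_group_ring_def supp_def section_matrix_def)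
  fix w assume "w \<in> carrier GU"
  then have w: "w \<in> U" by simp
  have c: "\<tau> m \<in> carrier G" "\<tau> n \<in> carrier G" "w \<in> carrier G" using \<tau> mn w by auto
  have "inv (\<tau> n) \<otimes> inv w \<otimes> \<tau> m = inv (inv (\<tau> m) \<otimes> w \<otimes> \<tau> n)"
    using c by (simp add: inv_mult_group m_assoc)
  moreover have "A (ix n) (ix m) (inv (inv (\<tau> m) \<otimes> w \<otimes> \<tau> n)) = A (ix m) (ix n) (inv (\<tau> m) \<otimes> w \<otimes> \<tau> n)"
    using A ix mn c by (simp add: hermitian_matrix_def)
  moreover have "inv w \<in> U" using w subgroup.m_inv_closed[OF subU] by blast
  ultimately show "block n m (inv\<^bsub>GU\<^esub> w) = block m n w" using w by (simp add: section_matrix_def invH)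
qed

lemma move_supp:
  "m < D \<Longrightarrow> move m ` (SIGMA n:{..<D}. supp (block m n)) \<subseteq> (SIGMA j:{..<d}. supp (A (ix m) j))"
  using ix by (auto simp: move_def supp_section)

lemma finite_Sigma_supp: "m < D \<Longrightarrow> finite (SIGMA j:{..<d}. supp (A (ix m) j))"
  using finite_supp[OF A ix] by auto

lemma move_inj_supp: "m < D \<Longrightarrow> inj_on (move m) (SIGMA n:{..<D}. supp (block m n))"
  by (rule inj_on_subset[OF move_inj]) (auto simp: supp_section)

lemma section_eq: "(n, w) \<in> (SIGMA n:{..<D}. supp (block m n)) \<Longrightarrow>
    block m n w = A (ix m) (fst (move m (n, w))) (snd (move m (n, w)))"
  by (auto simp: supp_section section_matrix_def move_def)

text \<open>By injectivity of \<open>move\<close>, a row of the compression is a part of a row of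
  \<open>A\<close>.\<close>

lemma row_sum_section:
  assumes m: "m < D"
  shows "row_sum D block m \<le> row_sum d A (ix m)"
proof -
  have "row_sum D block m = (\<Sum>(n, w)\<in>(SIGMA n:{..<D}. supp (block m n)). real_of_int \<bar>block m n w\<bar>)"
    unfolding row_sum_def by (rule sum.Sigma) (use finite_supp_section[OF m] in auto)
  also have "\<dots> = (\<Sum>p\<in>(SIGMA n:{..<D}. supp (block m n)).
      (\<lambda>(j, g). real_of_int \<bar>A (ix m) j g\<bar>) (move m p))"
    by (rule sum.cong) (use section_eq in \<open>auto simp: split_beta\<close>)
  also have "\<dots> = (\<Sum>(j, g)\<in>move m ` (SIGMA n:{..<D}. supp (block m n)). real_of_int \<bar>A (ix m) j g\<bar>)"
    by (subst sum.reindex[OF move_inj_supp[OF m]]) simp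
  also have "\<dots> \<le> (\<Sum>(j, g)\<in>(SIGMA j:{..<d}. supp (A (ix m) j)). real_of_int \<bar>A (ix m) j g\<bar>)"
    by (rule sum_mono2[OF finite_Sigma_supp[OF m] move_supp[OF m]]) auto
  also have "\<dots> = row_sum d A (ix m)"
    unfolding row_sum_def by (rule sum.Sigma[symmetric]) (use finite_supp[OF A ix[OF m]] in auto)
  finally show ?thesis .
qed

text \<open>\<open>P j\<close> contains the blocks that can be reached in \<open>j\<close> steps; up to step \<open>N\<close> nothing leaves the
  section, so that compressed and full operator have the same diagonal entry.\<close>

lemma interior_moment:
  assumes P: "\<And>j. j \<le> N \<Longrightarrow> P j \<subseteq> {..<D}" and m: "m \<in> P 0"
    and step: "\<And>j n k g. j < N \<Longrightarrow> n \<in> P j \<Longrightarrow> k < d \<Longrightarrow> g \<in> supp (A (ix n) k) \<Longrightarrow>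
      \<exists>n'\<in>P (Suc j). ix n' = k \<and> inv (\<tau> n') \<otimes> (\<tau> n \<otimes> g) \<in> U"
  shows "(matrix_op GU D block ^^ N) (delta (m, \<one>)) (m, \<one>)
    = (matrix_op G d A ^^ N) (delta (ix m, inv (\<tau> m))) (ix m, inv (\<tau> m))"
proof -
  let ?\<iota> = "\<lambda>(n, u). (ix n, inv (\<tau> n) \<otimes> u)"
  have mD: "m < D" using P[of 0] m by auto
  have "(matrix_op GU D block ^^ N) (delta (m, \<one>)) (m, \<one>)
    = (matrix_op G d A ^^ N) (delta (ix m, inv (\<tau> m))) (?\<iota> (m, \<one>))"
  proof (rule local_isomorphism_power[where B="\<lambda>j. P j \<times> U"])
    fix j b and v v' :: "nat \<times> 'a \<Rightarrow> complex"
    assume j: "j < N" and b: "b \<in> P j \<times> U" and vv: "\<And>c. c \<in> P (Suc j) \<times> U \<Longrightarrow> v c = v' (?\<iota> c)"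
    obtain n u where bn: "b = (n, u)" and nP: "n \<in> P j" and u: "u \<in> U" using b by auto
    have n: "n < D" using P[of j] j nP by auto
    have c: "\<tau> n \<in> carrier G" "u \<in> carrier G" using \<tau>[OF n] u by auto
    let ?S = "SIGMA n':{..<D}. supp (block n n')" and ?S' = "SIGMA k:{..<d}. supp (A (ix n) k)"
    \<comment> \<open>Normality turns the left coset condition on the target into membership in
      \<open>U\<close> of the block coordinate
      \<open>\<tau> n \<otimes> g \<otimes> inv (\<tau> n')\<close>.\<close>
    have step': "\<exists>n'\<in>P (Suc j). ix n' = k \<and> n' < D \<and> \<tau> n \<otimes> g \<otimes> inv (\<tau> n') \<in> U
        \<and> inv (\<tau> n') \<otimes> (\<tau> n \<otimes> g) \<in> U"
      if kg: "(k, g) \<in> ?S'" for k g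
    proof -
      have k: "k < d" "g \<in> supp (A (ix n) k)" using kg by auto
      have g: "g \<in> carrier G" using supp_carrier[OF A ix[OF n] k] .
      obtain n' where n': "n' \<in> P (Suc j)" "ix n' = k" "inv (\<tau> n') \<otimes> (\<tau> n \<otimes> g) \<in> U"
        using step[OF j nP k] by blast
      have n'D: "n' < D" using P[of "Suc j"] j n'(1) by auto
      have "\<tau> n' \<otimes> ((inv (\<tau> n') \<otimes> (\<tau> n \<otimes> g)) \<otimes> inv (\<tau> n')) \<in> U"
        by (rule conj_closed(2)[OF \<tau>[OF n'D] n'(3)])
      then have "\<tau> n \<otimes> g \<otimes> inv (\<tau> n') \<in> U" using c g \<tau>[OF n'D] by (simp add: m_assoc)
      then show ?thesis using n' n'D by blast
    qed
    \<comment> \<open>At an interior index the compression loses no entry of the row.\<close>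
    have im: "move n ` ?S = ?S'"
    proof
      show "move n ` ?S \<subseteq> ?S'" by (rule move_supp[OF n])
      show "?S' \<subseteq> move n ` ?S"
      proof clarify
        fix k g assume kg: "k < d" "g \<in> supp (A (ix n) k)"
        then obtain n' where n': "ix n' = k" "n' < D" "\<tau> n \<otimes> g \<otimes> inv (\<tau> n') \<in> U"
          using step'[of k g] by auto
        have g: "g \<in> carrier G" using supp_carrier[OF A ix[OF n] kg] .
        have e: "inv (\<tau> n) \<otimes> (\<tau> n \<otimes> g \<otimes> inv (\<tau> n')) \<otimes> \<tau> n' = g"
          using c g \<tau>[OF n'(2)] by (simp add: m_assoc)
        then have "(k, g) = move n (n', \<tau> n \<otimes> g \<otimes> inv (\<tau> n'))" using n'(1) by (simp add: move_def)
        moreover have "(n', \<tau> n \<otimes> g \<otimes> inv (\<tau> n')) \<in> ?S"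
          using n' e kg by (auto simp: supp_section)
        ultimately show "(k, g) \<in> move n ` ?S" by blast
      qed
    qed
    \<comment> \<open>The index provided by the step hypothesis lies in the same coset and row as
      \<open>n'\<close>, so it is \<open>n'\<close>.\<close>
    have nbr: "n' \<in> P (Suc j)" if p: "(n', w) \<in> ?S" for n' w
    proof -
      have n'D: "n' < D" and w: "w \<in> U" using p by (auto simp: supp_section)
      let ?g = "inv (\<tau> n) \<otimes> w \<otimes> \<tau> n'"
      have "(ix n', ?g) \<in> ?S'" using im p by (auto simp: move_def)
      then obtain n'' where n'': "n'' \<in> P (Suc j)" "ix n'' = ix n'" "n'' < D" "inv (\<tau> n'') \<otimes> (\<tau> n \<otimes> ?g) \<in> U"
        using step' by blast
      note c' = c \<tau>[OF n'D] \<tau>[OF n''(3)] U_carrier[OF w]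
      have "inv (\<tau> n'') \<otimes> (w \<otimes> \<tau> n') \<in> U" using n''(4) c' by (simp add: m_assoc)
      moreover have "inv (\<tau> n') \<otimes> (inv w \<otimes> \<tau> n') \<in> U"
        using conj_closed(1)[OF \<tau>[OF n'D]] subgroup.m_inv_closed[OF subU w] .
      ultimately have "(inv (\<tau> n'') \<otimes> (w \<otimes> \<tau> n')) \<otimes> (inv (\<tau> n') \<otimes> (inv w \<otimes> \<tau> n')) \<in> U"
        by (rule subgroup.m_closed[OF subU])
      then have "inv (\<tau> n'') \<otimes> \<tau> n' \<in> U" using c' by (simp add: m_assoc)
      then show ?thesis using sep[OF n''(3) n'D n''(2)] n''(1) by simp
    qed
    have "matrix_op G d A v' (ix n, inv (\<tau> n) \<otimes> u)
        = (\<Sum>(k, g)\<in>?S'. of_int (A (ix n) k g) * v' (k, inv g \<otimes> (inv (\<tau> n) \<otimes> u)))"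
      by (rule matrix_op_apply) (use ix[OF n] c finite_supp[OF A ix[OF n]] in auto)
    also have "\<dots> = (\<Sum>p\<in>?S. (\<lambda>(k, g). of_int (A (ix n) k g) * v' (k, inv g \<otimes> (inv (\<tau> n) \<otimes> u))) (move n p))"
      unfolding im[symmetric] by (subst sum.reindex[OF move_inj_supp[OF n]]) simp
    also have "\<dots> = (\<Sum>(n', w)\<in>?S. of_int (block n n' w) * v (n', inv\<^bsub>GU\<^esub> w \<otimes> u))"
    proof (rule sum.cong[OF refl])
      fix q assume q: "q \<in> ?S"
      obtain n' w where qw: "q = (n', w)" by (cases q)
      then have p: "(n', w) \<in> ?S" and n'D: "n' < D" and w: "w \<in> U" using q by (auto simp: supp_section)
      note c' = c \<tau>[OF n'D] U_carrier[OF w]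
      have "inv\<^bsub>GU\<^esub> w \<otimes> u \<in> U"
        using w u by (simp add: invH subgroup.m_closed[OF subU] subgroup.m_inv_closed[OF subU])
      then have "v (n', inv\<^bsub>GU\<^esub> w \<otimes> u) = v' (ix n', inv (\<tau> n') \<otimes> (inv\<^bsub>GU\<^esub> w \<otimes> u))"
        using vv[of "(n', inv\<^bsub>GU\<^esub> w \<otimes> u)"] nbr[OF p] by simp
      also have "inv (\<tau> n') \<otimes> (inv\<^bsub>GU\<^esub> w \<otimes> u) = inv (inv (\<tau> n) \<otimes> w \<otimes> \<tau> n') \<otimes> (inv (\<tau> n) \<otimes> u)"
        using c' w by (simp add: invH inv_mult_group m_assoc)
      finally have "v (n', inv\<^bsub>GU\<^esub> w \<otimes> u)
          = v' (ix n', inv (inv (\<tau> n) \<otimes> w \<otimes> \<tau> n') \<otimes> (inv (\<tau> n) \<otimes> u))" .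
      then show "(case move n q of (k, g) \<Rightarrow> of_int (A (ix n) k g) * v' (k, inv g \<otimes> (inv (\<tau> n) \<otimes> u)))
          = (case q of (n', w) \<Rightarrow> of_int (block n n' w) * v (n', inv\<^bsub>GU\<^esub> w \<otimes> u))"
        using section_eq[OF p] by (simp add: move_def qw)
    qed
    also have "\<dots> = matrix_op GU D block v (n, u)"
      using matrix_op_apply[of n D u GU block v] finite_supp_section[OF n] n u by simp
    finally show "matrix_op GU D block v b = matrix_op G d A v' (?\<iota> b)" by (simp add: bn)
  next
    fix b assume "b \<in> P N \<times> U"
    then obtain n u where bn: "b = (n, u)" and n: "n < D" and u: "u \<in> U" using P[of N] by auto
    have "n = m \<and> u = \<one>" if e: "ix n = ix m" "inv (\<tau> n) \<otimes> u = inv (\<tau> m)"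
    proof -
      note c = \<tau>[OF n] \<tau>[OF mD] U_carrier[OF u]
      have "u = \<tau> n \<otimes> (inv (\<tau> n) \<otimes> u)" using c by simp
      then have "u = \<tau> n \<otimes> inv (\<tau> m)" using e(2) by simp
      then have "inv (\<tau> m) \<otimes> (u \<otimes> \<tau> m) = inv (\<tau> m) \<otimes> \<tau> n" using c by (simp add: m_assoc)
      then have "inv (\<tau> m) \<otimes> \<tau> n \<in> U" using conj_closed(1)[OF c(2) u] by simp
      then have nm: "n = m" using sep[OF mD n] e(1) by simp
      then show ?thesis using \<open>u = \<tau> n \<otimes> inv (\<tau> m)\<close> c by simp
    qed
    moreover have "ix n = ix m \<and> inv (\<tau> n) \<otimes> u = inv (\<tau> m)" if "n = m" "u = \<one>"
      using that \<tau>[OF mD] by simp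
    ultimately have "(n = m \<and> u = \<one>) = (ix n = ix m \<and> inv (\<tau> n) \<otimes> u = inv (\<tau> m))" by blast
    then show "delta (m, \<one>) b = delta (ix m, inv (\<tau> m)) (?\<iota> b)"
      unfolding bn delta_def prod.case prod.inject by (rule if_cong) (rule refl)+
  next
    show "(m, \<one>) \<in> P 0 \<times> U" using m subgroup.one_closed[OF subU] by simp
  qed
  then show ?thesis using \<tau>[OF mD] by simp
qed

end

text \<open>Right translation commutes with left multiplication, so all diagonal entries of one row
  index agree.\<close>

lemma moment_translation:
  assumes A: "hermitian_matrix G d A" and i: "i < d" and x: "x \<in> carrier G"
  shows "(matrix_op G d A ^^ n) (delta (i, x)) (i, x) = (matrix_op G d A ^^ n) (delta (i, \<one>)) (i, \<one>)"
proof -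
  let ?\<iota> = "\<lambda>(j, y). (j, y \<otimes> x)"
  have "(matrix_op G d A ^^ n) (delta (i, \<one>)) (i, \<one>) = (matrix_op G d A ^^ n) (delta (i, x)) (?\<iota> (i, \<one>))"
  proof (rule local_isomorphism_power[where B="\<lambda>_. Sd d"])
    fix b and v v' :: "nat \<times> 'a \<Rightarrow> complex"
    assume "b \<in> Sd d" and vv: "\<And>c. c \<in> Sd d \<Longrightarrow> v c = v' (?\<iota> c)"
    then obtain k y where b: "b = (k, y)" and k: "k < d" and y: "y \<in> carrier G" by (auto simp: l2_sum_index_def)
    have "v (j, inv g \<otimes> y) = v' (j, inv g \<otimes> (y \<otimes> x))" if "j < d" "g \<in> supp (A k j)" for j g
      using vv[of "(j, inv g \<otimes> y)"] supp_carrier[OF A k that] that x y by (simp add: l2_sum_index_def m_assoc)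
    then show "matrix_op G d A v b = matrix_op G d A v' (?\<iota> b)"
      using x y k finite_supp[OF A k] unfolding b prod.case
      by (subst (1 2) matrix_op_apply) (auto intro!: sum.cong)
  next
    fix b assume "b \<in> Sd d"
    then obtain k y where b: "b = (k, y)" and y: "y \<in> carrier G" by (auto simp: l2_sum_index_def)
    have "y \<otimes> x = x \<longleftrightarrow> y = \<one>" using x y by simp
    then show "delta (i, \<one>) b = delta (i, x) (?\<iota> b)" by (auto simp: b delta_def)
  qed (use i in \<open>auto simp: l2_sum_index_def\<close>)
  then show ?thesis using x by simp
qed

text \<open>A crude bound for the indices near the boundary of a Folner set, where nothing else is
  known.\<close>

lemma moment_bound:
  assumes A: "hermitian_matrix G d A" and R: "\<And>i. i < d \<Longrightarrow> row_sum d A i \<le> R" "0 < R"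
    and p: "p \<in> Sd d"
  shows "\<bar>Re ((matrix_op G d A ^^ n) (delta p) p)\<bar> \<le> R ^ n"
proof -
  let ?v = "(matrix_op G d A ^^ n) (delta p)"
  have "?v \<in> l2 (Sd d) \<and> Re (l2_inner (Sd d) ?v ?v) \<le> (R ^ n)\<^sup>2"
  proof (induction n)
    case 0
    then show ?case using p by (simp add: l2_inner_delta) (simp add: delta_def)
  next
    case (Suc n)
    let ?w = "(matrix_op G d A ^^ n) (delta p)"
    have "Re (l2_inner (Sd d) (matrix_op G d A ?w) (matrix_op G d A ?w)) \<le> R\<^sup>2 * Re (l2_inner (Sd d) ?w ?w)"
      using Suc by (intro matrix_op_norm_bound[OF A R]) auto
    also have "\<dots> \<le> R\<^sup>2 * (R ^ n)\<^sup>2" using Suc by (intro mult_left_mono) auto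
    finally show ?case using Suc matrix_op_l2[OF A] by (simp add: power_mult_distrib)
  qed
  then have v: "?v \<in> l2 (Sd d)" "Re (l2_inner (Sd d) ?v ?v) \<le> (R ^ n)\<^sup>2" by auto
  have "(cmod (l2_inner (Sd d) ?v (delta p)))\<^sup>2 \<le> Re (l2_inner (Sd d) ?v ?v) * Re (l2_inner (Sd d) (delta p) (delta p))"
    using v(1) p by (intro l2_cauchy_schwarz) auto
  also have "Re (l2_inner (Sd d) (delta p) (delta p)) = 1" using p by (simp add: l2_inner_delta) (simp add: delta_def)
  finally have "(cmod (?v p))\<^sup>2 \<le> (R ^ n)\<^sup>2" using v(2) p by (simp add: l2_inner_delta)
  then have "cmod (?v p) \<le> R ^ n" using R(2) by (simp add: power2_le_iff_abs_le)
  then show ?thesis using abs_Re_le_cmod order_trans by blast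
qed

end

context group
begin

section \<open>Compression to Folner sets of cosets\<close>

lemma lcoset_eq_iff:
  assumes U: "subgroup U G" and x: "x \<in> carrier G" and y: "y \<in> carrier G"
  shows "inv x \<otimes> y \<in> U \<longleftrightarrow> x <# U = y <# U"
proof
  assume a: "inv x \<otimes> y \<in> U"
  have "y = x \<otimes> (inv x \<otimes> y)" using x y by simp
  then have "y \<in> x <# U" using a unfolding l_coset_def by blast
  then show "x <# U = y <# U" by (rule l_repr_independence[OF _ x U])
next
  assume a: "x <# U = y <# U"
  have "y \<otimes> \<one> \<in> y <# U" using subgroup.one_closed[OF U] unfolding l_coset_def by blast
  then have "y \<in> x <# U" using a y by simp
  then obtain u where "u \<in> U" "y = x \<otimes> u" unfolding l_coset_def by blast
  then show "inv x \<otimes> y \<in> U" using x subgroup.mem_carrier[OF U] by simp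
qed

text \<open>Over cosets outside \<open>Z\<close> the compressed diagonal entries equal those of
  \<open>A\<close> up to order \<open>N\<close>. Each of the \<open>d * card Z\<close> others
  contributes an error of at most \<open>2 * R ^ n\<close>.\<close>

lemma folner_section:
  fixes dist :: "'a set \<Rightarrow> 'a set \<Rightarrow> nat"
  defines "M U \<equiv> lcosets\<^bsub>G\<^esub> U"
  assumes U: "U \<lhd> G" and A: "hermitian_matrix G d A"
    and R: "\<And>i. i < d \<Longrightarrow> row_sum d A i \<le> R" "0 < R"
    and refl: "\<And>x. x \<in> M U \<Longrightarrow> dist x x = 0"
    and triangle: "\<And>x y z. x \<in> M U \<Longrightarrow> y \<in> M U \<Longrightarrow> z \<in> M U \<Longrightarrow> dist x z \<le> dist x y + dist y z"
    and invariant: "\<And>g x y. g \<in> carrier G \<Longrightarrow> x \<in> M U \<Longrightarrow> y \<in> M U \<Longrightarrow> dist (g <# x) (g <# y) = dist x y"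
    and K: "\<And>g. g \<in> support_union d A \<Longrightarrow> dist U (g <# U) \<le> K"
    and X: "X \<subseteq> M U" "finite X" "X \<noteq> {}" and Z: "Z \<subseteq> X"
    and good: "\<And>c c'. c \<in> X - Z \<Longrightarrow> c' \<in> M U \<Longrightarrow> dist c c' \<le> N * K \<Longrightarrow> c' \<in> X"
  shows "\<exists>D B. hermitian_matrix (G\<lparr>carrier := U\<rparr>) D B \<and> (\<forall>m<D. row_sum D B m \<le> R) \<and>
    (\<forall>n\<le>N. \<bar>trace_moment (G\<lparr>carrier := U\<rparr>) D B n / card X - trace_moment G d A n\<bar>
      \<le> 2 * real d * R ^ n * (card Z / card X))"
proof -
  let ?H = "G\<lparr>carrier := U\<rparr>"
  have sU: "subgroup U G" using U by (rule normal_imp_subgroup)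
  have M: "x <# U \<in> M U" if "x \<in> carrier G" for x using that by (auto simp: M_def LCOSETS_def)
  have U1: "U \<in> M U" using M[OF one_closed] lcos_mult_one[OF subgroup.subset[OF sU]] by simp
  have "\<forall>c. \<exists>x. c \<in> M U \<longrightarrow> x \<in> carrier G \<and> x <# U = c" by (auto simp: M_def LCOSETS_def)
  then obtain t where t: "\<And>c. c \<in> M U \<Longrightarrow> t c \<in> carrier G" "\<And>c. c \<in> M U \<Longrightarrow> t c <# U = c" by metis
  define D where "D = card ({..<d} \<times> X)"
  obtain h where "bij_betw h {0..<D} ({..<d} \<times> X)"
    unfolding D_def using ex_bij_betw_nat_finite[of "{..<d} \<times> X"] X(2) by auto
  then have h: "bij_betw h {..<D} ({..<d} \<times> X)" by (simp add: lessThan_atLeast0)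
  have hX: "fst (h m) < d" "snd (h m) \<in> X" "snd (h m) \<in> M U" if "m < D" for m
    using bij_betwE[OF h] that X(1) by (auto simp: mem_Times_iff)
  define ix where "ix m = fst (h m)" for m
  define \<tau> where "\<tau> m = t (snd (h m))" for m
  have ix: "ix m < d" if "m < D" for m using hX that by (simp add: ix_def)
  have \<tau>: "\<tau> m \<in> carrier G" "\<tau> m <# U = snd (h m)" if "m < D" for m using t hX that by (auto simp: \<tau>_def)
  have sep: "m = n" if mn: "m < D" "n < D" "ix m = ix n" "inv (\<tau> m) \<otimes> \<tau> n \<in> U" for m n
  proof -
    have "snd (h m) = snd (h n)"
      using mn(4) lcoset_eq_iff[OF sU \<tau>(1)[OF mn(1)] \<tau>(1)[OF mn(2)]] \<tau>(2) mn by simp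
    then have "h m = h n" using mn(3) by (simp add: ix_def prod_eq_iff)
    then show ?thesis using h mn by (auto simp: bij_betw_def dest: inj_onD)
  qed
  let ?B = "section_matrix G U A ix \<tau>"
  have herm: "hermitian_matrix ?H D ?B" by (rule hermitian_section[OF U A ix \<tau>(1) sep])
  have row: "row_sum D ?B m \<le> R" if m: "m < D" for m
  proof -
    have "row_sum D ?B m \<le> row_sum d A (ix m)"
      by (rule row_sum_section[where ix=ix and \<tau>=\<tau>, OF U A ix \<tau>(1) sep m])
    then show ?thesis using R(1)[OF ix[OF m]] by linarith
  qed
  define a where "a n m = Re ((matrix_op ?H D ?B ^^ n) (delta (m, \<one>)) (m, \<one>))" for n m
  define \<alpha> where "\<alpha> n i = Re ((matrix_op G d A ^^ n) (delta (i, \<one>)) (i, \<one>))" for n i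
  have interior: "a n m = \<alpha> n (ix m)" if n: "n \<le> N" and m: "m < D" "snd (h m) \<in> X - Z" for n m
  proof -
    let ?c = "snd (h m)"
    \<comment> \<open>A step moves a coset by at most \<open>K\<close>, so \<open>j\<close> steps
      stay in the ball of radius \<open>j * K\<close>, and up to \<open>N\<close> steps inside
      \<open>X\<close>.\<close>
    define P where "P j = {m'. m' < D \<and> dist ?c (snd (h m')) \<le> j * K}" for j
    have "(matrix_op ?H D ?B ^^ n) (delta (m, \<one>)) (m, \<one>)
        = (matrix_op G d A ^^ n) (delta (ix m, inv (\<tau> m))) (ix m, inv (\<tau> m))"
    proof (rule interior_moment[OF U A ix \<tau>(1) sep, where P=P])
      show "P j \<subseteq> {..<D}" for j by (auto simp: P_def)
      show "m \<in> P 0" using m refl[OF hX(3)] by (simp add: P_def)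
      fix j m' k g assume j: "j < n" and m': "m' \<in> P j" and k: "k < d" and g: "g \<in> supp (A (ix m') k)"
      have m'D: "m' < D" and dm': "dist ?c (snd (h m')) \<le> j * K" using m' by (auto simp: P_def)
      have gV: "g \<in> support_union d A" using support_union(4)[OF A ix[OF m'D] k] g by blast
      then have gc: "g \<in> carrier G" using support_union(2)[OF A] by blast
      note tm = \<tau>[OF m'D]
      let ?c' = "(\<tau> m' \<otimes> g) <# U"
      have c'M: "?c' \<in> M U" using tm gc by (intro M) simp
      \<comment> \<open>Left invariance makes the length of a step depend on \<open>g\<close>
        alone.\<close>
      have "dist (snd (h m')) ?c' = dist (\<tau> m' <# U) (\<tau> m' <# (g <# U))"
        using tm gc by (simp add: lcos_m_assoc[OF subgroup.subset[OF sU]])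
      also have "\<dots> = dist U (g <# U)" by (rule invariant[OF tm(1) U1 M[OF gc]])
      also have "\<dots> \<le> K" by (rule K[OF gV])
      finally have "dist ?c ?c' \<le> Suc j * K"
        using triangle[OF hX(3)[OF m(1)] hX(3)[OF m'D] c'M] dm' by simp
      moreover have "Suc j * K \<le> N * K" using j n by (intro mult_right_mono) auto
      ultimately have "?c' \<in> X" using good[OF m(2) c'M] by simp
      then have "(k, ?c') \<in> h ` {..<D}" using k by (simp add: bij_betw_imp_surj_on[OF h])
      then obtain m'' where m'': "m'' < D" "h m'' = (k, ?c')" by force
      have "m'' \<in> P (Suc j)" using m'' \<open>dist ?c ?c' \<le> Suc j * K\<close> by (simp add: P_def)
      moreover have "ix m'' = k" using m'' by (simp add: ix_def)
      moreover have "inv (\<tau> m'') \<otimes> (\<tau> m' \<otimes> g) \<in> U"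
        using lcoset_eq_iff[OF sU \<tau>(1)[OF m''(1)], of "\<tau> m' \<otimes> g"] \<tau>(2)[OF m''(1)] m'' tm gc by simp
      ultimately show "\<exists>n'\<in>P (Suc j). ix n' = k \<and> inv (\<tau> n') \<otimes> (\<tau> m' \<otimes> g) \<in> U" by blast
    qed
    also have "\<dots> = (matrix_op G d A ^^ n) (delta (ix m, \<one>)) (ix m, \<one>)"
      using \<tau>(1)[OF m(1)] by (intro moment_translation[OF A ix[OF m(1)]]) simp
    finally show ?thesis by (simp add: a_def \<alpha>_def)
  qed
  have gH: "group ?H" by (rule subgroup.subgroup_is_group[OF sU is_group])
  have a_bound: "\<bar>a n m\<bar> \<le> R ^ n" if "m < D" for n m
    unfolding a_def
    by (rule group.moment_bound[OF gH herm row R(2)])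
      (use that subgroup.one_closed[OF sU] in \<open>auto simp: l2_sum_index_def\<close>)
  have \<alpha>_bound: "\<bar>\<alpha> n i\<bar> \<le> R ^ n" if "i < d" for n i
    unfolding \<alpha>_def by (rule moment_bound[OF A R]) (use that in \<open>auto simp: l2_sum_index_def\<close>)
  have cX: "0 < real (card X)" using X by (simp add: card_gt_0_iff)
  have "\<bar>trace_moment ?H D ?B n / card X - trace_moment G d A n\<bar> \<le> 2 * real d * R ^ n * (card Z / card X)"
    if n: "n \<le> N" for n
  proof -
    have 1: "trace_moment ?H D ?B n = (\<Sum>m<D. a n m)" by (simp add: trace_moment_def a_def)
    have "(\<Sum>m<D. \<alpha> n (ix m)) = (\<Sum>p\<in>{..<d} \<times> X. \<alpha> n (fst p))"
      unfolding ix_def by (rule sum.reindex_bij_betw[OF h])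
    also have "\<dots> = (\<Sum>i<d. \<Sum>c\<in>X. \<alpha> n i)" by (subst sum.cartesian_product) (simp add: split_beta)
    also have "\<dots> = card X * trace_moment G d A n"
      by (simp add: trace_moment_def \<alpha>_def sum_distrib_left)
    finally have 2: "(\<Sum>m<D. \<alpha> n (ix m)) = card X * trace_moment G d A n" .
    have "\<bar>trace_moment ?H D ?B n - card X * trace_moment G d A n\<bar> = \<bar>\<Sum>m<D. a n m - \<alpha> n (ix m)\<bar>"
      by (simp only: 1 2[symmetric] sum_subtractf)
    also have "\<dots> \<le> (\<Sum>m<D. \<bar>a n m - \<alpha> n (ix m)\<bar>)" by (rule sum_abs)
    also have "\<dots> \<le> (\<Sum>m<D. if snd (h m) \<in> Z then 2 * R ^ n else 0)"
    proof (rule sum_mono)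
      fix m assume "m \<in> {..<D}"
      then have m: "m < D" by simp
      show "\<bar>a n m - \<alpha> n (ix m)\<bar> \<le> (if snd (h m) \<in> Z then 2 * R ^ n else 0)"
        using interior[OF n m] a_bound[OF m, of n] \<alpha>_bound[OF ix[OF m], of n] hX(2)[OF m] by auto
    qed
    also have "\<dots> = (\<Sum>p\<in>{..<d} \<times> X. if snd p \<in> Z then 2 * R ^ n else 0)"
      by (rule sum.reindex_bij_betw[OF h])
    also have "\<dots> = (\<Sum>i<d. \<Sum>c\<in>X. if c \<in> Z then 2 * R ^ n else 0)"
      by (subst sum.cartesian_product) (simp add: split_beta)
    also have "\<dots> = 2 * real d * R ^ n * card Z"
      using X(2) Z by (simp add: sum.If_cases Int_absorb1)
    finally have "\<bar>trace_moment ?H D ?B n - card X * trace_moment G d A n\<bar> / card X \<le> 2 * real d * R ^ n * card Z / card X"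
      using cX by (intro divide_right_mono) auto
    moreover have abs_quotient: "\<bar>x - r * y\<bar> / r = \<bar>x / r - y\<bar>" if "0 < r" for x y r :: real
    proof -
      have "x / r - y = (x - r * y) / r"
        unfolding diff_divide_distrib using that by (simp only: nonzero_mult_div_cancel_left)
      then show ?thesis using that by (simp only: abs_divide abs_of_pos)
    qed
    have "\<bar>trace_moment ?H D ?B n - card X * trace_moment G d A n\<bar> / card X
        = \<bar>trace_moment ?H D ?B n / card X - trace_moment G d A n\<bar>"
      by (rule abs_quotient[OF cX])
    ultimately show ?thesis by (simp only: times_divide_eq_right)
  qed
  note moments = this
  show ?thesis
  proof (intro exI conjI allI impI)
    show "hermitian_matrix ?H D ?B" by (rule herm)
    show "row_sum D ?B m \<le> R" if "m < D" for m by (rule row[OF that])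
    show "\<bar>trace_moment ?H D ?B n / card X - trace_moment G d A n\<bar> \<le> 2 * real d * R ^ n * (card Z / card X)"
      if "n \<le> N" for n by (rule moments[OF that])
  qed
qed

end

lemma set_distance_le_iff:
  assumes "finite X" "X \<noteq> {}"
  shows "set_distance d x X \<le> ereal K \<longleftrightarrow> (\<exists>a\<in>X. real (d x a) \<le> K)"
proof -
  have "set_distance d x X = Min ((\<lambda>a. ereal (real (d x a))) ` X)"
    unfolding set_distance_def using assms by (simp add: Min_Inf)
  then show ?thesis using assms by (simp add: Min_le_iff)
qed

lemma set_distance_leI: "a \<in> Y \<Longrightarrow> real (d x a) \<le> K \<Longrightarrow> set_distance d x Y \<le> ereal K"
  unfolding set_distance_def by (rule INF_lower2) auto

text \<open>The normalizing factor is \<open>1 / card X\<close>, because the compressed trace has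
  one block of \<open>d\<close> diagonal entries for each coset in \<open>X\<close>.\<close>

lemma semi_integral_amenable_extension:
  fixes G :: "'a monoid"
  assumes G: "group G" and U: "U \<lhd> G" and sid: "semi_integral_determinant (G\<lparr>carrier := U\<rparr>)"
    and am: "amenable_homogeneous_space G U"
  shows "semi_integral_determinant G"
  unfolding semi_integral_determinant_def
proof (intro allI impI)
  interpret group G by (rule G)
  fix d A
  assume A: "\<forall>i<d. \<forall>j<d. A i j \<in> int_group_ring G"
    and pos: "positive_self_adjoint_on (l2_sum_index G d) (matrix_op G d A)"
  have hA: "hermitian_matrix G d A"
    using hermitian_of_self_adjoint A pos by (simp add: positive_self_adjoint_on_def)
  let ?M = "lcosets\<^bsub>G\<^esub> U" and ?H = "G\<lparr>carrier := U\<rparr>"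
  obtain dist :: "'a set \<Rightarrow> 'a set \<Rightarrow> nat" where met: "Metric_space ?M (\<lambda>x y. real (dist x y))"
    and inv: "\<And>g x y. g \<in> carrier G \<Longrightarrow> x \<in> ?M \<Longrightarrow> y \<in> ?M \<Longrightarrow> dist (g <#\<^bsub>G\<^esub> x) (g <#\<^bsub>G\<^esub> y) = dist x y"
    and fin: "\<And>X. X \<subseteq> ?M \<Longrightarrow> \<exists>D. \<forall>x\<in>X. \<forall>y\<in>X. dist x y \<le> D \<Longrightarrow> finite X"
    and fol: "\<And>K \<epsilon>. (0::real) < K \<Longrightarrow> (0::real) < \<epsilon> \<Longrightarrow> \<exists>X\<subseteq>?M. finite X \<and> X \<noteq> {} \<and>
        real (card (boundary_nbhd ?M dist K X)) \<le> \<epsilon> * real (card X)"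
    using am unfolding amenable_homogeneous_space_def by metis
  interpret Metric_space ?M "\<lambda>x y. real (dist x y)" by (rule met)
  have tri: "dist x z \<le> dist x y + dist y z" if "x \<in> ?M" "y \<in> ?M" "z \<in> ?M" for x y z
    using triangle[OF that] by linarith
  have comm: "dist x y = dist y x" for x y using commute[of x y] by simp
  have refl: "dist x x = 0" if "x \<in> ?M" for x using zero[OF that that] by simp
  define R where "R = 1 + (\<Sum>i<d. row_sum d A i)"
  have R: "row_sum d A i \<le> R" if "i < d" for i
    using member_le_sum[of i "{..<d}" "row_sum d A"] that by (simp add: R_def row_sum_nonneg)
  have R0: "0 < R" unfolding R_def by (intro add_pos_nonneg sum_nonneg row_sum_nonneg) simp
  \<comment> \<open>The longest step of the matrix; 0 is inserted for the zero matrix, whose support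
    is empty.\<close>
  define K where "K = Max (insert 0 ((\<lambda>g. dist U (g <#\<^bsub>G\<^esub> U)) ` support_union d A))"
  have K: "dist U (g <#\<^bsub>G\<^esub> U) \<le> K" if "g \<in> support_union d A" for g
    unfolding K_def using that support_union(1)[OF hA] by (intro Max_ge) auto
  have "\<exists>D B c. hermitian_matrix ?H D B \<and> (\<forall>m<D. row_sum D B m \<le> R) \<and> 0 < c \<and>
      (\<forall>n\<le>2 * k. \<bar>c * trace_moment ?H D B n - trace_moment G d A n\<bar> \<le> 2 * real d * R ^ n * (1 / Suc k))" for k
  proof -
    \<comment> \<open>The length of \<open>2 * k\<close> steps; the 1 keeps the radius positive as
      the Folner condition demands.\<close>
    let ?K = "real (2 * k * K + 1)"
    have K0: "0 < ?K" by (simp only: of_nat_0_less_iff)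
    have "\<exists>X\<subseteq>?M. finite X \<and> X \<noteq> {} \<and>
        real (card (boundary_nbhd ?M dist ?K X)) \<le> 1 / Suc k * real (card X)"
      by (rule fol[OF K0]) simp
    then obtain X where X: "X \<subseteq> ?M" "finite X" "X \<noteq> {}"
      and bd: "real (card (boundary_nbhd ?M dist ?K X)) \<le> 1 / Suc k * real (card X)"
      by blast
    let ?N = "boundary_nbhd ?M dist ?K X"
    \<comment> \<open>Infinite sets have \<open>card\<close> 0, so the Folner estimate controls
      \<open>Z\<close> only once the neighbourhood is known to be finite; this comes from properness
      of the metric.\<close>
    have finN: "finite ?N"
    proof -
      have "finite {x \<in> ?M. real (dist x a) \<le> ?K}" if a: "a \<in> X" for a
      proof (rule fin)
        have "dist x y \<le> (2 * k * K + 1) + (2 * k * K + 1)"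
          if "x \<in> ?M" "real (dist x a) \<le> ?K" "y \<in> ?M" "real (dist y a) \<le> ?K" for x y
        proof -
          have "dist x a \<le> 2 * k * K + 1" "dist y a \<le> 2 * k * K + 1"
            using that by (simp_all only: of_nat_le_iff)
          moreover have "a \<in> ?M" using a X(1) by blast
          ultimately show ?thesis
            using order_trans[OF tri[of x a y] add_mono] that(1,3) comm[of a y] by metis
        qed
        then show "\<exists>D. \<forall>x\<in>{x \<in> ?M. real (dist x a) \<le> ?K}. \<forall>y\<in>{x \<in> ?M. real (dist x a) \<le> ?K}. dist x y \<le> D"
          by blast
      qed auto
      then have "finite (\<Union>a\<in>X. {x \<in> ?M. real (dist x a) \<le> ?K})" using X(2) by blast
      moreover have "?N \<subseteq> (\<Union>a\<in>X. {x \<in> ?M. real (dist x a) \<le> ?K})"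
        unfolding boundary_nbhd_def set_distance_le_iff[OF X(2,3)] by blast
      ultimately show ?thesis using finite_subset by blast
    qed
    \<comment> \<open>The boundary neighbourhood lies on both sides; only the cosets in
      \<open>X\<close> index rows of the compression.\<close>
    define Z where "Z = ?N \<inter> X"
    have good: "c' \<in> X" if c: "c \<in> X - Z" and c': "c' \<in> ?M" "dist c c' \<le> 2 * k * K" for c c'
    proof (rule ccontr)
      assume "c' \<notin> X"
      have cM: "c \<in> ?M" using c X(1) by blast
      have "real (dist c c') \<le> ?K" using c'(2) by (simp only: of_nat_le_iff)
      then have "set_distance dist c (?M - X) \<le> ereal ?K"
        using c'(1) \<open>c' \<notin> X\<close> by (intro set_distance_leI[of c']) auto
      moreover have "set_distance dist c X \<le> ereal ?K"
        using c refl[OF cM] by (intro set_distance_leI[of c]) auto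
      ultimately have "c \<in> Z" using c cM by (simp add: Z_def boundary_nbhd_def)
      then show False using c by blast
    qed
    have cX: "0 < real (card X)" using X by (simp add: card_gt_0_iff)
    have "card Z \<le> card ?N" unfolding Z_def using finN by (intro card_mono) auto
    then have Zb: "card Z / card X \<le> 1 / Suc k" using bd cX by (simp add: divide_le_eq)
    have "\<exists>D B. hermitian_matrix ?H D B \<and> (\<forall>m<D. row_sum D B m \<le> R) \<and>
      (\<forall>n\<le>2 * k. \<bar>trace_moment ?H D B n / card X - trace_moment G d A n\<bar>
        \<le> 2 * real d * R ^ n * (card Z / card X))"
    proof (rule folner_section[OF U hA R R0 refl tri inv K X])
      show "Z \<subseteq> X" by (simp add: Z_def)
    qed (assumption | rule good)+
    then obtain D B where DB: "hermitian_matrix ?H D B" "\<forall>m<D. row_sum D B m \<le> R"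
      "\<And>n. n \<le> 2 * k \<Longrightarrow> \<bar>trace_moment ?H D B n / card X - trace_moment G d A n\<bar>
        \<le> 2 * real d * R ^ n * (card Z / card X)"
      by blast
    have "\<bar>1 / card X * trace_moment ?H D B n - trace_moment G d A n\<bar> \<le> 2 * real d * R ^ n * (1 / Suc k)"
      if "n \<le> 2 * k" for n
    proof -
      have "2 * real d * R ^ n * (card Z / card X) \<le> 2 * real d * R ^ n * (1 / Suc k)"
        using Zb R0 by (intro mult_left_mono) auto
      then show ?thesis using DB(3)[OF that] by simp
    qed
    then show ?thesis using DB(1,2) cX by (intro exI[of _ D] exI[of _ B] exI[of _ "1 / card X"]) auto
  qed
  then obtain D B c where DB: "\<And>k. hermitian_matrix ?H (D k) (B k)"
    "\<And>k m. m < D k \<Longrightarrow> row_sum (D k) (B k) m \<le> R" "\<And>k. (0::real) < c k"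
    "\<And>k n. n \<le> 2 * k \<Longrightarrow> \<bar>c k * trace_moment ?H (D k) (B k) n - trace_moment G d A n\<bar> \<le> 2 * real d * R ^ n * (1 / Suc k)"
    by metis
  show "0 \<le> ln_det G d (matrix_op G d A)"
  proof (rule determinant_from_approximation[where H="\<lambda>_. ?H" and D=D and B=B and c=c and R=R])
    show "group ?H" by (rule subgroup.subgroup_is_group[OF normal_imp_subgroup[OF U] G])
    show "(\<lambda>k. c k * trace_moment ?H (D k) (B k) (2 * n)) \<longlonglongrightarrow> trace_moment G d A (2 * n)" for n
    proof (rule LIM_zero_cancel, rule Lim_null_comparison)
      show "\<forall>\<^sub>F k in sequentially. norm (c k * trace_moment ?H (D k) (B k) (2 * n) - trace_moment G d A (2 * n))
          \<le> 2 * real d * R ^ (2 * n) * (1 / Suc k)"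
        using eventually_ge_at_top[of n]
      proof eventually_elim
        case (elim k)
        then show ?case using DB(4)[of "2 * n" k] by simp
      qed
      show "(\<lambda>k. 2 * real d * R ^ (2 * n) * (1 / real (Suc k))) \<longlonglongrightarrow> 0"
        using tendsto_mult_left[OF LIMSEQ_inverse_real_of_nat, of "2 * real d * R ^ (2 * n)"]
        by (simp add: inverse_eq_divide)
    qed
  qed (use A pos sid DB in auto)
qed

theorem theorem1p21:
  shows "(\<forall>(I :: 'i set) r (G :: 'i \<Rightarrow> 'a monoid) \<phi> (\<pi> :: 'b monoid).
            direct_system I r G \<phi> \<longrightarrow> (\<forall>i\<in>I. semi_integral_determinant (G i)) \<longrightarrow>
            group \<pi> \<longrightarrow> \<pi> \<cong> direct_limit I r G \<phi> \<longrightarrow> semi_integral_determinant \<pi>) \<and>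
         (\<forall>(I :: 'i set) r (G :: 'i \<Rightarrow> 'a monoid) \<phi> (\<pi> :: 'b monoid).
            inverse_system I r G \<phi> \<longrightarrow> (\<forall>i\<in>I. semi_integral_determinant (G i)) \<longrightarrow>
            group \<pi> \<longrightarrow> \<pi> \<cong> inverse_limit I r G \<phi> \<longrightarrow> semi_integral_determinant \<pi>) \<and>
         (\<forall>(\<pi> :: 'b monoid) H.
            group \<pi> \<longrightarrow> subgroup H \<pi> \<longrightarrow> semi_integral_determinant \<pi> \<longrightarrow>
            semi_integral_determinant (\<pi>\<lparr>carrier := H\<rparr>)) \<and>
         (\<forall>(\<pi> :: 'b monoid) U.
            group \<pi> \<longrightarrow> U \<lhd> \<pi> \<longrightarrow> semi_integral_determinant (\<pi>\<lparr>carrier := U\<rparr>) \<longrightarrow>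
            amenable_homogeneous_space \<pi> U \<longrightarrow> semi_integral_determinant \<pi>)"
proof (intro conjI allI impI)
  fix I :: "'i set" and r and G :: "'i \<Rightarrow> 'a monoid" and \<phi> and \<pi> :: "'b monoid"
  assume sid: "\<forall>i\<in>I. semi_integral_determinant (G i)" and \<pi>: "group \<pi>"
  show "semi_integral_determinant \<pi>" if "direct_system I r G \<phi>" "\<pi> \<cong> direct_limit I r G \<phi>"
    by (rule semi_integral_direct_limit[OF that(1) _ \<pi> that(2)]) (use sid in blast)
  show "semi_integral_determinant \<pi>" if "inverse_system I r G \<phi>" "\<pi> \<cong> inverse_limit I r G \<phi>"
    by (rule semi_integral_inverse_limit[OF that(1) _ \<pi> that(2)]) (use sid in blast)
qed (auto intro: semi_integral_subgroup semi_integral_amenable_extension)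

end
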